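(* Let $\tau_E:E\to Q$ be a real vector bundle with an algebroid structure $(B_E,\rho^l_E,\rho^r_E)$. Let $D^l$ be a $\rho^l_E$-connection and $D^r$ a $\rho^r_E$-connection on $E$ with $B_E(\sigma,\bar\sigma)=D^l_\sigma\bar\sigma-D^r_{\bar\sigma}\sigma$ for all $\sigma,\bar\sigma\in\Gamma(\tau_E)$, let $R$ be a tensor of type $(1,3)$ on $E$, and let $(B_{\mathcal{T}_l^EE^*},\rho^l_{\mathcal{T}_l^EE^*},\rho^r_{\mathcal{T}_l^EE^*})$ be the associated algebroid structure on the left $E$-tangent bundle $\mathcal{T}_l^EE^*\to E^*$, with exact symplectic structure $\Omega_{\mathcal{T}_l^EE^*}=-d^{lr}_{\mathcal{T}_l^EE^*}\lambda_{\mathcal{T}_l^EE^*}$, where $\lambda_{\mathcal{T}_l^EE^*}$ is the Liouville section. Then for every Hamiltonian function $H\in C^\infty(E^* )$ the left-right Hamiltonian vector field of $H$ with respect to $\Omega_{\mathcal{T}_l^EE^*}$ coincides with the Hamiltonian vector field of $H$ with respect to $\Pi_{E^*}$: $$\mathcal{H}_H^{(\Omega_{\mathcal{T}_l^EE^*},lr)}=\mathcal{H}_H^{\Pi_{E^*}}.$$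
   Context: All objects are smooth; $\Gamma(\tau)$ is the space of sections of a vector bundle $\tau$; anchors cover the identity of the base. Algebroid structure on $\tau_{\bar E}:\bar E\to\bar Q$: an $\mathbb{R}$-bilinear bracket $B_{\bar E}$ on $\Gamma(\tau_{\bar E})$ and vector bundle morphisms $\rho^l_{\bar E},\rho^r_{\bar E}:\bar E\to T\bar Q$ with $B_{\bar E}(f\sigma,f'\sigma')=f\rho^l_{\bar E}(\sigma)(f')\sigma'-f'\rho^r_{\bar E}(\sigma')(f)\sigma+ff'B_{\bar E}(\sigma,\sigma')$ for $f,f'\in C^\infty(\bar Q)$. Tensor $\Pi_{E^*}$ and its Hamiltonian vector fields: for $\sigma\in\Gamma(\tau_E)$ let $\widehat\sigma\in C^\infty(E^* )$ be the linear function $\widehat\sigma(\kappa)=\langle\kappa,\sigma(\tau_{E^*}(\kappa))\rangle$. $\Pi_{E^*}$ is the $(2,0)$-tensor on $E^*$ whose bracket $\{\varphi,\psi\}_{\Pi_{E^*}}=\Pi_{E^*}(d\varphi,d\psi)$ satisfies $\{\widehat\sigma,\widehat{\sigma'}\}=-\widehat{B_E(\sigma,\sigma')}$, $\{\widehat\sigma,f'\circ\tau_{E^*}\}=-\rho^l_E(\sigma)(f')\circ\tau_{E^*}$, $\{f\circ\tau_{E^*},\widehat{\sigma'}\}=\rho^r_E(\sigma')(f)\circ\tau_{E^*}$, $\{f\circ\tau_{E^*},f'\circ\tau_{E^*}\}=0$. The vector field $\mathcal{H}_H^{\Pi_{E^*}}$ on $E^*$ is defined by $\mathcal{H}_H^{\Pi_{E^*}}(F)=-\{H,F\}_{\Pi_{E^*}}$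 for $F\in C^\infty(E^* )$. Connections: for a vector bundle morphism $\rho_E:E\to TQ$, a $\rho_E$-connection on $E$ is an $\mathbb{R}$-bilinear map $D:\Gamma(\tau_E)\times\Gamma(\tau_E)\to\Gamma(\tau_E)$ with $D_{f\sigma}\gamma=fD_\sigma\gamma$ and $D_\sigma(g\gamma)=\rho_E(\sigma)(g)\gamma+gD_\sigma\gamma$. It acts on $\kappa\in\Gamma(\tau_{E^*})$ by $(D_\sigma\kappa)(\gamma)=\rho_E(\sigma)(\kappa(\gamma))-\kappa(D_\sigma\gamma)$. The $D$-horizontal lift of $\sigma_q\in E_q$ at $\kappa_q\in E_q^*$ is the vector $(\sigma_q)^{D\mathbf{h}}_{\kappa_q}\in T_{\kappa_q}E^*$ characterized by $(\sigma_q)^{D\mathbf{h}}_{\kappa_q}(f\circ\tau_{E^*})=\rho_E(\sigma_q)(f)$ and $(\sigma_q)^{D\mathbf{h}}_{\kappa_q}(\widehat\gamma)=\kappa_q(D_{\sigma_q}\gamma)$; for $\sigma\in\Gamma(\tau_E)$ it defines a vector field $\sigma^{D\mathbf{h}}$ on $E^*$. The vertical lift of $\nu\in\Gamma(\tau_{E^*})$ is the vector field $\nu^{\mathbf{v}}$ on $E^*$ with $\nu^{\mathbf{v}}(f\circ\tau_{E^*})=0$, $\nu^{\mathbf{v}}(\widehat\gamma)=\nu(\gamma)\circ\tau_{E^*}$. The vertical lift of a $(1,1)$-tensor $S:\Gamma(\tau_E)\to\Gamma(\tau_E)$ is the vector field $S^{\mathbf{v}}$ on $E^*$ with $S^{\mathbf{v}}(f\circ\tau_{E^*})=0$,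 $S^{\mathbf{v}}(\widehat\gamma)=\widehat{S(\gamma)}$. A $(1,3)$-tensor on $E$ is a $C^\infty(Q)$-trilinear map $R:\Gamma(\tau_E)^3\to\Gamma(\tau_E)$; $R(\sigma,\bar\sigma,\cdot)$ is then a $(1,1)$-tensor. The bundle $\mathcal{T}_l^EE^*\to E^*$ has fiber at $\kappa_q\in E_q^*$ equal to $\{(\sigma_q,\tilde X_{\kappa_q})\in E_q\times T_{\kappa_q}E^*:\rho^l_E(\sigma_q)=(T_{\kappa_q}\tau_{E^*})(\tilde X_{\kappa_q})\}$. Sections of it: $\sigma^{(D^l)\mathbf{h}}_l=(\sigma,\sigma^{D^l\mathbf{h}})$, $\nu^{\mathbf{v}}_l=(0,\nu^{\mathbf{v}})$, $S^{\mathbf{v}}_l=(0,S^{\mathbf{v}})$. Associated algebroid structure on $\mathcal{T}_l^EE^*$: the anchors are $\rho^l_{\mathcal{T}_l^EE^*}(\sigma_q,\tilde X_{\kappa_q})=\tilde X_{\kappa_q}$ and $\rho^r_{\mathcal{T}_l^EE^*}(\sigma_q,\tilde X_{\kappa_q})=\tilde X_{\kappa_q}-(\sigma_q)^{D^l\mathbf{h}}_{\kappa_q}+(\sigma_q)^{D^r\mathbf{h}}_{\kappa_q}$, and the bracket is the unique one compatible with these anchors such that, for $\sigma,\bar\sigma\in\Gamma(\tau_E)$, $\kappa,\nu\in\Gamma(\tau_{E^*})$: $$B_{\mathcal{T}_l^EE^*}(\sigma^{(D^l)\mathbf{h}}_l,\bar\sigma^{(D^l)\mathbf{h}}_l)=B_E(\sigma,\bar\sigma)^{(D^l)\mathbf{h}}_l+R(\sigma,\bar\sigma,\cdot)^{\mathbf{v}}_l,\quad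 B_{\mathcal{T}_l^EE^*}(\sigma^{(D^l)\mathbf{h}}_l,\nu^{\mathbf{v}}_l)=(D^l_\sigma\nu)^{\mathbf{v}}_l,$$ $$B_{\mathcal{T}_l^EE^*}(\kappa^{\mathbf{v}}_l,\bar\sigma^{(D^l)\mathbf{h}}_l)=-(D^r_{\bar\sigma}\kappa)^{\mathbf{v}}_l,\quad B_{\mathcal{T}_l^EE^*}(\kappa^{\mathbf{v}}_l,\nu^{\mathbf{v}}_l)=0.$$ Liouville section: $\lambda_{\mathcal{T}_l^EE^*}(\kappa_q)(\sigma_q,\tilde X_{\kappa_q})=\kappa_q(\sigma_q)$. Differentials on an algebroid $\bar E\to\bar Q$: $(d^r_{\bar E}F)(\sigma)=\rho^r_{\bar E}(\sigma)(F)$ for $F\in C^\infty(\bar Q)$, and $(d^{lr}_{\bar E}\kappa)(\sigma,\sigma')=\rho^l_{\bar E}(\sigma)(\kappa(\sigma'))-\rho^r_{\bar E}(\sigma')(\kappa(\sigma))-\kappa(B_{\bar E}(\sigma,\sigma'))$ for $\kappa\in\Gamma(\tau_{\bar E^*})$. An algebroid is exact symplectic, with exact symplectic structure $\Omega_{\bar E}=-d^{lr}_{\bar E}\lambda_{\bar E}$, if this $(0,2)$-tensor is skew-symmetric and nondegenerate for the given $\lambda_{\bar E}\in\Gamma(\tau_{\bar E^*})$; the tensor $\Omega_{\mathcal{T}_l^EE^*}$ has this property. Left-right Hamiltonian vector field: on an exact symplectic algebroid $\bar E\to\bar Q$, for $\bar H\in C^\infty(\bar Q)$ the right Hamiltonian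 section $\mathcal{H}^{(\Omega_{\bar E},r)}_{\bar H}\in\Gamma(\tau_{\bar E})$ is the unique section $X$ with $\Omega_{\bar E}(X,\cdot)=d^r_{\bar E}\bar H$, and $\mathcal{H}^{(\Omega_{\bar E},lr)}_{\bar H}=\rho^l_{\bar E}(\mathcal{H}^{(\Omega_{\bar E},r)}_{\bar H})\in\mathfrak{X}(\bar Q)$. *)

theory Defs
  imports "HOL-Analysis.Analysis" "HOL-Library.Function_Algebras"
begin

section \<open>Linear algebra and calculus\<close>

text \<open>Pointwise scalar multiplication; the additive structure on functions is the one of
  \<^verbatim>\<open>Function_Algebras\<close>.\<close>

instantiation "fun" :: (type, real_vector) real_vector
begin

definition scaleR_fun_def: "scaleR c f = (\<lambda>x. c *\<^sub>R f x)"

instance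
  by standard (simp_all add: scaleR_fun_def fun_eq_iff scaleR_add_right scaleR_add_left)

end

text \<open>The model spaces of charts: finite-dimensional inner product spaces. In contrast to
  \<^class>\<open>euclidean_space\<close>, dimension 0 is allowed, so that for instance an algebroid over a
  point (an algebra) is covered.\<close>

class fd_inner = real_inner +
  assumes finite_dimensional: "\<exists>B. finite B \<and> (\<forall>x. \<exists>c. x = (\<Sum>b\<in>B. c b *\<^sub>R b))"

subclass (in euclidean_space) fd_inner
proof
  show "\<exists>B. finite B \<and> (\<forall>x::'a. \<exists>c. x = (\<Sum>b\<in>B. c b *\<^sub>R b))"
    by (intro exI[of _ Basis] conjI finite_Basis allI) (metis euclidean_representation)
qed

definition linear_on_set :: "'a::real_vector set \<Rightarrow> ('a \<Rightarrow> 'b::real_vector) \<Rightarrow> bool" where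
  "linear_on_set V f \<longleftrightarrow>
     (\<forall>x\<in>V. \<forall>y\<in>V. f (x + y) = f x + f y) \<and> (\<forall>c. \<forall>x\<in>V. f (c *\<^sub>R x) = c *\<^sub>R f x)"

definition bilinear_on_set :: "'a::real_vector set \<Rightarrow> ('a \<Rightarrow> 'a \<Rightarrow> 'b::real_vector) \<Rightarrow> bool" where
  "bilinear_on_set V B \<longleftrightarrow>
     (\<forall>x\<in>V. linear_on_set V (B x)) \<and> (\<forall>y\<in>V. linear_on_set V (\<lambda>x. B x y))"

text \<open>Functionals on \<^term>\<open>V\<close>, made unique as functions by the value 0 off \<^term>\<open>V\<close>.\<close>

definition dual_space :: "'a::real_vector set \<Rightarrow> ('a \<Rightarrow> real) set" where
  "dual_space V = {\<alpha>. linear_on_set V \<alpha> \<and> (\<forall>x. x \<notin> V \<longrightarrow> \<alpha> x = 0)}"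

definition riesz :: "('c::real_inner \<Rightarrow> real) \<Rightarrow> 'c" where
  "riesz \<alpha> = (THE w. \<forall>c. \<alpha> c = inner w c)"

text \<open>On an open subset of a finite-dimensional space.\<close>

primrec Ck_on :: "nat \<Rightarrow> 'a::real_normed_vector set \<Rightarrow> ('a \<Rightarrow> 'b::real_normed_vector) \<Rightarrow> bool" where
  "Ck_on 0 S f \<longleftrightarrow> continuous_on S f"
| "Ck_on (Suc k) S f \<longleftrightarrow> (\<forall>x\<in>S. f differentiable (at x)) \<and>
     (\<forall>v. Ck_on k S (\<lambda>x. frechet_derivative f (at x) v))"

definition smooth_on :: "'a::real_normed_vector set \<Rightarrow> ('a \<Rightarrow> 'b::real_normed_vector) \<Rightarrow> bool" where
  "smooth_on S f \<longleftrightarrow> (\<forall>k. Ck_on k S f)"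


section \<open>Manifolds, tangent vectors, vector fields\<close>

text \<open>A manifold is given by its atlas, a set of pairs (domain, chart map); its points are
  those covered by the domains, and its topology is the one making all charts homeomorphisms
  onto open sets.\<close>

type_synonym ('a, 'm) atlas = "('a set \<times> ('a \<Rightarrow> 'm)) set"

definition points :: "('a, 'm) atlas \<Rightarrow> 'a set" where
  "points M = \<Union>(fst ` M)"

definition mtop :: "('a, 'm::real_normed_vector) atlas \<Rightarrow> 'a topology" where
  "mtop M = topology (\<lambda>W. W \<subseteq> points M \<and> (\<forall>(U, \<phi>)\<in>M. open (\<phi> ` (U \<inter> W))))"

definition smooth_manifold :: "('a, 'm::fd_inner) atlas \<Rightarrow> bool" where
  "smooth_manifold M \<longleftrightarrow>
     (\<forall>(U, \<phi>)\<in>M. inj_on \<phi> U \<and> open (\<phi> ` U)) \<and>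
     (\<forall>(U, \<phi>)\<in>M. \<forall>(V, \<psi>)\<in>M. open (\<phi> ` (U \<inter> V)) \<and> smooth_on (\<phi> ` (U \<inter> V)) (\<psi> \<circ> inv_into U \<phi>)) \<and>
     Hausdorff_space (mtop M) \<and> second_countable (mtop M)"

definition msmooth_on ::
    "('a, 'm::real_normed_vector) atlas \<Rightarrow> 'a set \<Rightarrow> ('a \<Rightarrow> 'v::real_normed_vector) \<Rightarrow> bool" where
  "msmooth_on M W f \<longleftrightarrow> (\<forall>(U, \<phi>)\<in>M. smooth_on (\<phi> ` (U \<inter> W)) (f \<circ> inv_into U \<phi>))"

text \<open>The values of the functions in \<^term>\<open>Cinf M\<close> off \<^term>\<open>points M\<close> are arbitrary and
  never matter (in particular, tangent vectors as defined below do not depend on them, by the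
  product rule applied with the indicator function of the complement of \<^term>\<open>points M\<close>). Sections
  and vector fields, on the other hand, are set to 0 off \<^term>\<open>points M\<close>, so that they are equal
  as functions iff they agree on \<^term>\<open>points M\<close>.\<close>

definition Cinf :: "('a, 'm::real_normed_vector) atlas \<Rightarrow> ('a \<Rightarrow> real) set" where
  "Cinf M = {f. msmooth_on M (points M) f}"

text \<open>Tangent vectors are derivations of \<^term>\<open>Cinf M\<close> at a point.\<close>

type_synonym 'a tvec = "('a \<Rightarrow> real) \<Rightarrow> real"

definition tangent_space :: "('a, 'm::real_normed_vector) atlas \<Rightarrow> 'a \<Rightarrow> 'a tvec set" where
  "tangent_space M p = {v \<in> dual_space (Cinf M).
     \<forall>f\<in>Cinf M. \<forall>g\<in>Cinf M. v (\<lambda>x. f x * g x) = f p * v g + g p * v f}"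

definition vector_fields :: "('a, 'm::real_normed_vector) atlas \<Rightarrow> ('a \<Rightarrow> 'a tvec) set" where
  "vector_fields M = {X. (\<forall>p\<in>points M. X p \<in> tangent_space M p) \<and> (\<forall>p. p \<notin> points M \<longrightarrow> X p = 0) \<and>
     (\<forall>f\<in>Cinf M. (\<lambda>p. X p f) \<in> Cinf M)}"

text \<open>The tangent map of \<^term>\<open>h\<close>, a smooth map into \<^term>\<open>M\<close>.\<close>

definition tangent_map :: "('b, 'm::real_normed_vector) atlas \<Rightarrow> ('a \<Rightarrow> 'b) \<Rightarrow> 'a tvec \<Rightarrow> 'b tvec" where
  "tangent_map M h v = (\<lambda>f. if f \<in> Cinf M then v (f \<circ> h) else 0)"

definition differential :: "('a, 'm::real_normed_vector) atlas \<Rightarrow> ('a \<Rightarrow> real) \<Rightarrow> 'a \<Rightarrow> 'a tvec \<Rightarrow> real" where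
  "differential M f p = (\<lambda>v. if v \<in> tangent_space M p then v f else 0)"

text \<open>A (2,0)-tensor: pointwise bilinear on cotangent spaces. As the differentials of global
  functions span the cotangent spaces, smoothness is tested on these.\<close>

definition tensor_2_0 ::
    "('a, 'm::real_normed_vector) atlas \<Rightarrow> ('a \<Rightarrow> ('a tvec \<Rightarrow> real) \<Rightarrow> ('a tvec \<Rightarrow> real) \<Rightarrow> real) \<Rightarrow> bool" where
  "tensor_2_0 M P \<longleftrightarrow>
     (\<forall>p\<in>points M. bilinear_on_set (dual_space (tangent_space M p)) (P p)) \<and>
     (\<forall>f\<in>Cinf M. \<forall>g\<in>Cinf M. (\<lambda>p. P p (differential M f p) (differential M g p)) \<in> Cinf M)"

definition tensor_bracket ::
    "('a, 'm::real_normed_vector) atlas \<Rightarrow> ('a \<Rightarrow> ('a tvec \<Rightarrow> real) \<Rightarrow> ('a tvec \<Rightarrow> real) \<Rightarrow> real) \<Rightarrow>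
     ('a \<Rightarrow> real) \<Rightarrow> ('a \<Rightarrow> real) \<Rightarrow> 'a \<Rightarrow> real" where
  "tensor_bracket M P f g = (\<lambda>p. P p (differential M f p) (differential M g p))"

definition tensor_hamiltonian_field ::
    "('a, 'm::real_normed_vector) atlas \<Rightarrow> ('a \<Rightarrow> ('a tvec \<Rightarrow> real) \<Rightarrow> ('a tvec \<Rightarrow> real) \<Rightarrow> real) \<Rightarrow>
     ('a \<Rightarrow> real) \<Rightarrow> 'a \<Rightarrow> 'a tvec" where
  "tensor_hamiltonian_field M P H =
     (\<lambda>p F. if p \<in> points M \<and> F \<in> Cinf M then - tensor_bracket M P H F p else 0)"


section \<open>Vector bundles\<close>

text \<open>The fibre over \<^term>\<open>q\<close> is a linear subspace of a real vector space, which may have any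
  dimension, carries no topology, and only serves to provide the linear structures of the
  fibres; this is no restriction, since any family of vector spaces embeds into its direct
  sum. A local trivialization is a pair of an open set \<^term>\<open>U\<close> and a family of linear
  isomorphisms from the fibres over \<^term>\<open>U\<close> to the model fibre.\<close>

record ('q, 'b, 'e, 'c) vbundle =
  base :: "('q, 'b) atlas"
  fibre :: "'q \<Rightarrow> 'e set"
  trivs :: "('q set \<times> ('q \<Rightarrow> 'e \<Rightarrow> 'c)) set"

definition vector_bundle :: "('q, 'b::fd_inner, 'e::real_vector, 'c::fd_inner) vbundle \<Rightarrow> bool" where
  "vector_bundle E \<longleftrightarrow> smooth_manifold (base E) \<and>
     (\<forall>q\<in>points (base E). subspace (fibre E q)) \<and>
     \<Union>(fst ` trivs E) = points (base E) \<and>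
     (\<forall>(U, \<Phi>)\<in>trivs E. openin (mtop (base E)) U \<and>
        (\<forall>q\<in>U. linear_on_set (fibre E q) (\<Phi> q) \<and> bij_betw (\<Phi> q) (fibre E q) UNIV)) \<and>
     (\<forall>(U, \<Phi>)\<in>trivs E. \<forall>(V, \<Psi>)\<in>trivs E. \<forall>w.
        msmooth_on (base E) (U \<inter> V) (\<lambda>q. \<Psi> q (inv_into (fibre E q) (\<Phi> q) w)))"

text \<open>Smooth sections of \<^term>\<open>E\<close> along a smooth map \<^term>\<open>h\<close> from \<^term>\<open>N\<close> to the base.\<close>

definition sections_along ::
    "('n, 'm::real_normed_vector) atlas \<Rightarrow> ('n \<Rightarrow> 'q) \<Rightarrow>
     ('q, 'b, 'e::real_vector, 'c::real_normed_vector) vbundle \<Rightarrow> ('n \<Rightarrow> 'e) set" where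
  "sections_along N h E = {s. (\<forall>x\<in>points N. s x \<in> fibre E (h x)) \<and> (\<forall>x. x \<notin> points N \<longrightarrow> s x = 0) \<and>
     (\<forall>(U, \<Phi>)\<in>trivs E. msmooth_on N {x \<in> points N. h x \<in> U} (\<lambda>x. \<Phi> (h x) (s x)))}"

definition sections ::
    "('q, 'b::real_normed_vector, 'e::real_vector, 'c::real_normed_vector) vbundle \<Rightarrow> ('q \<Rightarrow> 'e) set" where
  "sections E = sections_along (base E) (\<lambda>q. q) E"

text \<open>Local trivializations of the dual bundle are the inverse transposes of those of \<^term>\<open>E\<close>,
  where the model fibre is identified with its dual by the inner product.\<close>

definition dual_bundle ::
    "('q, 'b, 'e::real_vector, 'c::real_inner) vbundle \<Rightarrow> ('q, 'b, 'e \<Rightarrow> real, 'c) vbundle" where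
  "dual_bundle E = \<lparr>base = base E, fibre = (\<lambda>q. dual_space (fibre E q)),
     trivs = {(U, \<lambda>q \<alpha>. riesz (\<alpha> \<circ> inv_into (fibre E q) (\<Phi> q))) | U \<Phi>. (U, \<Phi>) \<in> trivs E}\<rparr>"

text \<open>The total space as a manifold; its points are the pairs \<^term>\<open>(q, e)\<close> with \<^term>\<open>e\<close> in the
  fibre over \<^term>\<open>q\<close>, and the bundle projection is \<^term>\<open>fst\<close>.\<close>

definition total_space ::
    "('q, 'b, 'e, 'c) vbundle \<Rightarrow> ('q \<times> 'e, 'b \<times> 'c) atlas" where
  "total_space E = {({(q, e). q \<in> U \<inter> V \<and> e \<in> fibre E q}, \<lambda>(q, e). (\<phi> q, \<Phi> q e)) | U \<phi> V \<Phi>.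
     (U, \<phi>) \<in> base E \<and> (V, \<Phi>) \<in> trivs E}"

definition fmul :: "('q \<Rightarrow> real) \<Rightarrow> ('q \<Rightarrow> 'e::real_vector) \<Rightarrow> 'q \<Rightarrow> 'e" where
  "fmul f s = (\<lambda>q. f q *\<^sub>R s q)"


section \<open>Algebroids\<close>

text \<open>In this section a vector bundle enters through its base manifold \<^term>\<open>M\<close>, its fibres
  \<^term>\<open>Fib\<close> and its space \<^term>\<open>G\<close> of smooth sections.\<close>

definition apply_anchor ::
    "('a, 'm) atlas \<Rightarrow> ('a \<Rightarrow> 'e \<Rightarrow> 'a tvec) \<Rightarrow> ('a \<Rightarrow> 'e) \<Rightarrow> 'a \<Rightarrow> 'a tvec" where
  "apply_anchor M \<rho> s = (\<lambda>p. if p \<in> points M then \<rho> p (s p) else 0)"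

text \<open>Vector bundle morphisms to the tangent bundle over the identity (a fibrewise linear map is
  smooth iff it maps smooth sections to smooth sections).\<close>

definition anchor ::
    "('a, 'm::real_normed_vector) atlas \<Rightarrow> ('a \<Rightarrow> 'e::real_vector set) \<Rightarrow> ('a \<Rightarrow> 'e) set \<Rightarrow>
     ('a \<Rightarrow> 'e \<Rightarrow> 'a tvec) \<Rightarrow> bool" where
  "anchor M Fib G \<rho> \<longleftrightarrow>
     (\<forall>p\<in>points M. linear_on_set (Fib p) (\<rho> p) \<and> \<rho> p ` Fib p \<subseteq> tangent_space M p) \<and>
     (\<forall>s\<in>G. apply_anchor M \<rho> s \<in> vector_fields M)"

definition algebroid ::
    "('a, 'm::real_normed_vector) atlas \<Rightarrow> ('a \<Rightarrow> 'e::real_vector set) \<Rightarrow> ('a \<Rightarrow> 'e) set \<Rightarrow>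
     (('a \<Rightarrow> 'e) \<Rightarrow> ('a \<Rightarrow> 'e) \<Rightarrow> 'a \<Rightarrow> 'e) \<Rightarrow> ('a \<Rightarrow> 'e \<Rightarrow> 'a tvec) \<Rightarrow> ('a \<Rightarrow> 'e \<Rightarrow> 'a tvec) \<Rightarrow> bool" where
  "algebroid M Fib G B \<rho>l \<rho>r \<longleftrightarrow>
     anchor M Fib G \<rho>l \<and> anchor M Fib G \<rho>r \<and>
     (\<forall>s\<in>G. \<forall>t\<in>G. B s t \<in> G) \<and> bilinear_on_set G B \<and>
     (\<forall>f\<in>Cinf M. \<forall>g\<in>Cinf M. \<forall>s\<in>G. \<forall>t\<in>G. \<forall>p\<in>points M.
        B (fmul f s) (fmul g t) p =
          (f p * \<rho>l p (s p) g) *\<^sub>R t p - (g p * \<rho>r p (t p) f) *\<^sub>R s p + (f p * g p) *\<^sub>R B s t p)"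

definition d_r ::
    "('a \<Rightarrow> 'e \<Rightarrow> 'a tvec) \<Rightarrow> ('a \<Rightarrow> real) \<Rightarrow> ('a \<Rightarrow> 'e) \<Rightarrow> 'a \<Rightarrow> real" where
  "d_r \<rho>r F s = (\<lambda>p. \<rho>r p (s p) F)"

definition d_lr ::
    "(('a \<Rightarrow> 'e) \<Rightarrow> ('a \<Rightarrow> 'e) \<Rightarrow> 'a \<Rightarrow> 'e) \<Rightarrow> ('a \<Rightarrow> 'e \<Rightarrow> 'a tvec) \<Rightarrow> ('a \<Rightarrow> 'e \<Rightarrow> 'a tvec) \<Rightarrow>
     ('a \<Rightarrow> 'e \<Rightarrow> real) \<Rightarrow> ('a \<Rightarrow> 'e) \<Rightarrow> ('a \<Rightarrow> 'e) \<Rightarrow> 'a \<Rightarrow> real" where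
  "d_lr B \<rho>l \<rho>r \<kappa> s t = (\<lambda>p. \<rho>l p (s p) (\<lambda>x. \<kappa> x (t x)) - \<rho>r p (t p) (\<lambda>x. \<kappa> x (s x)) - \<kappa> p (B s t p))"

definition right_hamiltonian_section ::
    "('a, 'm) atlas \<Rightarrow> ('a \<Rightarrow> 'e) set \<Rightarrow> (('a \<Rightarrow> 'e) \<Rightarrow> ('a \<Rightarrow> 'e) \<Rightarrow> 'a \<Rightarrow> real) \<Rightarrow>
     ('a \<Rightarrow> 'e \<Rightarrow> 'a tvec) \<Rightarrow> ('a \<Rightarrow> real) \<Rightarrow> 'a \<Rightarrow> 'e" where
  "right_hamiltonian_section M G \<Omega> \<rho>r H =
     (THE X. X \<in> G \<and> (\<forall>Y\<in>G. \<forall>p\<in>points M. \<Omega> X Y p = d_r \<rho>r H Y p))"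

definition lr_hamiltonian_field ::
    "('a, 'm) atlas \<Rightarrow> ('a \<Rightarrow> 'e) set \<Rightarrow> (('a \<Rightarrow> 'e) \<Rightarrow> ('a \<Rightarrow> 'e) \<Rightarrow> 'a \<Rightarrow> real) \<Rightarrow>
     ('a \<Rightarrow> 'e \<Rightarrow> 'a tvec) \<Rightarrow> ('a \<Rightarrow> 'e \<Rightarrow> 'a tvec) \<Rightarrow> ('a \<Rightarrow> real) \<Rightarrow> 'a \<Rightarrow> 'a tvec" where
  "lr_hamiltonian_field M G \<Omega> \<rho>l \<rho>r H = apply_anchor M \<rho>l (right_hamiltonian_section M G \<Omega> \<rho>r H)"

abbreviation algebroid_on ::
    "('q, 'b::real_normed_vector, 'e::real_vector, 'c::real_normed_vector) vbundle \<Rightarrow>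
     (('q \<Rightarrow> 'e) \<Rightarrow> ('q \<Rightarrow> 'e) \<Rightarrow> 'q \<Rightarrow> 'e) \<Rightarrow> ('q \<Rightarrow> 'e \<Rightarrow> 'q tvec) \<Rightarrow> ('q \<Rightarrow> 'e \<Rightarrow> 'q tvec) \<Rightarrow> bool" where
  "algebroid_on E \<equiv> algebroid (base E) (fibre E) (sections E)"


section \<open>Tensors and connections on a vector bundle\<close>

definition tensor_1_3 ::
    "('q, 'b::real_normed_vector, 'e::real_vector, 'c::real_normed_vector) vbundle \<Rightarrow>
     (('q \<Rightarrow> 'e) \<Rightarrow> ('q \<Rightarrow> 'e) \<Rightarrow> ('q \<Rightarrow> 'e) \<Rightarrow> 'q \<Rightarrow> 'e) \<Rightarrow> bool" where
  "tensor_1_3 E R \<longleftrightarrow>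
     (\<forall>s\<in>sections E. \<forall>t\<in>sections E. \<forall>u\<in>sections E. R s t u \<in> sections E \<and>
        (\<forall>s'\<in>sections E. R (s + s') t u = R s t u + R s' t u) \<and>
        (\<forall>t'\<in>sections E. R s (t + t') u = R s t u + R s t' u) \<and>
        (\<forall>u'\<in>sections E. R s t (u + u') = R s t u + R s t u') \<and>
        (\<forall>f\<in>Cinf (base E). R (fmul f s) t u = fmul f (R s t u) \<and>
           R s (fmul f t) u = fmul f (R s t u) \<and> R s t (fmul f u) = fmul f (R s t u)))"

definition connection ::
    "('q, 'b::real_normed_vector, 'e::real_vector, 'c::real_normed_vector) vbundle \<Rightarrow>
     ('q \<Rightarrow> 'e \<Rightarrow> 'q tvec) \<Rightarrow> (('q \<Rightarrow> 'e) \<Rightarrow> ('q \<Rightarrow> 'e) \<Rightarrow> 'q \<Rightarrow> 'e) \<Rightarrow> bool" where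
  "connection E \<rho> D \<longleftrightarrow>
     (\<forall>s\<in>sections E. \<forall>t\<in>sections E. D s t \<in> sections E) \<and> bilinear_on_set (sections E) D \<and>
     (\<forall>f\<in>Cinf (base E). \<forall>s\<in>sections E. \<forall>t\<in>sections E.
        D (fmul f s) t = fmul f (D s t) \<and>
        D s (fmul f t) = fmul (\<lambda>q. apply_anchor (base E) \<rho> s q f) t + fmul f (D s t))"

definition dual_connection ::
    "('q, 'b::real_normed_vector, 'e::real_vector, 'c::real_inner) vbundle \<Rightarrow>
     ('q \<Rightarrow> 'e \<Rightarrow> 'q tvec) \<Rightarrow> (('q \<Rightarrow> 'e) \<Rightarrow> ('q \<Rightarrow> 'e) \<Rightarrow> 'q \<Rightarrow> 'e) \<Rightarrow>
     ('q \<Rightarrow> 'e) \<Rightarrow> ('q \<Rightarrow> 'e \<Rightarrow> real) \<Rightarrow> 'q \<Rightarrow> 'e \<Rightarrow> real" where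
  "dual_connection E \<rho> D s \<kappa> = (THE \<nu>. \<nu> \<in> sections (dual_bundle E) \<and>
     (\<forall>t\<in>sections E. \<forall>q\<in>points (base E). \<nu> q (t q) = \<rho> q (s q) (\<lambda>x. \<kappa> x (t x)) - \<kappa> q (D s t q)))"


section \<open>Functions and vector fields on the dual bundle\<close>

abbreviation dual_total ::
    "('q, 'b, 'e::real_vector, 'c::real_inner) vbundle \<Rightarrow> ('q \<times> ('e \<Rightarrow> real), 'b \<times> 'c) atlas" where
  "dual_total E \<equiv> total_space (dual_bundle E)"

definition hat :: "('q \<Rightarrow> 'e) \<Rightarrow> 'q \<times> ('e \<Rightarrow> real) \<Rightarrow> real" where
  "hat s = (\<lambda>(q, \<kappa>). \<kappa> (s q))"

definition Pi_tensor ::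
    "('q, 'b::real_normed_vector, 'e::real_vector, 'c::real_inner) vbundle \<Rightarrow>
     (('q \<Rightarrow> 'e) \<Rightarrow> ('q \<Rightarrow> 'e) \<Rightarrow> 'q \<Rightarrow> 'e) \<Rightarrow> ('q \<Rightarrow> 'e \<Rightarrow> 'q tvec) \<Rightarrow> ('q \<Rightarrow> 'e \<Rightarrow> 'q tvec) \<Rightarrow>
     ('q \<times> ('e \<Rightarrow> real) \<Rightarrow> (('q \<times> ('e \<Rightarrow> real)) tvec \<Rightarrow> real) \<Rightarrow>
        (('q \<times> ('e \<Rightarrow> real)) tvec \<Rightarrow> real) \<Rightarrow> real) \<Rightarrow> bool" where
  "Pi_tensor E B \<rho>l \<rho>r P \<longleftrightarrow> tensor_2_0 (dual_total E) P \<and>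
     (\<forall>s\<in>sections E. \<forall>t\<in>sections E. \<forall>f\<in>Cinf (base E). \<forall>g\<in>Cinf (base E). \<forall>p\<in>points (dual_total E).
        tensor_bracket (dual_total E) P (hat s) (hat t) p = - hat (B s t) p \<and>
        tensor_bracket (dual_total E) P (hat s) (g \<circ> fst) p = - \<rho>l (fst p) (s (fst p)) g \<and>
        tensor_bracket (dual_total E) P (f \<circ> fst) (hat t) p = \<rho>r (fst p) (t (fst p)) f \<and>
        tensor_bracket (dual_total E) P (f \<circ> fst) (g \<circ> fst) p = 0)"

text \<open>The horizontal lift of \<^term>\<open>e\<close>, a vector in the fibre over \<^term>\<open>q\<close>, at the point
  \<^term>\<open>(q, \<kappa>)\<close>. The value at \<^term>\<open>q\<close> of the derivative along \<^term>\<open>e\<close> is \<^term>\<open>D s t q\<close> for any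
  section \<^term>\<open>s\<close> through \<^term>\<open>e\<close>.\<close>

definition hlift ::
    "('q, 'b::real_normed_vector, 'e::real_vector, 'c::real_inner) vbundle \<Rightarrow>
     ('q \<Rightarrow> 'e \<Rightarrow> 'q tvec) \<Rightarrow> (('q \<Rightarrow> 'e) \<Rightarrow> ('q \<Rightarrow> 'e) \<Rightarrow> 'q \<Rightarrow> 'e) \<Rightarrow>
     'q \<times> ('e \<Rightarrow> real) \<Rightarrow> 'e \<Rightarrow> ('q \<times> ('e \<Rightarrow> real)) tvec" where
  "hlift E \<rho> D = (\<lambda>(q, \<kappa>) e. THE v. v \<in> tangent_space (dual_total E) (q, \<kappa>) \<and>
     (\<forall>f\<in>Cinf (base E). v (f \<circ> fst) = \<rho> q e f) \<and>
     (\<forall>s\<in>sections E. s q = e \<longrightarrow> (\<forall>t\<in>sections E. v (hat t) = \<kappa> (D s t q))))"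

definition vlift ::
    "('q, 'b::real_normed_vector, 'e::real_vector, 'c::real_inner) vbundle \<Rightarrow>
     ('q \<Rightarrow> 'e \<Rightarrow> real) \<Rightarrow> 'q \<times> ('e \<Rightarrow> real) \<Rightarrow> ('q \<times> ('e \<Rightarrow> real)) tvec" where
  "vlift E \<nu> = (THE X. X \<in> vector_fields (dual_total E) \<and> (\<forall>p\<in>points (dual_total E).
     (\<forall>f\<in>Cinf (base E). X p (f \<circ> fst) = 0) \<and>
     (\<forall>t\<in>sections E. X p (hat t) = \<nu> (fst p) (t (fst p)))))"

definition vlift_tensor ::
    "('q, 'b::real_normed_vector, 'e::real_vector, 'c::real_inner) vbundle \<Rightarrow>
     (('q \<Rightarrow> 'e) \<Rightarrow> 'q \<Rightarrow> 'e) \<Rightarrow> 'q \<times> ('e \<Rightarrow> real) \<Rightarrow> ('q \<times> ('e \<Rightarrow> real)) tvec" where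
  "vlift_tensor E S = (THE X. X \<in> vector_fields (dual_total E) \<and> (\<forall>p\<in>points (dual_total E).
     (\<forall>f\<in>Cinf (base E). X p (f \<circ> fst) = 0) \<and>
     (\<forall>t\<in>sections E. X p (hat t) = hat (S t) p)))"


section \<open>The left tangent bundle over the dual bundle\<close>

type_synonym ('q, 'e) lt_vec = "'e \<times> ('q \<times> ('e \<Rightarrow> real)) tvec"

definition LT_fibre ::
    "('q, 'b::real_normed_vector, 'e::real_vector, 'c::real_inner) vbundle \<Rightarrow>
     ('q \<Rightarrow> 'e \<Rightarrow> 'q tvec) \<Rightarrow> 'q \<times> ('e \<Rightarrow> real) \<Rightarrow> ('q, 'e) lt_vec set" where
  "LT_fibre E \<rho>l p = {(e, v). e \<in> fibre E (fst p) \<and> v \<in> tangent_space (dual_total E) p \<and>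
     \<rho>l (fst p) e = tangent_map (base E) fst v}"

text \<open>A section is smooth iff it is smooth as a section of the ambient bundle, that is, iff both
  components are smooth.\<close>

definition LT_sections ::
    "('q, 'b::real_normed_vector, 'e::real_vector, 'c::real_inner) vbundle \<Rightarrow>
     ('q \<Rightarrow> 'e \<Rightarrow> 'q tvec) \<Rightarrow> ('q \<times> ('e \<Rightarrow> real) \<Rightarrow> ('q, 'e) lt_vec) set" where
  "LT_sections E \<rho>l = {s. (\<forall>p\<in>points (dual_total E). s p \<in> LT_fibre E \<rho>l p) \<and>
     fst \<circ> s \<in> sections_along (dual_total E) fst E \<and> snd \<circ> s \<in> vector_fields (dual_total E)}"

definition LT_hor ::
    "('q, 'b::real_normed_vector, 'e::real_vector, 'c::real_inner) vbundle \<Rightarrow>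
     ('q \<Rightarrow> 'e \<Rightarrow> 'q tvec) \<Rightarrow> (('q \<Rightarrow> 'e) \<Rightarrow> ('q \<Rightarrow> 'e) \<Rightarrow> 'q \<Rightarrow> 'e) \<Rightarrow>
     ('q \<Rightarrow> 'e) \<Rightarrow> 'q \<times> ('e \<Rightarrow> real) \<Rightarrow> ('q, 'e) lt_vec" where
  "LT_hor E \<rho>l Dl s = (\<lambda>p. if p \<in> points (dual_total E)
     then (s (fst p), hlift E \<rho>l Dl p (s (fst p))) else 0)"

definition LT_vert ::
    "('q \<times> ('e \<Rightarrow> real) \<Rightarrow> ('q \<times> ('e \<Rightarrow> real)) tvec) \<Rightarrow>
     'q \<times> ('e \<Rightarrow> real) \<Rightarrow> ('q, 'e::real_vector) lt_vec" where
  "LT_vert X = (\<lambda>p. (0, X p))"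

definition LT_anchor_l :: "'q \<times> ('e \<Rightarrow> real) \<Rightarrow> ('q, 'e) lt_vec \<Rightarrow> ('q \<times> ('e \<Rightarrow> real)) tvec" where
  "LT_anchor_l = (\<lambda>p (e, v). v)"

definition LT_anchor_r ::
    "('q, 'b::real_normed_vector, 'e::real_vector, 'c::real_inner) vbundle \<Rightarrow>
     ('q \<Rightarrow> 'e \<Rightarrow> 'q tvec) \<Rightarrow> ('q \<Rightarrow> 'e \<Rightarrow> 'q tvec) \<Rightarrow>
     (('q \<Rightarrow> 'e) \<Rightarrow> ('q \<Rightarrow> 'e) \<Rightarrow> 'q \<Rightarrow> 'e) \<Rightarrow> (('q \<Rightarrow> 'e) \<Rightarrow> ('q \<Rightarrow> 'e) \<Rightarrow> 'q \<Rightarrow> 'e) \<Rightarrow>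
     'q \<times> ('e \<Rightarrow> real) \<Rightarrow> ('q, 'e) lt_vec \<Rightarrow> ('q \<times> ('e \<Rightarrow> real)) tvec" where
  "LT_anchor_r E \<rho>l \<rho>r Dl Dr = (\<lambda>p (e, v). v - hlift E \<rho>l Dl p e + hlift E \<rho>r Dr p e)"

definition LT_algebroid ::
    "('q, 'b::real_normed_vector, 'e::real_vector, 'c::real_inner) vbundle \<Rightarrow>
     (('q \<Rightarrow> 'e) \<Rightarrow> ('q \<Rightarrow> 'e) \<Rightarrow> 'q \<Rightarrow> 'e) \<Rightarrow> ('q \<Rightarrow> 'e \<Rightarrow> 'q tvec) \<Rightarrow> ('q \<Rightarrow> 'e \<Rightarrow> 'q tvec) \<Rightarrow>
     (('q \<Rightarrow> 'e) \<Rightarrow> ('q \<Rightarrow> 'e) \<Rightarrow> 'q \<Rightarrow> 'e) \<Rightarrow> (('q \<Rightarrow> 'e) \<Rightarrow> ('q \<Rightarrow> 'e) \<Rightarrow> 'q \<Rightarrow> 'e) \<Rightarrow>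
     (('q \<Rightarrow> 'e) \<Rightarrow> ('q \<Rightarrow> 'e) \<Rightarrow> ('q \<Rightarrow> 'e) \<Rightarrow> 'q \<Rightarrow> 'e) \<Rightarrow>
     (('q \<times> ('e \<Rightarrow> real) \<Rightarrow> ('q, 'e) lt_vec) \<Rightarrow> ('q \<times> ('e \<Rightarrow> real) \<Rightarrow> ('q, 'e) lt_vec) \<Rightarrow>
        'q \<times> ('e \<Rightarrow> real) \<Rightarrow> ('q, 'e) lt_vec) \<Rightarrow> bool" where
  "LT_algebroid E B \<rho>l \<rho>r Dl Dr R BT \<longleftrightarrow>
     algebroid (dual_total E) (LT_fibre E \<rho>l) (LT_sections E \<rho>l) BT
       LT_anchor_l (LT_anchor_r E \<rho>l \<rho>r Dl Dr) \<and>
     (\<forall>s\<in>sections E. \<forall>t\<in>sections E. \<forall>\<kappa>\<in>sections (dual_bundle E). \<forall>\<nu>\<in>sections (dual_bundle E).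
        BT (LT_hor E \<rho>l Dl s) (LT_hor E \<rho>l Dl t) =
          LT_hor E \<rho>l Dl (B s t) + LT_vert (vlift_tensor E (R s t)) \<and>
        BT (LT_hor E \<rho>l Dl s) (LT_vert (vlift E \<nu>)) = LT_vert (vlift E (dual_connection E \<rho>l Dl s \<nu>)) \<and>
        BT (LT_vert (vlift E \<kappa>)) (LT_hor E \<rho>l Dl t) = - LT_vert (vlift E (dual_connection E \<rho>r Dr t \<kappa>)) \<and>
        BT (LT_vert (vlift E \<kappa>)) (LT_vert (vlift E \<nu>)) = 0)"

definition liouville :: "'q \<times> ('e \<Rightarrow> real) \<Rightarrow> ('q, 'e) lt_vec \<Rightarrow> real" where
  "liouville = (\<lambda>(q, \<kappa>) (e, v). \<kappa> e)"

definition LT_Omega ::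
    "('q, 'b::real_normed_vector, 'e::real_vector, 'c::real_inner) vbundle \<Rightarrow>
     ('q \<Rightarrow> 'e \<Rightarrow> 'q tvec) \<Rightarrow> ('q \<Rightarrow> 'e \<Rightarrow> 'q tvec) \<Rightarrow>
     (('q \<Rightarrow> 'e) \<Rightarrow> ('q \<Rightarrow> 'e) \<Rightarrow> 'q \<Rightarrow> 'e) \<Rightarrow> (('q \<Rightarrow> 'e) \<Rightarrow> ('q \<Rightarrow> 'e) \<Rightarrow> 'q \<Rightarrow> 'e) \<Rightarrow>
     (('q \<times> ('e \<Rightarrow> real) \<Rightarrow> ('q, 'e) lt_vec) \<Rightarrow> ('q \<times> ('e \<Rightarrow> real) \<Rightarrow> ('q, 'e) lt_vec) \<Rightarrow>
        'q \<times> ('e \<Rightarrow> real) \<Rightarrow> ('q, 'e) lt_vec) \<Rightarrow>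
     ('q \<times> ('e \<Rightarrow> real) \<Rightarrow> ('q, 'e) lt_vec) \<Rightarrow> ('q \<times> ('e \<Rightarrow> real) \<Rightarrow> ('q, 'e) lt_vec) \<Rightarrow>
     'q \<times> ('e \<Rightarrow> real) \<Rightarrow> real" where
  "LT_Omega E \<rho>l \<rho>r Dl Dr BT =
     (\<lambda>s t. - d_lr BT LT_anchor_l (LT_anchor_r E \<rho>l \<rho>r Dl Dr) liouville s t)"

end

theory Submission
  imports Defs
begin

text \<open>In the coordinates of a trivialization, Hadamard's lemma shows that at every point
  \<^term>\<open>p\<close> of the dual bundle each differential \<open>dH\<close> equals that of \<open>f \<circ> fst + hat t\<close> for a
  function \<^term>\<open>f\<close> on the base and a section \<^term>\<open>t\<close>. The vector \<open>t (fst p)\<close> is the fibre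
  derivative of \<^term>\<open>H\<close> at \<^term>\<open>p\<close>. By tensoriality, the symplectic form is determined by its
  values on horizontal and vertical lifts: it vanishes on two lifts of the same kind and pairs
  horizontal with vertical ones. Hence the section with components the fibre derivative of \<^term>\<open>H\<close>
  and the Hamiltonian vector field of \<^term>\<open>H\<close> with respect to the tensor satisfies the equation of the right
  Hamiltonian section, which is checked on lifts using \<open>dH = d (f \<circ> fst + hat t)\<close>, and it is the
  only solution.\<close>

section \<open>Finite-dimensional inner product spaces\<close>

text \<open>Tangent vectors are derivations of globally defined functions, so nothing can simply be
  restricted to a chart. Localization is done by multiplication with functions that are 1 at the
  point in question: the product rule, or linearity over functions, recovers the value at that
  point, and local frames become finite families of global sections that reproduce a vector up to
  such a factor. The cut-off functions live on the base, where closed balls in charts have compact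
  and hence closed images, and are pulled back to the dual bundle.

  A second obstacle is that all lifts and the Hamiltonian section are given by definite
  descriptions, which yield nothing before existence, uniqueness and smoothness are known.
  Uniqueness of lifts follows from the splitting of differentials. Existence comes from derivatives
  along lines in the fibres for vertical lifts and from the tensor itself for horizontal ones; as
  the tensor need not be skew, its two slots serve the left and the right connection separately.

  The Liouville section sees only the component in \<open>E\<close>, so brackets of lifts enter the
  symplectic form only through that component.\<close>

lemma orthonormal_extension:
  fixes B :: "'a::real_inner set"
  assumes "finite B"
  shows "\<exists>C. finite C \<and> (\<forall>c\<in>C. \<forall>d\<in>C. inner c d = (if c = d then 1 else 0)) \<and> span B \<subseteq> span C"
  using assms
proof (induction B)
  case empty
  show ?case by (rule exI[of _ "{}"]) auto
next
  case (insert a B)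
  then obtain C where C: "finite C" "\<And>c d. c \<in> C \<Longrightarrow> d \<in> C \<Longrightarrow> inner c d = (if c = d then 1 else 0)"
    "span B \<subseteq> span C" by blast
  \<comment> \<open>Gram-Schmidt step: \<open>s\<close> is the orthogonal projection of
    \<open>a\<close> to the span of \<open>C\<close>. Only a nonzero remainder \<open>a'\<close>
    yields a new basis vector, so \<open>B\<close> may be dependent.\<close>
  define s where "s = (\<Sum>c\<in>C. inner a c *\<^sub>R c)"
  define a' where "a' = a - s"
  have sC: "s \<in> span C" unfolding s_def by (intro span_sum span_scale span_base)
  have orth: "inner a' d = 0" if "d \<in> C" for d
  proof -
    have "inner s d = (\<Sum>c\<in>C. inner a c * inner c d)" by (simp add: s_def inner_sum_left)
    also have "\<dots> = (\<Sum>c\<in>C. if c = d then inner a c else 0)"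
      using C(2) that by (intro sum.cong) auto
    also have "\<dots> = inner a d" using C(1) that by simp
    finally show ?thesis by (simp add: a'_def inner_diff_left)
  qed
  show ?case
  proof (cases "a' = 0")
    case True
    then have "a \<in> span C" using sC by (simp add: a'_def)
    then have "span (insert a B) \<subseteq> span C"
      by (metis C(3) insert_subset order_trans span_minimal span_superset subspace_span)
    with C show ?thesis by blast
  next
    case False
    define u where "u = a' /\<^sub>R norm a'"
    have uu: "inner u u = 1" using False by (simp add: u_def dot_square_norm power2_eq_square)
    have ud: "inner u d = 0" "inner d u = 0" if "d \<in> C" for d
      using orth[OF that] by (simp_all add: u_def inner_commute)
    have "a = norm a' *\<^sub>R u + s" using False by (simp add: u_def a'_def)
    moreover have "norm a' *\<^sub>R u + s \<in> span (insert u C)"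
      using span_mono[OF subset_insertI[of C u]] sC by (auto intro!: span_add span_scale intro: span_base)
    ultimately have "a \<in> span (insert u C)" by simp
    moreover have "span B \<subseteq> span (insert u C)"
      using C(3) span_mono[of C "insert u C"] by auto
    ultimately have "span (insert a B) \<subseteq> span (insert u C)"
      by (metis insert_subset order_trans span_minimal span_superset subspace_span)
    moreover have "\<forall>c\<in>insert u C. \<forall>d\<in>insert u C. inner c d = (if c = d then 1 else 0)"
      using uu ud C(2) by (metis insert_iff zero_neq_one)
    ultimately show ?thesis using C(1) by (intro exI[of _ "insert u C"]) auto
  qed
qed

text \<open>Takes the place of \<open>Basis\<close> on model spaces that may have dimension 0; the
  basis is then empty.\<close>

definition onb :: "'a::fd_inner set" where
  "onb = (SOME C. finite C \<and> (\<forall>c\<in>C. \<forall>d\<in>C. inner c d = (if c = d then 1 else 0)) \<and>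
     (\<forall>x. x = (\<Sum>c\<in>C. inner x c *\<^sub>R c)))"

lemma onb_ex:
  "\<exists>C::'a::fd_inner set. finite C \<and> (\<forall>c\<in>C. \<forall>d\<in>C. inner c d = (if c = d then 1 else 0)) \<and>
     (\<forall>x. x = (\<Sum>c\<in>C. inner x c *\<^sub>R c))"
proof -
  obtain B :: "'a set" where B: "finite B" "\<And>x. \<exists>c. x = (\<Sum>b\<in>B. c b *\<^sub>R b)"
    using finite_dimensional by blast
  obtain C where C: "finite C" "\<And>c d. c \<in> C \<Longrightarrow> d \<in> C \<Longrightarrow> inner c d = (if c = d then 1 else 0)"
    "span B \<subseteq> span C"
    using orthonormal_extension[OF B(1)] by blast
  have "x = (\<Sum>c\<in>C. inner x c *\<^sub>R c)" for x
  proof -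
    obtain c where "x = (\<Sum>b\<in>B. c b *\<^sub>R b)" using B(2) by blast
    then have "x \<in> span B" by (simp add: span_sum span_scale span_base)
    then have "x \<in> span C" using C(3) by blast
    then obtain u where u: "x = (\<Sum>c\<in>C. u c *\<^sub>R c)" using span_finite[OF C(1)] by auto
    have "inner x d = u d" if "d \<in> C" for d
    proof -
      have "inner x d = (\<Sum>c\<in>C. u c * inner c d)" by (simp add: u inner_sum_left)
      also have "\<dots> = (\<Sum>c\<in>C. if c = d then u c else 0)"
        using C(2) that by (intro sum.cong) auto
      finally show ?thesis using C(1) that by simp
    qed
    with u show ?thesis by simp
  qed
  with C show ?thesis by blast
qed

lemma finite_onb [simp]: "finite (onb :: 'a::fd_inner set)"
  and inner_onb: "\<And>c d::'a. c \<in> onb \<Longrightarrow> d \<in> onb \<Longrightarrow> inner c d = (if c = d then 1 else 0)"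
  and onb_expand: "\<And>x::'a. x = (\<Sum>c\<in>onb. inner x c *\<^sub>R c)"
  using someI_ex[OF onb_ex, folded onb_def] by blast+

text \<open>Coordinates with respect to \<open>onb\<close> reduce the claim to bounded sequences of
  reals. Compactness of closed balls is what later makes the carriers of bump functions closed;
  completeness follows as well.\<close>

instance fd_inner \<subseteq> heine_borel
proof
  fix f :: "nat \<Rightarrow> 'a"
  assume f: "bounded (range f)"
  let ?proj = "\<lambda>(x::'a) b. if b \<in> onb then inner x b else (0::real)"
  let ?unproj = "\<lambda>e. \<Sum>b\<in>(onb::'a set). (e b :: real) *\<^sub>R b"
  have "\<exists>l r. strict_mono r \<and> (\<forall>e>0. eventually (\<lambda>n. \<forall>i\<in>(onb::'a set). dist (?proj (f (r n)) i) (?proj l i) < e) sequentially)"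
  proof (rule compact_lemma_general[where basis = "onb::'a set" and proj = ?proj and unproj = ?unproj, rule_format, OF _ _ _ _ subset_refl])
    show "bounded ((\<lambda>x. ?proj x k) ` range f)" if "k \<in> onb" for k
      using that f by (auto intro!: bounded_linear_image bounded_linear_inner_left)
    show "?proj (?unproj e) k = e k" if "k \<in> onb" for e k
    proof -
      have "inner (?unproj e) k = (\<Sum>b\<in>onb. e b * inner b k)"
        by (simp add: inner_sum_left)
      also have "\<dots> = (\<Sum>b\<in>onb. if b = k then e b else 0)"
        using that by (intro sum.cong) (auto simp: inner_onb)
      finally have "inner (?unproj e) k = (\<Sum>b\<in>onb. if b = k then e b else 0)" .
      with that show ?thesis by simp
    qed
    show "?unproj (\<lambda>k. ?proj x k) = x" for x
      by (subst (2) onb_expand) (intro sum.cong, auto)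
  qed simp
  then obtain l r where r: "strict_mono r"
    and l: "\<And>e. e > 0 \<Longrightarrow> eventually (\<lambda>n. \<forall>i\<in>(onb::'a set). dist (inner (f (r n)) i) (inner l i) < e) sequentially"
    by (auto cong: ball_cong)
  have "((\<lambda>n. inner (f (r n)) i) \<longlongrightarrow> inner l i) sequentially" if "i \<in> onb" for i
    by (rule tendstoI) (use l that in \<open>fast elim: eventually_mono\<close>)
  then have "((\<lambda>n. \<Sum>i\<in>onb. inner (f (r n)) i *\<^sub>R i) \<longlongrightarrow> (\<Sum>i\<in>onb. inner l i *\<^sub>R i)) sequentially"
    by (intro tendsto_sum tendsto_scaleR tendsto_const)
  then have "((f \<circ> r) \<longlongrightarrow> l) sequentially"
    by (simp add: onb_expand[symmetric] comp_def)
  with r show "\<exists>l r. strict_mono (r::nat\<Rightarrow>nat) \<and> ((f \<circ> r) \<longlongrightarrow> l) sequentially" by blast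
qed

instance fd_inner \<subseteq> banach ..

instance prod :: (fd_inner, fd_inner) fd_inner
proof
  let ?B = "(\<lambda>b. (b, 0)) ` onb \<union> (\<lambda>b. (0, b)) ` onb :: ('a \<times> 'b) set"
  have fin: "finite ?B" by simp
  have "z \<in> span ?B" for z :: "'a \<times> 'b"
  proof -
    have "(fst z, 0) = (\<Sum>c\<in>onb. inner (fst z) c *\<^sub>R (c, 0::'b))"
      by (subst onb_expand[of "fst z"]) (simp add: sum_prod)
    moreover have "(0, snd z) = (\<Sum>c\<in>onb. inner (snd z) c *\<^sub>R (0::'a, c))"
      by (subst onb_expand[of "snd z"]) (simp add: sum_prod)
    moreover have "(\<Sum>c\<in>onb. inner (fst z) c *\<^sub>R (c, 0)) \<in> span ?B"
      "(\<Sum>c\<in>onb. inner (snd z) c *\<^sub>R (0, c)) \<in> span ?B"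
      by (intro span_sum span_scale span_base UnI1 UnI2 imageI; assumption)+
    ultimately have "(fst z, 0) \<in> span ?B" "(0, snd z) \<in> span ?B"
      by simp_all
    from span_add[OF this] show ?thesis by simp
  qed
  then have "\<forall>z. \<exists>c. z = (\<Sum>b\<in>?B. c b *\<^sub>R b)"
    using span_finite[OF fin] by auto
  with fin show "\<exists>B::('a \<times> 'b) set. finite B \<and> (\<forall>x. \<exists>c. x = (\<Sum>b\<in>B. c b *\<^sub>R b))" by blast
qed

text \<open>\<open>Ck_on\<close> speaks of derivatives in fixed directions; this expansion reduces a
  derivative in a variable direction to finitely many of those.\<close>

lemma linear_onb:
  assumes "linear f"
  shows "f v = (\<Sum>b\<in>onb. inner v b *\<^sub>R f b)"
  by (subst onb_expand[of v]) (simp add: linear_sum[OF assms] linear_scale[OF assms])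


section \<open>Smooth functions\<close>

lemma frechet_derivative_cong:
  assumes "open S" "x \<in> S" "\<And>y. y \<in> S \<Longrightarrow> f y = g y"
  shows "frechet_derivative f (at x) = frechet_derivative g (at x)"
proof -
  have "(f has_derivative D) (at x) \<longleftrightarrow> (g has_derivative D) (at x)" for D
    using has_derivative_transform_within_open[of f D x UNIV S g]
      has_derivative_transform_within_open[of g D x UNIV S f] assms by auto
  then show ?thesis unfolding frechet_derivative_def by simp
qed

lemma Ck_on_cong:
  assumes "open S" "\<And>x. x \<in> S \<Longrightarrow> f x = g x" "Ck_on k S f"
  shows "Ck_on k S g"
  using assms(2,3)
proof (induction k arbitrary: f g)
  case 0
  then show ?case by (simp cong: continuous_on_cong)
next
  case (Suc k)
  have "g differentiable (at x)" if "x \<in> S" for x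
  proof -
    have "f differentiable (at x)" using Suc.prems(2) that by simp
    then have "(f has_derivative frechet_derivative f (at x)) (at x)"
      by (simp add: frechet_derivative_works)
    then have "(g has_derivative frechet_derivative f (at x)) (at x)"
      by (rule has_derivative_transform_within_open[OF _ assms(1) that]) (rule Suc.prems(1))
    then show ?thesis by (auto simp: differentiable_def)
  qed
  moreover have "Ck_on k S (\<lambda>x. frechet_derivative g (at x) v)" for v
  proof (rule Suc.IH)
    show "frechet_derivative f (at x) v = frechet_derivative g (at x) v" if "x \<in> S" for x
      by (rule fun_cong[OF frechet_derivative_cong[OF assms(1) that Suc.prems(1)]])
    show "Ck_on k S (\<lambda>x. frechet_derivative f (at x) v)" using Suc.prems(2) by simp
  qed
  ultimately show ?case by simp
qed

lemma Ck_on_subset: "Ck_on k S f \<Longrightarrow> T \<subseteq> S \<Longrightarrow> Ck_on k T f"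
  by (induction k arbitrary: f) (auto intro: continuous_on_subset)

lemma Ck_on_locally:
  assumes "\<And>x. x \<in> S \<Longrightarrow> \<exists>T. open T \<and> x \<in> T \<and> Ck_on k T f"
  shows "Ck_on k S f"
  using assms
proof (induction k arbitrary: f)
  case 0
  have "isCont f x" if "x \<in> S" for x
    using 0[OF that] by (auto simp: continuous_on_eq_continuous_at)
  then show ?case by (simp add: continuous_at_imp_continuous_on)
next
  case (Suc k)
  then show ?case by simp (metis (no_types, lifting))
qed

lemma has_frechet_derivative:
  "Ck_on (Suc k) S f \<Longrightarrow> x \<in> S \<Longrightarrow> (f has_derivative frechet_derivative f (at x)) (at x)"
  by (simp add: frechet_derivative_works[symmetric])

text \<open>\<open>frechet_derivative\<close> is obtained by choice. Uniqueness of derivatives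
  allows any explicit formula \<open>D\<close> instead, and openness of \<open>S\<close> allows the
  replacement on \<open>S\<close> alone.\<close>

lemma Ck_on_SucI:
  assumes "open S" "\<And>x. x \<in> S \<Longrightarrow> (f has_derivative D x) (at x)"
    "\<And>v. Ck_on k S (\<lambda>x. D x v)"
  shows "Ck_on (Suc k) S f"
proof -
  have "frechet_derivative f (at x) = D x" if "x \<in> S" for x
    using assms(2)[OF that] by (metis frechet_derivative_at)
  then have "Ck_on k S (\<lambda>x. frechet_derivative f (at x) v)" for v
    by (intro Ck_on_cong[OF assms(1) _ assms(3)[of v]]) simp
  then show ?thesis using assms(2) by (auto simp: differentiable_def)
qed

lemma Ck_on_SucD: "Ck_on (Suc k) S f \<Longrightarrow> Ck_on k S f"
proof (induction k arbitrary: f)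
  case 0
  then show ?case
    by (auto intro!: continuous_at_imp_continuous_on differentiable_imp_continuous_within)
next
  case (Suc k)
  then show ?case by (metis Ck_on.simps(2))
qed

lemma Ck_on_const: "open S \<Longrightarrow> Ck_on k S (\<lambda>x. c)"
  by (induction k arbitrary: c) (auto intro!: Ck_on_SucI[where D = "\<lambda>x v. 0"] simp del: Ck_on.simps(2))

lemma Ck_on_linear:
  assumes "open S" "bounded_linear f"
  shows "Ck_on k S f"
proof (cases k)
  case 0
  with assms show ?thesis by (simp add: linear_continuous_on)
next
  case (Suc k')
  show ?thesis unfolding Suc
    by (rule Ck_on_SucI[where D = "\<lambda>x. f"])
      (auto intro: assms Ck_on_const bounded_linear_imp_has_derivative)
qed

lemma Ck_on_compose_linear:
  assumes "open S" "bounded_linear L" "Ck_on k S f"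
  shows "Ck_on k S (\<lambda>x. L (f x))"
  using assms(3)
proof (induction k arbitrary: f)
  case 0
  then show ?case by (simp add: assms(2) linear_continuous_on_compose bounded_linear.continuous_on)
next
  case (Suc k)
  show ?case
    by (rule Ck_on_SucI[OF assms(1), where D = "\<lambda>x v. L (frechet_derivative f (at x) v)"])
      (use Suc.prems in \<open>auto intro!: bounded_linear.has_derivative[OF assms(2)] has_frechet_derivative[OF Suc.prems] Suc.IH\<close>)
qed

lemma Ck_on_add:
  assumes "open S" "Ck_on k S f" "Ck_on k S g"
  shows "Ck_on k S (\<lambda>x. f x + g x)"
  using assms(2,3)
proof (induction k arbitrary: f g)
  case 0
  then show ?case by (simp add: continuous_on_add)
next
  case (Suc k)
  show ?case
    by (rule Ck_on_SucI[OF assms(1), where D = "\<lambda>x v. frechet_derivative f (at x) v + frechet_derivative g (at x) v"])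
      (use Suc.prems in \<open>auto intro!: has_derivative_add has_frechet_derivative[OF Suc.prems(1)] has_frechet_derivative[OF Suc.prems(2)] Suc.IH\<close>)
qed

lemma Ck_on_bilinear:
  assumes "open S" "bounded_bilinear p" "Ck_on k S f" "Ck_on k S g"
  shows "Ck_on k S (\<lambda>x. p (f x) (g x))"
  using assms(3,4)
proof (induction k arbitrary: f g)
  case 0
  then show ?case by (simp add: bounded_bilinear.continuous_on[OF assms(2)])
next
  case (Suc k)
  show ?case
  proof (rule Ck_on_SucI[OF assms(1)])
    show "((\<lambda>x. p (f x) (g x)) has_derivative
        (\<lambda>v. p (f x) (frechet_derivative g (at x) v) + p (frechet_derivative f (at x) v) (g x))) (at x)"
      if "x \<in> S" for x
      by (intro bounded_bilinear.FDERIV[OF assms(2)] has_frechet_derivative[OF Suc.prems(1) that]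
          has_frechet_derivative[OF Suc.prems(2) that])
    show "Ck_on k S (\<lambda>x. p (f x) (frechet_derivative g (at x) v) + p (frechet_derivative f (at x) v) (g x))" for v
      using Suc.prems Suc.prems[THEN Ck_on_SucD]
      by (intro Ck_on_add assms(1) Suc.IH) simp_all
  qed
qed

lemma Ck_on_sum:
  assumes "open S" "\<And>i. i \<in> I \<Longrightarrow> Ck_on k S (f i)"
  shows "Ck_on k S (\<lambda>x. \<Sum>i\<in>I. f i x)"
  using assms(2)
  by (induction I rule: infinite_finite_induct) (auto intro: Ck_on_add Ck_on_const assms(1))

text \<open>The chain rule evaluates the derivative of \<open>g\<close> in the moving direction
  given by the derivative of \<open>f\<close>. Expanding this direction in \<open>onb\<close> of the
  middle space leaves products of coordinates of that direction with \<open>f\<close> followed by a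
  derivative of \<open>g\<close> in a fixed direction; the induction hypothesis applies to the
  latter, which is why \<open>g\<close> is generalized.\<close>

lemma Ck_on_compose:
  fixes f :: "'a::real_normed_vector \<Rightarrow> 'b::fd_inner"
  assumes "open S" "open T" "f ` S \<subseteq> T" "Ck_on k S f" "Ck_on k T g"
  shows "Ck_on k S (\<lambda>x. g (f x))"
  using assms(4,5)
proof (induction k arbitrary: g)
  case 0
  then show ?case using assms(3) by (auto intro: continuous_on_compose2)
next
  case (Suc k)
  show ?case
  proof (rule Ck_on_SucI[OF assms(1)])
    fix x assume x: "x \<in> S"
    have g: "(g has_derivative frechet_derivative g (at (f x))) (at (f x))"
      by (rule has_frechet_derivative[OF Suc.prems(2)]) (use x assms(3) in auto)
    have "linear (frechet_derivative g (at (f x)))" using g has_derivative_linear by blast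
    then have eq: "(\<lambda>v. frechet_derivative g (at (f x)) (frechet_derivative f (at x) v)) =
        (\<lambda>v. \<Sum>b\<in>onb. inner (frechet_derivative f (at x) v) b *\<^sub>R frechet_derivative g (at (f x)) b)"
      by (intro ext linear_onb)
    show "((\<lambda>x. g (f x)) has_derivative (\<lambda>v. \<Sum>b\<in>onb. inner (frechet_derivative f (at x) v) b *\<^sub>R frechet_derivative g (at (f x)) b)) (at x)"
      by (rule has_derivative_eq_rhs[OF has_derivative_compose[OF has_frechet_derivative[OF Suc.prems(1) x] g] eq])
  next
    fix v
    show "Ck_on k S (\<lambda>x. \<Sum>b\<in>onb. inner (frechet_derivative f (at x) v) b *\<^sub>R frechet_derivative g (at (f x)) b)"
      using Suc.prems Suc.prems(1)[THEN Ck_on_SucD]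
      by (intro Ck_on_sum Ck_on_bilinear[OF _ bounded_bilinear_scaleR] assms(1)
          Ck_on_compose_linear[OF _ bounded_linear_inner_left] Suc.IH) simp_all
  qed
qed

text \<open>The derivative is a product of the inverse with itself and with the derivative of
  \<open>f\<close>, so the induction closes. The sign is written as a constant factor to fit the
  product rule.\<close>

lemma Ck_on_inverse:
  fixes f :: "'a::real_normed_vector \<Rightarrow> real"
  assumes "open S" "\<And>x. x \<in> S \<Longrightarrow> f x \<noteq> 0" "Ck_on k S f"
  shows "Ck_on k S (\<lambda>x. inverse (f x))"
  using assms(3)
proof (induction k)
  case 0
  then show ?case using assms(2) by (auto intro: continuous_on_inverse)
next
  case (Suc k)
  show ?case
  proof (rule Ck_on_SucI[OF assms(1)])
    show "((\<lambda>x. inverse (f x)) has_derivative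
        (\<lambda>v. (- 1) * (inverse (f x) * (frechet_derivative f (at x) v * inverse (f x))))) (at x)" if "x \<in> S" for x
      using Deriv.has_derivative_inverse[OF assms(2)[OF that] has_frechet_derivative[OF Suc.prems that]]
      by (simp add: mult.assoc)
    show "Ck_on k S (\<lambda>x. (- 1) * (inverse (f x) * (frechet_derivative f (at x) v * inverse (f x))))" for v
      using Suc.prems Suc.prems[THEN Ck_on_SucD]
      by (intro Ck_on_bilinear[OF _ bounded_bilinear_mult] Ck_on_const assms(1) Suc.IH) simp_all
  qed
qed

lemma smooth_on_cong:
  "open S \<Longrightarrow> (\<And>x. x \<in> S \<Longrightarrow> f x = g x) \<Longrightarrow> smooth_on S f \<Longrightarrow> smooth_on S g"
  unfolding smooth_on_def by (metis Ck_on_cong)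

lemma smooth_on_subset: "smooth_on S f \<Longrightarrow> T \<subseteq> S \<Longrightarrow> smooth_on T f"
  unfolding smooth_on_def by (metis Ck_on_subset)

lemma smooth_on_locally:
  "(\<And>x. x \<in> S \<Longrightarrow> \<exists>T. open T \<and> x \<in> T \<and> smooth_on T f) \<Longrightarrow> smooth_on S f"
  unfolding smooth_on_def by (meson Ck_on_locally)

lemma smooth_on_imp_continuous: "smooth_on S f \<Longrightarrow> continuous_on S f"
  unfolding smooth_on_def by (metis Ck_on.simps(1))

lemma smooth_on_has_derivative:
  "smooth_on S f \<Longrightarrow> x \<in> S \<Longrightarrow> (f has_derivative frechet_derivative f (at x)) (at x)"
  unfolding smooth_on_def by (metis has_frechet_derivative)

lemma smooth_on_frechet_derivative:
  "smooth_on S f \<Longrightarrow> smooth_on S (\<lambda>x. frechet_derivative f (at x) v)"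
  unfolding smooth_on_def by (metis Ck_on.simps(2))

lemma smooth_on_const: "open S \<Longrightarrow> smooth_on S (\<lambda>x. c)"
  by (simp add: smooth_on_def Ck_on_const)

lemma smooth_on_linear: "open S \<Longrightarrow> bounded_linear f \<Longrightarrow> smooth_on S f"
  by (simp add: smooth_on_def Ck_on_linear)

lemma smooth_on_compose_linear:
  "open S \<Longrightarrow> bounded_linear L \<Longrightarrow> smooth_on S f \<Longrightarrow> smooth_on S (\<lambda>x. L (f x))"
  by (simp add: smooth_on_def Ck_on_compose_linear)

lemma smooth_on_add:
  "open S \<Longrightarrow> smooth_on S f \<Longrightarrow> smooth_on S g \<Longrightarrow> smooth_on S (\<lambda>x. f x + g x)"
  by (simp add: smooth_on_def Ck_on_add)

lemma smooth_on_scaleR: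
  "open S \<Longrightarrow> smooth_on S f \<Longrightarrow> smooth_on S g \<Longrightarrow> smooth_on S (\<lambda>x. f x *\<^sub>R g x)"
  by (simp add: smooth_on_def Ck_on_bilinear[OF _ bounded_bilinear_scaleR])

lemma smooth_on_mult:
  fixes f g :: "'a::real_normed_vector \<Rightarrow> real"
  shows "open S \<Longrightarrow> smooth_on S f \<Longrightarrow> smooth_on S g \<Longrightarrow> smooth_on S (\<lambda>x. f x * g x)"
  by (simp add: smooth_on_def Ck_on_bilinear[OF _ bounded_bilinear_mult])

lemma smooth_on_inner:
  "open S \<Longrightarrow> smooth_on S f \<Longrightarrow> smooth_on S g \<Longrightarrow> smooth_on S (\<lambda>x. inner (f x) (g x))"
  by (simp add: smooth_on_def Ck_on_bilinear[OF _ bounded_bilinear_inner])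

lemma smooth_on_minus: "open S \<Longrightarrow> smooth_on S f \<Longrightarrow> smooth_on S (\<lambda>x. - f x)"
  by (rule smooth_on_compose_linear[OF _ bounded_linear_minus[OF bounded_linear_ident]])

lemma smooth_on_diff:
  "open S \<Longrightarrow> smooth_on S f \<Longrightarrow> smooth_on S g \<Longrightarrow> smooth_on S (\<lambda>x. f x - g x)"
  using smooth_on_add[of S f "\<lambda>x. - g x"] smooth_on_minus[of S g] by simp

lemma smooth_on_sum:
  "open S \<Longrightarrow> (\<And>i. i \<in> I \<Longrightarrow> smooth_on S (f i)) \<Longrightarrow> smooth_on S (\<lambda>x. \<Sum>i\<in>I. f i x)"
  by (simp add: smooth_on_def Ck_on_sum)

lemma smooth_on_compose:
  fixes f :: "'a::real_normed_vector \<Rightarrow> 'b::fd_inner"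
  shows "open S \<Longrightarrow> open T \<Longrightarrow> f ` S \<subseteq> T \<Longrightarrow> smooth_on S f \<Longrightarrow> smooth_on T g \<Longrightarrow>
    smooth_on S (\<lambda>x. g (f x))"
  by (simp add: smooth_on_def Ck_on_compose)

lemma smooth_on_inverse:
  fixes f :: "'a::real_normed_vector \<Rightarrow> real"
  shows "open S \<Longrightarrow> (\<And>x. x \<in> S \<Longrightarrow> f x \<noteq> 0) \<Longrightarrow> smooth_on S f \<Longrightarrow> smooth_on S (\<lambda>x. inverse (f x))"
  by (simp add: smooth_on_def Ck_on_inverse)

lemma smooth_on_Pair:
  assumes "open S" "smooth_on S f" "smooth_on S g"
  shows "smooth_on S (\<lambda>x. (f x, g x))"
proof -
  have "smooth_on S (\<lambda>x. (f x, 0) + (0, g x))"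
    by (intro smooth_on_add assms smooth_on_compose_linear[of S "\<lambda>y. (y, 0)"]
        smooth_on_compose_linear[of S "\<lambda>y. (0, y)"] bounded_linear_Pair bounded_linear_ident bounded_linear_zero)
  then show ?thesis by simp
qed

lemma smooth_on_fst: "open S \<Longrightarrow> smooth_on S fst"
  and smooth_on_snd: "open S \<Longrightarrow> smooth_on S snd"
  by (simp_all add: smooth_on_linear bounded_linear_fst bounded_linear_snd)

section \<open>Bump functions and Hadamard's lemma\<close>

text \<open>The function \<open>exp (- 1 / t)\<close>, extended by 0, together with the factors
  \<open>1 / t ^ n\<close> that appear on differentiation: the derivative of \<open>flat n\<close>
  is a combination of \<open>flat (n + 2)\<close> and \<open>flat (n + 1)\<close>, so the whole
  family is smooth by one induction.\<close>

definition flat :: "nat \<Rightarrow> real \<Rightarrow> real" where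
  "flat n t = (if t \<le> 0 then 0 else inverse t ^ n * exp (- inverse t))"

lemma power_le_fact_exp:
  assumes "0 \<le> (x::real)"
  shows "x ^ n \<le> fact n * exp x"
proof -
  have "sum (\<lambda>n. x ^ n /\<^sub>R fact n) {n} \<le> (\<Sum>n. x ^ n /\<^sub>R fact n)"
    using assms by (intro sum_le_suminf summable_exp_generic) auto
  then have "x ^ n /\<^sub>R fact n \<le> exp x" by (simp add: exp_def)
  then show ?thesis by (simp add: field_simps)
qed

text \<open>With \<open>x = 1 / t\<close> this says that \<open>x ^ (n + 1) * exp (- x)\<close> is
  at most \<open>(n + 1)!\<close>, which compares one term of the exponential series with its sum.
  The bound gives the limit 0 at 0.\<close>

lemma flat_bound: "\<bar>flat n t\<bar> \<le> fact (Suc n) * \<bar>t\<bar>"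
proof (cases "t \<le> 0")
  case False
  define x where "x = inverse t"
  have x: "x > 0" "t = inverse x" using False by (simp_all add: x_def)
  have "x ^ n * exp (- x) * x \<le> fact (Suc n)"
  proof -
    have "x ^ Suc n * exp (- x) \<le> (fact (Suc n) * exp x) * exp (- x)"
      using x by (intro mult_right_mono power_le_fact_exp) auto
    also have "\<dots> = fact (Suc n) * (exp x * exp (- x))" by (simp only: mult.assoc)
    finally show ?thesis by (simp add: exp_minus_inverse mult_ac del: fact_Suc)
  qed
  then have "x ^ n * exp (- x) \<le> fact (Suc n) / x"
    using x(1) by (simp only: pos_le_divide_eq)
  then show ?thesis using x by (simp add: flat_def divide_inverse)
qed (simp add: flat_def mult_nonneg_nonpos del: fact_Suc)

lemma DERIV_flat:
  "(flat n has_real_derivative (flat (n + 2) t - real n * flat (n + 1) t)) (at t)"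
proof (cases t "0::real" rule: linorder_cases)
  case less
  have "((\<lambda>_. 0) has_real_derivative (flat (n + 2) t - real n * flat (n + 1) t)) (at t)"
    using less by (simp add: flat_def)
  then show ?thesis
    by (rule has_field_derivative_transform_within_open[of _ _ _ "{..<0}"])
      (use less in \<open>auto simp: flat_def\<close>)
next
  case greater
  have "((\<lambda>t. inverse t ^ n * exp (- inverse t)) has_real_derivative
      (flat (n + 2) t - real n * flat (n + 1) t)) (at t)"
    using greater by (cases n) (auto intro!: derivative_eq_intros simp: flat_def field_simps power2_eq_square,
      metis One_nat_def mult.commute neq0_conv power_minus_mult)
  then show ?thesis
    by (rule has_field_derivative_transform_within_open[of _ _ _ "{0<..}"])
      (use greater in \<open>auto simp: flat_def\<close>)
next
  case equal
  \<comment> \<open>The difference quotient of \<open>flat n\<close> at 0 is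
    \<open>flat (Suc n)\<close>, so the derivative at 0 is the limit of the next member of the
    family.\<close>
  have "((\<lambda>h. flat (Suc n) h) \<longlongrightarrow> 0) (at 0)"
  proof (rule Lim_null_comparison)
    show "eventually (\<lambda>h. norm (flat (Suc n) h) \<le> fact (Suc (Suc n)) * \<bar>h\<bar>) (at 0)"
      using flat_bound by (intro always_eventually) (simp del: fact_Suc)
    show "((\<lambda>h. fact (Suc (Suc n)) * \<bar>h\<bar>) \<longlongrightarrow> 0) (at (0::real))"
      by (auto intro!: tendsto_eq_intros)
  qed
  moreover have "(flat n (0 + h) - flat n 0) / h = flat (Suc n) h" for h
    by (simp add: flat_def divide_inverse)
  ultimately show ?thesis unfolding DERIV_def equal by (simp add: flat_def)
qed

lemma smooth_on_flat: "smooth_on S (flat n)"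
proof -
  have "Ck_on k UNIV (flat n)" for k n
  proof (induction k arbitrary: n)
    case 0
    show ?case using DERIV_flat by (auto intro!: continuous_at_imp_continuous_on DERIV_isCont)
  next
    case (Suc k)
    show ?case
    proof (rule Ck_on_SucI[OF open_UNIV])
      show "(flat n has_derivative (\<lambda>v. (flat (n + 2) t + (- real n) * flat (n + 1) t) * v)) (at t)" for t
        using DERIV_flat[of n t] by (simp add: has_field_derivative_def)
      show "Ck_on k UNIV (\<lambda>t. (flat (n + 2) t + (- real n) * flat (n + 1) t) * v)" for v
        by (intro Ck_on_bilinear[OF _ bounded_bilinear_mult] Ck_on_add Ck_on_const Suc.IH open_UNIV)
    qed
  qed
  then show ?thesis by (metis smooth_on_def smooth_on_subset top_greatest)
qed

text \<open>The value 1 is arranged at \<open>x0\<close> only, not in a neighbourhood, which is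
  enough for arguments with the product rule. The profile \<open>flat 0\<close> is taken at
  \<open>r^2 - |x - x0|^2\<close> and normalized by its value at the centre.\<close>

lemma bump_exists:
  fixes x0 :: "'a::fd_inner"
  assumes "r > 0"
  shows "\<exists>h::'a \<Rightarrow> real. smooth_on UNIV h \<and> h x0 = 1 \<and> (\<forall>x. x \<notin> cball x0 r \<longrightarrow> h x = 0)"
proof (intro exI conjI allI impI)
  let ?h = "\<lambda>x. inverse (flat 0 (r\<^sup>2)) * flat 0 (r\<^sup>2 - inner (x - x0) (x - x0))"
  have lin: "smooth_on UNIV (\<lambda>x. x - x0)"
    by (intro smooth_on_diff smooth_on_linear smooth_on_const open_UNIV bounded_linear_ident)
  have "smooth_on UNIV (\<lambda>x. r\<^sup>2 - inner (x - x0) (x - x0))"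
    by (intro smooth_on_diff smooth_on_const smooth_on_inner lin open_UNIV)
  from smooth_on_compose[OF open_UNIV open_UNIV _ this smooth_on_flat]
  show "smooth_on UNIV ?h"
    by (intro smooth_on_mult smooth_on_const open_UNIV) auto
  show "?h x0 = 1" using assms by (simp add: flat_def)
  fix x assume "x \<notin> cball x0 r"
  then have "r \<le> norm (x - x0)" by (simp add: dist_norm norm_minus_commute)
  then have "r\<^sup>2 \<le> inner (x - x0) (x - x0)"
    using assms by (metis dot_square_norm less_imp_le power_mono)
  then show "?h x = 0" by (simp add: flat_def)
qed

text \<open>Differentiation under the integral sign yields a factor \<open>t\<close> from the chain
  rule along the segment. The weight \<open>t ^ m\<close> absorbs it, so the statement with
  arbitrary \<open>m\<close> and \<open>F\<close> is stable under differentiation.\<close>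

lemma Ck_on_segment_integral:
  fixes F :: "'a::fd_inner \<Rightarrow> real"
  assumes D: "open D" "convex D" "z0 \<in> D" and F: "smooth_on D F"
  shows "Ck_on k D (\<lambda>z. integral (cbox 0 1) (\<lambda>t. t ^ m * F (z0 + t *\<^sub>R (z - z0))))"
  using F
proof (induction k arbitrary: m F)
  case 0
  have seg: "z0 + t *\<^sub>R (z - z0) \<in> D" if "z \<in> D" "t \<in> cbox 0 (1::real)" for z t
    using convexD_alt[OF D(2,3), of z t] that by (simp add: algebra_simps)
  have "continuous_on (D \<times> cbox 0 1) (\<lambda>(z, t). t ^ m * F (z0 + t *\<^sub>R (z - z0)))"
    unfolding split_beta
    by (intro continuous_intros continuous_on_compose2[OF smooth_on_imp_continuous[OF 0]]) (auto intro!: seg)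
  then show ?case by (simp only: Ck_on.simps) (rule integral_continuous_on_param)
next
  case (Suc k)
  have seg: "z0 + t *\<^sub>R (z - z0) \<in> D" if "z \<in> D" "t \<in> cbox 0 (1::real)" for z t
    using convexD_alt[OF D(2,3), of z t] that by (simp add: algebra_simps)
  have cont: "continuous_on (D \<times> cbox 0 1) (\<lambda>(z, t). t ^ n * G (z0 + t *\<^sub>R (z - z0)))"
    if "smooth_on D G" for n and G :: "'a \<Rightarrow> real"
    unfolding split_beta
    by (intro continuous_intros continuous_on_compose2[OF smooth_on_imp_continuous[OF that]]) (auto intro!: seg)
  let ?DF = "\<lambda>x. frechet_derivative F (at x)"
  \<comment> \<open>The derivative of the integrand as an operator, written as a combination of
    inner products with basis vectors: its continuity in \<open>(z, t)\<close> then follows from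
    that of the coefficients.\<close>
  define fx :: "'a \<Rightarrow> real \<Rightarrow> 'a \<Rightarrow>\<^sub>L real" where
    "fx z t = (\<Sum>b\<in>onb. (t ^ Suc m * ?DF (z0 + t *\<^sub>R (z - z0)) b) *\<^sub>R blinfun_inner_left b)" for z t
  have fx_apply: "blinfun_apply (fx z t) v = t ^ Suc m * ?DF (z0 + t *\<^sub>R (z - z0)) v"
    if "z \<in> D" "t \<in> cbox 0 1" for z t v
  proof -
    have "linear (?DF (z0 + t *\<^sub>R (z - z0)))"
      using smooth_on_has_derivative[OF Suc.prems seg[OF that]] has_derivative_linear by blast
    from linear_onb[OF this, of v] show ?thesis
      by (simp add: fx_def blinfun.sum_left blinfun.scaleR_left sum_distrib_left inner_commute mult_ac)
  qed
  have contfx: "continuous_on (D \<times> cbox 0 1) (\<lambda>(z, t). fx z t)"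
    unfolding fx_def split_beta
    by (intro continuous_on_sum continuous_on_scaleR continuous_on_const
        cont[OF smooth_on_frechet_derivative[OF Suc.prems], unfolded split_beta])
  show ?case
  proof (rule Ck_on_SucI[OF D(1)])
    fix z assume z: "z \<in> D"
    have cf: "continuous_on (cbox 0 1) (fx z)"
    proof -
      have "continuous_on (cbox 0 1) (\<lambda>t. case (z, t) of (z, t) \<Rightarrow> fx z t)"
        by (rule continuous_on_compose2[OF contfx, of "cbox 0 1"])
          (auto intro!: continuous_on_Pair[OF continuous_on_const continuous_on_id] simp: z)
      then show ?thesis by simp
    qed
    have "((\<lambda>z. integral (cbox 0 1) (\<lambda>t. t ^ m * F (z0 + t *\<^sub>R (z - z0)))) has_derivative
        integral (cbox 0 1) (fx z)) (at z within D)"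
    proof (rule leibniz_rule[OF _ _ contfx z D(2)])
      fix x and t :: real assume x: "x \<in> D" "t \<in> cbox 0 1"
      have "((\<lambda>x. z0 + t *\<^sub>R (x - z0)) has_derivative (\<lambda>v. t *\<^sub>R v)) (at x)"
        by (auto intro!: derivative_eq_intros)
      from has_derivative_compose[OF this smooth_on_has_derivative[OF Suc.prems seg[OF x]]]
      have "((\<lambda>x. t ^ m * F (z0 + t *\<^sub>R (x - z0))) has_derivative
          (\<lambda>v. t ^ m * ?DF (z0 + t *\<^sub>R (x - z0)) (t *\<^sub>R v))) (at x)"
        by (intro has_derivative_mult_right)
      moreover have "linear (?DF (z0 + t *\<^sub>R (x - z0)))"
        using smooth_on_has_derivative[OF Suc.prems seg[OF x]] has_derivative_linear by blast
      then have "(\<lambda>v. t ^ m * ?DF (z0 + t *\<^sub>R (x - z0)) (t *\<^sub>R v)) = blinfun_apply (fx x t)"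
        by (simp add: fx_apply[OF x] fun_eq_iff linear_scale mult_ac)
      ultimately have "((\<lambda>x. t ^ m * F (z0 + t *\<^sub>R (x - z0))) has_derivative
          blinfun_apply (fx x t)) (at x)" by simp
      then show "((\<lambda>x. t ^ m * F (z0 + t *\<^sub>R (x - z0))) has_derivative blinfun_apply (fx x t)) (at x within D)"
        by (rule has_derivative_at_withinI)
    next
      fix x assume x: "x \<in> D"
      show "(\<lambda>t. t ^ m * F (z0 + t *\<^sub>R (x - z0))) integrable_on cbox 0 1"
      proof -
        have "continuous_on (cbox 0 1) (\<lambda>t. case (x, t) of (z, t) \<Rightarrow> t ^ m * F (z0 + t *\<^sub>R (z - z0)))"
          by (rule continuous_on_compose2[OF cont[OF Suc.prems], of "cbox 0 1"])
            (auto intro!: continuous_on_Pair[OF continuous_on_const continuous_on_id] simp: x)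
        then have "continuous_on (cbox 0 1) (\<lambda>t. t ^ m * F (z0 + t *\<^sub>R (x - z0)))"
          by (simp only: prod.case)
        then show ?thesis by (rule integrable_continuous)
      qed
    qed
    moreover have "blinfun_apply (integral (cbox 0 1) (fx z)) =
        (\<lambda>v. integral (cbox 0 1) (\<lambda>t. t ^ Suc m * ?DF (z0 + t *\<^sub>R (z - z0)) v))"
    proof
      fix v
      have "blinfun_apply (integral (cbox 0 1) (fx z)) v = integral (cbox 0 1) (\<lambda>t. blinfun_apply (fx z t) v)"
        using integral_linear[OF integrable_continuous[OF cf] blinfun.bounded_linear_left[of v]]
        by (simp add: comp_def)
      also have "\<dots> = integral (cbox 0 1) (\<lambda>t. t ^ Suc m * ?DF (z0 + t *\<^sub>R (z - z0)) v)"
        by (intro integral_cong fx_apply z)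
      finally show "blinfun_apply (integral (cbox 0 1) (fx z)) v =
        integral (cbox 0 1) (\<lambda>t. t ^ Suc m * ?DF (z0 + t *\<^sub>R (z - z0)) v)" .
    qed
    ultimately show "((\<lambda>z. integral (cbox 0 1) (\<lambda>t. t ^ m * F (z0 + t *\<^sub>R (z - z0)))) has_derivative
        (\<lambda>v. integral (cbox 0 1) (\<lambda>t. t ^ Suc m * ?DF (z0 + t *\<^sub>R (z - z0)) v))) (at z)"
      using at_within_open[OF z D(1)] by simp
  next
    show "Ck_on k D (\<lambda>z. integral (cbox 0 1) (\<lambda>t. t ^ Suc m * ?DF (z0 + t *\<^sub>R (z - z0)) v))" for v
      by (rule Suc.IH[OF smooth_on_frechet_derivative[OF Suc.prems]])
  qed
qed

text \<open>The fundamental theorem of calculus along the segment from \<open>z0\<close> to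
  \<open>z\<close>: \<open>g b\<close> is the average over this segment of the partial derivative in
  direction \<open>b\<close>, smooth by the case \<open>m = 0\<close> of the preceding
  lemma.\<close>

lemma hadamard:
  fixes f :: "'a::fd_inner \<Rightarrow> real"
  assumes D: "open D" "convex D" "z0 \<in> D" and f: "smooth_on D f"
  shows "\<exists>g. (\<forall>b. smooth_on D (g b)) \<and>
    (\<forall>z\<in>D. f z = f z0 + (\<Sum>b\<in>onb. inner (z - z0) b * g b z))"
proof (intro exI conjI allI ballI)
  let ?Df = "\<lambda>x. frechet_derivative f (at x)"
  let ?g = "\<lambda>b z. integral (cbox 0 1) (\<lambda>t. t ^ 0 * ?Df (z0 + t *\<^sub>R (z - z0)) b)"
  show "smooth_on D (?g b)" for b
    unfolding smooth_on_def
    using Ck_on_segment_integral[OF D smooth_on_frechet_derivative[OF f]] by blast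
  fix z assume z: "z \<in> D"
  have seg: "z0 + t *\<^sub>R (z - z0) \<in> D" if "t \<in> {0..1::real}" for t
    using convexD_alt[OF D(2,3) z, of t] that by (simp add: algebra_simps)
  have der: "((\<lambda>t. f (z0 + t *\<^sub>R (z - z0))) has_vector_derivative
      ?Df (z0 + t *\<^sub>R (z - z0)) (z - z0)) (at t within {0..1})" if t: "t \<in> {0..1}" for t
  proof -
    have "((\<lambda>t. z0 + t *\<^sub>R (z - z0)) has_vector_derivative (z - z0)) (at t within {0..1})"
      by (auto intro!: derivative_eq_intros simp: has_vector_derivative_def)
    from vector_derivative_diff_chain_within[OF this, of f "?Df (z0 + t *\<^sub>R (z - z0))"]
    show ?thesis
      using smooth_on_has_derivative[OF f seg[OF t]] by (simp add: comp_def has_derivative_at_withinI)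
  qed
  have cont: "continuous_on (cbox 0 1) (\<lambda>t. ?Df (z0 + t *\<^sub>R (z - z0)) b)" for b
    by (intro continuous_on_compose2[OF smooth_on_imp_continuous[OF smooth_on_frechet_derivative[OF f]]]
        continuous_intros) (use seg in auto)
  have "f z - f z0 = integral {0..1} (\<lambda>t. ?Df (z0 + t *\<^sub>R (z - z0)) (z - z0))"
    using fundamental_theorem_of_calculus[of 0 1 "\<lambda>t. f (z0 + t *\<^sub>R (z - z0))", OF _ der]
    by (simp add: integral_unique)
  also have "\<dots> = integral {0..1} (\<lambda>t. \<Sum>b\<in>onb. inner (z - z0) b * ?Df (z0 + t *\<^sub>R (z - z0)) b)"
  proof (rule integral_cong)
    fix t :: real assume "t \<in> {0..1}"
    then have "linear (?Df (z0 + t *\<^sub>R (z - z0)))"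
      using smooth_on_has_derivative[OF f seg] has_derivative_linear by blast
    from linear_onb[OF this, of "z - z0"]
    show "?Df (z0 + t *\<^sub>R (z - z0)) (z - z0) = (\<Sum>b\<in>onb. inner (z - z0) b * ?Df (z0 + t *\<^sub>R (z - z0)) b)"
      by simp
  qed
  also have "\<dots> = (\<Sum>b\<in>onb. integral {0..1} (\<lambda>t. inner (z - z0) b * ?Df (z0 + t *\<^sub>R (z - z0)) b))"
    using cont by (intro integral_sum integrable_continuous_real continuous_on_mult_left) simp_all
  also have "\<dots> = (\<Sum>b\<in>onb. inner (z - z0) b * ?g b z)"
    by simp
  finally show "f z = f z0 + (\<Sum>b\<in>onb. inner (z - z0) b * ?g b z)" by simp
qed

section \<open>Smooth functions on manifolds\<close>

text \<open>\<open>W\<close> may reach outside \<open>points M\<close>; only its part inside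
  counts.\<close>

definition mopen :: "('a, 'm::real_normed_vector) atlas \<Rightarrow> 'a set \<Rightarrow> bool" where
  "mopen M W \<longleftrightarrow> (\<forall>(U, \<phi>)\<in>M. open (\<phi> ` (U \<inter> W)))"

text \<open>Injective charts with open images suffice for the calculus of functions and derivations.
  The total space of the dual bundle enters in this form, while topological arguments are carried
  out on the base.\<close>

locale charted =
  fixes M :: "('a, 'm::fd_inner) atlas"
  assumes inj_chart: "(U, \<phi>) \<in> M \<Longrightarrow> inj_on \<phi> U"
    and open_chart: "(U, \<phi>) \<in> M \<Longrightarrow> open (\<phi> ` U)"
begin

lemma mopenD: "mopen M W \<Longrightarrow> (U, \<phi>) \<in> M \<Longrightarrow> open (\<phi> ` (U \<inter> W))"
  by (auto simp: mopen_def)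

lemma chart_subset_points: "(U, \<phi>) \<in> M \<Longrightarrow> U \<subseteq> points M"
  by (auto simp: points_def intro!: bexI[of _ "(U, \<phi>)"])

lemma pointsE:
  assumes "x \<in> points M" obtains U \<phi> where "(U, \<phi>) \<in> M" "x \<in> U"
  using assms by (auto simp: points_def)

lemma mopen_points: "mopen M (points M)"
  using open_chart chart_subset_points unfolding mopen_def by (auto simp: Int_absorb2)

lemma mopen_Int: "mopen M W \<Longrightarrow> mopen M W' \<Longrightarrow> mopen M (W \<inter> W')"
proof -
  assume *: "mopen M W" "mopen M W'"
  have "\<phi> ` (U \<inter> (W \<inter> W')) = \<phi> ` (U \<inter> W) \<inter> \<phi> ` (U \<inter> W')" if "(U, \<phi>) \<in> M" for U \<phi>
    using inj_chart[OF that] by (auto simp: inj_on_def)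
  with * show ?thesis unfolding mopen_def by (auto intro!: open_Int)
qed

lemma mopen_Un: "mopen M W \<Longrightarrow> mopen M W' \<Longrightarrow> mopen M (W \<union> W')"
  by (auto simp: mopen_def Int_Un_distrib image_Un)

lemma mopen_Union:
  assumes "\<And>W. W \<in> \<W> \<Longrightarrow> mopen M W" shows "mopen M (\<Union>\<W>)"
proof -
  have "\<phi> ` (U \<inter> \<Union>\<W>) = (\<Union>W\<in>\<W>. \<phi> ` (U \<inter> W))" for U and \<phi> :: "'a \<Rightarrow> 'm" by auto
  with assms show ?thesis unfolding mopen_def by (auto intro!: open_UN)
qed

lemma openin_mtop: "openin (mtop M) W \<longleftrightarrow> W \<subseteq> points M \<and> mopen M W"
proof -
  have "istopology (\<lambda>W. W \<subseteq> points M \<and> mopen M W)"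
    unfolding istopology_def using mopen_Int mopen_Union by (auto simp: subset_iff)
  then show ?thesis unfolding mtop_def mopen_def by (simp add: topology_inverse')
qed

lemma topspace_mtop: "topspace (mtop M) = points M"
  unfolding topspace_def using openin_mtop mopen_points by auto

lemma inv_chart: "(U, \<phi>) \<in> M \<Longrightarrow> z \<in> \<phi> ` (U \<inter> W) \<Longrightarrow> inv_into U \<phi> z \<in> U \<inter> W"
  using inj_chart by fastforce

lemma msmooth_on_I:
  assumes "\<And>U \<phi>. (U, \<phi>) \<in> M \<Longrightarrow> smooth_on (\<phi> ` (U \<inter> W)) (\<lambda>z. f (inv_into U \<phi> z))"
  shows "msmooth_on M W f"
  using assms by (auto simp: msmooth_on_def comp_def)

lemma msmooth_on_D:
  "msmooth_on M W f \<Longrightarrow> (U, \<phi>) \<in> M \<Longrightarrow> smooth_on (\<phi> ` (U \<inter> W)) (\<lambda>z. f (inv_into U \<phi> z))"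
  by (auto simp: msmooth_on_def comp_def)

lemma msmooth_on_subset:
  assumes "msmooth_on M W f" "W' \<inter> points M \<subseteq> W" shows "msmooth_on M W' f"
proof (rule msmooth_on_I)
  fix U \<phi> assume U: "(U, \<phi>) \<in> M"
  show "smooth_on (\<phi> ` (U \<inter> W')) (\<lambda>z. f (inv_into U \<phi> z))"
    by (rule smooth_on_subset[OF msmooth_on_D[OF assms(1) U]])
      (use assms(2) chart_subset_points[OF U] in auto)
qed

lemma msmooth_on_cong:
  assumes "mopen M W" "\<And>x. x \<in> W \<Longrightarrow> x \<in> points M \<Longrightarrow> f x = g x" "msmooth_on M W f"
  shows "msmooth_on M W g"
proof (rule msmooth_on_I)
  fix U \<phi> assume U: "(U, \<phi>) \<in> M"
  have "f (inv_into U \<phi> z) = g (inv_into U \<phi> z)" if "z \<in> \<phi> ` (U \<inter> W)" for z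
    using inv_chart[OF U that] chart_subset_points[OF U] assms(2) by blast
  then show "smooth_on (\<phi> ` (U \<inter> W)) (\<lambda>z. g (inv_into U \<phi> z))"
    by (rule smooth_on_cong[OF mopenD[OF assms(1) U] _ msmooth_on_D[OF assms(3) U]])
qed

lemma msmooth_on_locally:
  assumes "\<And>x. x \<in> W \<Longrightarrow> x \<in> points M \<Longrightarrow> \<exists>W'. mopen M W' \<and> x \<in> W' \<and> msmooth_on M W' f"
  shows "msmooth_on M W f"
proof (rule msmooth_on_I, rule smooth_on_locally)
  fix U \<phi> z assume U: "(U, \<phi>) \<in> M" and "z \<in> \<phi> ` (U \<inter> W)"
  then obtain x where x: "x \<in> U" "x \<in> W" "z = \<phi> x" by blast
  then obtain W' where W': "mopen M W'" "x \<in> W'" "msmooth_on M W' f"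
    using assms chart_subset_points[OF U] by blast
  with x show "\<exists>T. open T \<and> z \<in> T \<and> smooth_on T (\<lambda>z. f (inv_into U \<phi> z))"
    using mopenD[OF W'(1) U] msmooth_on_D[OF W'(3) U] by blast
qed

lemma msmooth_on_Un:
  "mopen M W \<Longrightarrow> mopen M W' \<Longrightarrow> msmooth_on M W f \<Longrightarrow> msmooth_on M W' f \<Longrightarrow> msmooth_on M (W \<union> W') f"
  by (rule msmooth_on_locally) blast

lemma msmooth_on_const: "mopen M W \<Longrightarrow> msmooth_on M W (\<lambda>x. c)"
  by (rule msmooth_on_I) (auto intro: smooth_on_const mopenD)

lemma msmooth_on_add:
  "mopen M W \<Longrightarrow> msmooth_on M W f \<Longrightarrow> msmooth_on M W g \<Longrightarrow> msmooth_on M W (\<lambda>x. f x + g x)"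
  by (rule msmooth_on_I) (auto intro: smooth_on_add mopenD msmooth_on_D)

lemma msmooth_on_scaleR:
  "mopen M W \<Longrightarrow> msmooth_on M W f \<Longrightarrow> msmooth_on M W g \<Longrightarrow> msmooth_on M W (\<lambda>x. f x *\<^sub>R g x)"
  by (rule msmooth_on_I) (auto intro: smooth_on_scaleR mopenD msmooth_on_D)

lemma msmooth_on_mult:
  fixes f g :: "'a \<Rightarrow> real"
  shows "mopen M W \<Longrightarrow> msmooth_on M W f \<Longrightarrow> msmooth_on M W g \<Longrightarrow> msmooth_on M W (\<lambda>x. f x * g x)"
  by (rule msmooth_on_I) (auto intro: smooth_on_mult mopenD msmooth_on_D)

lemma msmooth_on_inner:
  "mopen M W \<Longrightarrow> msmooth_on M W f \<Longrightarrow> msmooth_on M W g \<Longrightarrow> msmooth_on M W (\<lambda>x. inner (f x) (g x))"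
  by (rule msmooth_on_I) (auto intro: smooth_on_inner mopenD msmooth_on_D)

lemma msmooth_on_Pair:
  "mopen M W \<Longrightarrow> msmooth_on M W f \<Longrightarrow> msmooth_on M W g \<Longrightarrow> msmooth_on M W (\<lambda>x. (f x, g x))"
  by (rule msmooth_on_I) (auto intro: smooth_on_Pair mopenD msmooth_on_D)

lemma msmooth_on_sum:
  "mopen M W \<Longrightarrow> (\<And>i. i \<in> I \<Longrightarrow> msmooth_on M W (f i)) \<Longrightarrow> msmooth_on M W (\<lambda>x. \<Sum>i\<in>I. f i x)"
  by (rule msmooth_on_I, rule smooth_on_sum) (auto intro: mopenD msmooth_on_D)

lemma msmooth_on_inverse:
  fixes f :: "'a \<Rightarrow> real"
  assumes "mopen M W" "\<And>x. x \<in> W \<Longrightarrow> f x \<noteq> 0" "msmooth_on M W f"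
  shows "msmooth_on M W (\<lambda>x. inverse (f x))"
proof (rule msmooth_on_I)
  fix U \<phi> assume U: "(U, \<phi>) \<in> M"
  show "smooth_on (\<phi> ` (U \<inter> W)) (\<lambda>z. inverse (f (inv_into U \<phi> z)))"
    using inv_chart[OF U] assms(2)
    by (intro smooth_on_inverse mopenD[OF assms(1) U] msmooth_on_D[OF assms(3) U]) blast
qed

lemma msmooth_on_compose:
  fixes f :: "'a \<Rightarrow> 'v::fd_inner"
  assumes "mopen M W" "open T" "\<And>x. x \<in> W \<Longrightarrow> x \<in> points M \<Longrightarrow> f x \<in> T" "msmooth_on M W f" "smooth_on T g"
  shows "msmooth_on M W (\<lambda>x. g (f x))"
proof (rule msmooth_on_I)
  fix U \<phi> assume U: "(U, \<phi>) \<in> M"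
  show "smooth_on (\<phi> ` (U \<inter> W)) (\<lambda>z. g (f (inv_into U \<phi> z)))"
    using inv_chart[OF U] assms(3) chart_subset_points[OF U]
    by (intro smooth_on_compose[OF mopenD[OF assms(1) U] assms(2) _ msmooth_on_D[OF assms(4) U] assms(5)])
      blast
qed

lemma mopen_vimage:
  fixes f :: "'a \<Rightarrow> 'v::real_normed_vector"
  assumes "mopen M W" "msmooth_on M W f" "open T"
  shows "mopen M {x \<in> W. f x \<in> T}"
  unfolding mopen_def
proof safe
  fix U \<phi> assume U: "(U, \<phi>) \<in> M"
  let ?S = "\<phi> ` (U \<inter> W)" and ?f = "\<lambda>z. f (inv_into U \<phi> z)"
  have "open (?S \<inter> ?f -` T)"
    by (rule continuous_open_preimage[OF smooth_on_imp_continuous[OF msmooth_on_D[OF assms(2) U]]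
        mopenD[OF assms(1) U] assms(3)])
  moreover have "\<phi> ` (U \<inter> {x \<in> W. f x \<in> T}) = ?S \<inter> ?f -` T"
    using inj_chart[OF U] by (auto simp: inj_on_def inv_into_f_f[OF inj_chart[OF U]])
  ultimately show "open (\<phi> ` (U \<inter> {x \<in> W. f x \<in> T}))" by simp
qed

text \<open>Extension by zero: off \<open>V\<close> the function \<open>f\<close> may be arbitrary,
  because the product vanishes on the open complement of \<open>K\<close>, and this complement and
  \<open>V\<close> together cover the manifold.\<close>

lemma msmooth_on_cutoff:
  fixes \<psi> :: "'a \<Rightarrow> real"
  assumes "\<psi> \<in> Cinf M" "\<And>x. x \<notin> K \<Longrightarrow> \<psi> x = 0" "mopen M (points M - K)" "K \<subseteq> V"
    and "mopen M V" "mopen M W" "msmooth_on M (V \<inter> W) f"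
  shows "msmooth_on M W (\<lambda>x. \<psi> x *\<^sub>R f x)"
proof -
  have "msmooth_on M (V \<inter> W) (\<lambda>x. \<psi> x *\<^sub>R f x)"
    using assms(1) by (intro msmooth_on_scaleR mopen_Int assms) (auto simp: Cinf_def intro: msmooth_on_subset)
  moreover have "msmooth_on M ((points M - K) \<inter> W) (\<lambda>x. \<psi> x *\<^sub>R f x)"
    using assms(2) by (intro msmooth_on_cong[OF _ _ msmooth_on_const[of _ 0]] mopen_Int assms) auto
  ultimately have "msmooth_on M ((V \<inter> W) \<union> ((points M - K) \<inter> W)) (\<lambda>x. \<psi> x *\<^sub>R f x)"
    by (intro msmooth_on_Un mopen_Int assms)
  then show ?thesis by (rule msmooth_on_subset) (use assms(4) in auto)
qed

lemma Cinf_const: "(\<lambda>x. c) \<in> Cinf M"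
  by (simp add: Cinf_def msmooth_on_const mopen_points)

lemma Cinf_add: "f \<in> Cinf M \<Longrightarrow> g \<in> Cinf M \<Longrightarrow> (\<lambda>x. f x + g x) \<in> Cinf M"
  by (simp add: Cinf_def msmooth_on_add mopen_points)

lemma Cinf_mult: "f \<in> Cinf M \<Longrightarrow> g \<in> Cinf M \<Longrightarrow> (\<lambda>x. f x * g x) \<in> Cinf M"
  by (simp add: Cinf_def msmooth_on_mult mopen_points)

lemma Cinf_uminus: "f \<in> Cinf M \<Longrightarrow> (\<lambda>x. - f x) \<in> Cinf M"
  using Cinf_mult[OF Cinf_const[of "- 1"]] by simp

lemma Cinf_sum: "(\<And>i. i \<in> I \<Longrightarrow> f i \<in> Cinf M) \<Longrightarrow> (\<lambda>x. \<Sum>i\<in>I. f i x) \<in> Cinf M"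
  by (simp add: Cinf_def msmooth_on_sum mopen_points)

lemma Cinf_cong: "f \<in> Cinf M \<Longrightarrow> (\<And>x. x \<in> points M \<Longrightarrow> f x = g x) \<Longrightarrow> g \<in> Cinf M"
  unfolding Cinf_def mem_Collect_eq by (rule msmooth_on_cong[OF mopen_points])

lemma Cinf_subset: "f \<in> Cinf M \<Longrightarrow> msmooth_on M W f"
  unfolding Cinf_def mem_Collect_eq by (rule msmooth_on_subset) auto

text \<open>Division by \<^term>\<open>\<theta>\<close> near \<^term>\<open>x\<close> replaces localization by a function that is 1 near
  \<^term>\<open>x\<close>.\<close>

lemma Cinf_locally_mult:
  fixes f :: "'a \<Rightarrow> real"
  assumes "\<And>x. x \<in> points M \<Longrightarrow> \<exists>\<theta>\<in>Cinf M. \<theta> x \<noteq> 0 \<and> (\<lambda>y. \<theta> y * f y) \<in> Cinf M"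
  shows "f \<in> Cinf M"
  unfolding Cinf_def mem_Collect_eq
proof (rule msmooth_on_locally)
  fix x assume "x \<in> points M"
  then obtain \<theta> where \<theta>: "\<theta> \<in> Cinf M" "\<theta> x \<noteq> 0" "(\<lambda>y. \<theta> y * f y) \<in> Cinf M"
    using assms by blast
  let ?W = "{y \<in> points M. \<theta> y \<in> - {0}}"
  have W: "mopen M ?W"
    using \<theta>(1) by (intro mopen_vimage mopen_points Cinf_subset) auto
  have "msmooth_on M ?W (\<lambda>y. inverse (\<theta> y) * (\<theta> y * f y))"
    by (intro msmooth_on_mult W msmooth_on_inverse Cinf_subset \<theta>) auto
  then have "msmooth_on M ?W f"
    by (rule msmooth_on_cong[OF W, rotated]) auto
  with W \<theta>(2) \<open>x \<in> points M\<close> show "\<exists>W'. mopen M W' \<and> x \<in> W' \<and> msmooth_on M W' f" by blast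
qed

section \<open>Tangent vectors as derivations\<close>

lemma tangent_spaceD:
  assumes "v \<in> tangent_space M p" "f \<in> Cinf M" "g \<in> Cinf M"
  shows "v (\<lambda>x. f x + g x) = v f + v g" "v (\<lambda>x. c * f x) = c * v f"
    "v (\<lambda>x. f x * g x) = f p * v g + g p * v f"
proof -
  have "v (f + g) = v f + v g" "v (c *\<^sub>R f) = c *\<^sub>R v f"
    using assms unfolding tangent_space_def dual_space_def linear_on_set_def by auto
  then show "v (\<lambda>x. f x + g x) = v f + v g" "v (\<lambda>x. c * f x) = c * v f"
    by (simp_all add: plus_fun_def scaleR_fun_def)
  show "v (\<lambda>x. f x * g x) = f p * v g + g p * v f"
    using assms unfolding tangent_space_def by auto
qed

lemma tangent_const: "v \<in> tangent_space M p \<Longrightarrow> v (\<lambda>x. c) = 0"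
proof -
  assume v: "v \<in> tangent_space M p"
  have "v (\<lambda>x. 1 * 1) = 1 * v (\<lambda>x. 1) + 1 * v (\<lambda>x. 1)"
    by (rule tangent_spaceD(3)[OF v Cinf_const Cinf_const])
  then have "v (\<lambda>x. 1) = 0" by simp
  with tangent_spaceD(2)[OF v Cinf_const Cinf_const, of c 1] show ?thesis by simp
qed

lemma tangent_sum:
  assumes "v \<in> tangent_space M p" "\<And>i. i \<in> I \<Longrightarrow> f i \<in> Cinf M"
  shows "v (\<lambda>x. \<Sum>i\<in>I. f i x) = (\<Sum>i\<in>I. v (f i))"
  using assms(2)
proof (induction I rule: infinite_finite_induct)
  case (insert i I)
  then show ?case
    using tangent_spaceD(1)[OF assms(1), of "f i" "\<lambda>x. \<Sum>i\<in>I. f i x"] by (auto intro: Cinf_sum)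
qed (use tangent_const[OF assms(1)] in auto)

lemma tangent_cong:
  assumes v: "v \<in> tangent_space M p" and p: "p \<in> points M"
    and f: "f \<in> Cinf M" and eq: "\<And>x. x \<in> points M \<Longrightarrow> f x = g x"
  shows "v f = v g"
proof -
  define h where "h = (\<lambda>x. f x + (- 1) * g x)"
  define u where "u = (\<lambda>x. if x \<in> points M then 0 else (1::real))"
  have g: "g \<in> Cinf M" using Cinf_cong[OF f eq] .
  have h: "h \<in> Cinf M" unfolding h_def by (intro Cinf_add f g Cinf_mult Cinf_const)
  have u: "u \<in> Cinf M" by (rule Cinf_cong[OF Cinf_const[of 0]]) (simp add: u_def)
  \<comment> \<open>The difference \<open>h\<close> vanishes on the manifold and equals its product
    with the indicator function \<open>u\<close> of the complement. Both factors are 0 at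
    \<open>p\<close>, hence so is the product rule.\<close>
  have "h = (\<lambda>x. u x * h x)" using eq by (auto simp: u_def h_def)
  then have "v h = u p * v h + h p * v u" using tangent_spaceD(3)[OF v u h] by simp
  then have "v h = 0" using p eq by (simp add: u_def h_def)
  moreover have "v h = v f - v g"
    unfolding h_def using tangent_spaceD(1)[OF v f, of "\<lambda>x. (- 1) * g x"] tangent_spaceD(2)[OF v g g, of "- 1"]
      g Cinf_mult[OF Cinf_const[of "- 1"] g] by simp
  ultimately show ?thesis by simp
qed

end


section \<open>Bump functions on manifolds\<close>

locale manifold =
  fixes M :: "('a, 'm::fd_inner) atlas"
  assumes smooth_manifold: "smooth_manifold M"

sublocale manifold \<subseteq> charted
  using smooth_manifold by unfold_locales (auto simp: smooth_manifold_def)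

context manifold
begin

lemma mopen_chart: "(U, \<phi>) \<in> M \<Longrightarrow> mopen M U"
  using smooth_manifold unfolding smooth_manifold_def mopen_def by blast

lemma msmooth_on_chart: "(U, \<phi>) \<in> M \<Longrightarrow> msmooth_on M U \<phi>"
  using smooth_manifold unfolding smooth_manifold_def msmooth_on_def by blast

text \<open>The inverse chart is continuous into \<open>mtop M\<close>, so the image of
  \<open>C\<close> is compact, and compact sets in a Hausdorff space are closed.\<close>

lemma closed_chart_image:
  assumes U: "(U, \<phi>) \<in> M" and C: "compact C" "C \<subseteq> \<phi> ` U"
  shows "mopen M (points M - inv_into U \<phi> ` C)"
proof -
  have "continuous_map (top_of_set (\<phi> ` U)) (mtop M) (inv_into U \<phi>)"
    unfolding continuous_map_def
  proof (intro conjI allI impI)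
    show "inv_into U \<phi> \<in> topspace (top_of_set (\<phi> ` U)) \<rightarrow> topspace (mtop M)"
      using inv_chart[OF U, of _ U] chart_subset_points[OF U] by (auto simp: topspace_mtop)
    fix W assume "openin (mtop M) W"
    then have "open (\<phi> ` (U \<inter> W))" using mopenD[OF _ U] openin_mtop by blast
    moreover have "{x \<in> topspace (top_of_set (\<phi> ` U)). inv_into U \<phi> x \<in> W} = \<phi> ` (U \<inter> W)"
      using inj_chart[OF U] by auto
    moreover have "\<phi> ` (U \<inter> W) \<subseteq> \<phi> ` U" by blast
    ultimately show "openin (top_of_set (\<phi> ` U)) {x \<in> topspace (top_of_set (\<phi> ` U)). inv_into U \<phi> x \<in> W}"
      by (simp add: open_subset)
  qed
  moreover have "compactin (top_of_set (\<phi> ` U)) C" using C by (simp add: compactin_subtopology)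
  ultimately have "compactin (mtop M) (inv_into U \<phi> ` C)" by (metis image_compactin)
  moreover have "Hausdorff_space (mtop M)" using smooth_manifold by (simp add: smooth_manifold_def)
  ultimately have "closedin (mtop M) (inv_into U \<phi> ` C)" by (metis compactin_imp_closedin)
  then show ?thesis by (simp add: closedin_def openin_mtop topspace_mtop)
qed

text \<open>A bump in a chart, extended by zero. Besides the function, the image \<open>K\<close> of
  a closed ball is returned, since cutting off needs a closed carrier inside \<open>W\<close> and
  not just vanishing off \<open>W\<close>.\<close>

lemma manifold_bump_exists:
  assumes W: "mopen M W" "q \<in> W" "q \<in> points M"
  obtains \<psi> :: "'a \<Rightarrow> real" and K where "\<psi> \<in> Cinf M" "\<psi> q = 1" "\<And>x. x \<notin> K \<Longrightarrow> \<psi> x = 0" "K \<subseteq> W"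
    "mopen M (points M - K)"
proof -
  obtain U \<phi> where U: "(U, \<phi>) \<in> M" "q \<in> U" using W(3) pointsE by blast
  have "open (\<phi> ` (U \<inter> W))" "\<phi> q \<in> \<phi> ` (U \<inter> W)" using mopenD[OF W(1) U(1)] U W by auto
  then obtain r where r: "r > 0" "cball (\<phi> q) r \<subseteq> \<phi> ` (U \<inter> W)" by (meson open_contains_cball)
  obtain h :: "'m \<Rightarrow> real" where h: "smooth_on UNIV h" "h (\<phi> q) = 1" "\<And>x. x \<notin> cball (\<phi> q) r \<Longrightarrow> h x = 0"
    using bump_exists[OF r(1)] by blast
  define K where "K = inv_into U \<phi> ` cball (\<phi> q) r"
  define \<psi> where "\<psi> x = (if x \<in> U then h (\<phi> x) else 0)" for x
  have rU: "cball (\<phi> q) r \<subseteq> \<phi> ` U" using r(2) by blast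
  have KW: "K \<subseteq> U \<inter> W" using inv_chart[OF U(1)] r(2) by (auto simp: K_def)
  have Kop: "mopen M (points M - K)"
    unfolding K_def by (rule closed_chart_image[OF U(1) _ rU]) simp
  have off: "\<psi> x = 0" if "x \<notin> K" for x
  proof (cases "x \<in> U")
    case True
    have "\<phi> x \<notin> cball (\<phi> q) r"
      using that inv_into_f_f[OF inj_chart[OF U(1)] True] unfolding K_def by (metis imageI)
    with h(3) show ?thesis by (simp add: \<psi>_def)
  qed (simp add: \<psi>_def)
  have "msmooth_on M U (\<lambda>x. h (\<phi> x))"
    by (rule msmooth_on_compose[OF mopen_chart[OF U(1)] open_UNIV _ msmooth_on_chart[OF U(1)] h(1)]) simp
  then have "msmooth_on M U \<psi>"
    by (rule msmooth_on_cong[OF mopen_chart[OF U(1)], rotated]) (simp add: \<psi>_def)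
  moreover have "msmooth_on M (points M - K) \<psi>"
    by (rule msmooth_on_cong[OF Kop _ msmooth_on_const[OF Kop, of 0]]) (simp add: off)
  ultimately have "msmooth_on M (U \<union> (points M - K)) \<psi>"
    by (intro msmooth_on_Un mopen_chart[OF U(1)] Kop)
  then have "\<psi> \<in> Cinf M" unfolding Cinf_def mem_Collect_eq by (rule msmooth_on_subset) (use KW in auto)
  moreover have "\<psi> q = 1" using U h by (simp add: \<psi>_def)
  ultimately show ?thesis using that off Kop KW by blast
qed

end

section \<open>Smooth maps\<close>

text \<open>Used for the identity of the base and for the projection of the dual bundle, so that
  each fact about sections along a map covers both sections of \<open>E\<close> and sections pulled
  back to the dual bundle.\<close>

definition smooth_map ::
    "('n, 'k::fd_inner) atlas \<Rightarrow> ('n \<Rightarrow> 'a) \<Rightarrow> ('a, 'm::fd_inner) atlas \<Rightarrow> bool" where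
  "smooth_map N h M \<longleftrightarrow> charted N \<and> (\<forall>x\<in>points N. h x \<in> points M) \<and>
     (\<forall>(V, \<psi>)\<in>M. mopen N {x \<in> points N. h x \<in> V} \<and>
        msmooth_on N {x \<in> points N. h x \<in> V} (\<lambda>x. \<psi> (h x)))"

context charted
begin

lemma mopen_smooth_map:
  assumes h: "smooth_map N h M" and W: "mopen M W"
  shows "mopen N {x \<in> points N. h x \<in> W}"
proof -
  interpret N: charted N using h by (simp add: smooth_map_def)
  let ?P = "\<lambda>(V, \<psi>). {x \<in> {x \<in> points N. h x \<in> V}. \<psi> (h x) \<in> \<psi> ` (V \<inter> W)}"
  have "mopen N (?P c)" if "c \<in> M" for c
  proof -
    obtain V \<psi> where c: "c = (V, \<psi>)" by (cases c)
    then have V: "(V, \<psi>) \<in> M" using that by simp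
    then have "mopen N {x \<in> points N. h x \<in> V}"
      "msmooth_on N {x \<in> points N. h x \<in> V} (\<lambda>x. \<psi> (h x))"
      using h by (auto simp: smooth_map_def)
    from N.mopen_vimage[OF this mopenD[OF W V]] show ?thesis by (simp add: c)
  qed
  then have "mopen N (\<Union>(?P ` M))" by (intro N.mopen_Union) auto
  moreover have "{x \<in> points N. h x \<in> W} = \<Union>(?P ` M)"
  proof (intro equalityI subsetI)
    fix x assume x: "x \<in> {x \<in> points N. h x \<in> W}"
    then have "h x \<in> points M" using h by (auto simp: smooth_map_def)
    then obtain V \<psi> where "(V, \<psi>) \<in> M" "h x \<in> V" by (rule pointsE)
    with x show "x \<in> \<Union>(?P ` M)" by (intro UN_I[of "(V, \<psi>)"]) auto
  next
    fix x assume "x \<in> \<Union>(?P ` M)"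
    then obtain V \<psi> where "(V, \<psi>) \<in> M" "x \<in> points N" "h x \<in> V" "\<psi> (h x) \<in> \<psi> ` (V \<inter> W)" by auto
    with inj_chart[of V \<psi>] show "x \<in> {x \<in> points N. h x \<in> W}" by (auto simp: inj_on_def)
  qed
  ultimately show ?thesis by simp
qed

lemma msmooth_on_smooth_map:
  assumes h: "smooth_map N h M" and W: "mopen M W" and f: "msmooth_on M W f"
  shows "msmooth_on N {x \<in> points N. h x \<in> W} (\<lambda>x. f (h x))"
proof -
  interpret N: charted N using h by (simp add: smooth_map_def)
  show ?thesis
  proof (rule N.msmooth_on_locally)
    fix x assume x: "x \<in> {x \<in> points N. h x \<in> W}"
    then have "h x \<in> points M" using h by (auto simp: smooth_map_def)
    then obtain V \<psi> where V: "(V, \<psi>) \<in> M" "h x \<in> V" by (rule pointsE)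
    let ?V = "{x \<in> points N. h x \<in> V}" and ?W = "{x \<in> points N. h x \<in> W}"
    have mV: "mopen N ?V" "msmooth_on N ?V (\<lambda>x. \<psi> (h x))"
      using h V by (auto simp: smooth_map_def)
    have mVW: "mopen N (?V \<inter> ?W)" by (intro N.mopen_Int mV mopen_smooth_map[OF h W])
    have "msmooth_on N (?V \<inter> ?W) (\<lambda>x. f (inv_into V \<psi> (\<psi> (h x))))"
      by (rule N.msmooth_on_compose[OF mVW mopenD[OF W V(1)] _ _ msmooth_on_D[OF f V(1)]])
        (auto intro: N.msmooth_on_subset[OF mV(2)])
    then have "msmooth_on N (?V \<inter> ?W) (\<lambda>x. f (h x))"
      by (rule N.msmooth_on_cong[OF mVW, rotated]) (simp add: inv_into_f_f[OF inj_chart[OF V(1)]])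
    with mVW x V show "\<exists>W'. mopen N W' \<and> x \<in> W' \<and> msmooth_on N W' (\<lambda>x. f (h x))" by blast
  qed
qed

lemma Cinf_smooth_map:
  assumes h: "smooth_map N h M" and f: "f \<in> Cinf M"
  shows "(\<lambda>x. f (h x)) \<in> Cinf N"
proof -
  interpret N: charted N using h by (simp add: smooth_map_def)
  show ?thesis using msmooth_on_smooth_map[OF h mopen_points, of f] f h
    unfolding Cinf_def mem_Collect_eq smooth_map_def by (auto intro: N.msmooth_on_subset)
qed

end

lemma (in manifold) smooth_map_id: "smooth_map M (\<lambda>x. x) M"
proof -
  have "{x \<in> points M. x \<in> V} = V" if "(V, \<psi>) \<in> M" for V \<psi>
    using chart_subset_points[OF that] by auto
  then show ?thesis unfolding smooth_map_def
    using mopen_chart msmooth_on_chart by (auto intro: charted_axioms)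
qed


section \<open>Vector bundles and their duals\<close>

text \<open>The representing vector has the values of \<open>l\<close> on the orthonormal basis as
  coefficients, which justifies the definite description in \<open>riesz\<close>.\<close>

lemma linear_riesz:
  fixes l :: "'c::fd_inner \<Rightarrow> real"
  assumes "linear l"
  shows "inner (riesz l) w = l w"
proof -
  define u where "u = (\<Sum>b\<in>onb. l b *\<^sub>R b)"
  have u: "l w = inner u w" for w
  proof -
    have "inner u w = (\<Sum>b\<in>onb. inner w b *\<^sub>R l b)"
      unfolding u_def by (simp add: inner_sum_left inner_commute[of w] mult.commute)
    then show ?thesis using linear_onb[OF assms, of w] by simp
  qed
  have "riesz l = u" unfolding riesz_def
  proof (rule the_equality)
    show "\<forall>c. l c = inner u c" using u by blast
    fix w assume "\<forall>c. l c = inner w c"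
    then have "inner (w - u) (w - u) = 0" using u by (simp add: inner_diff_left)
    then show "w = u" by simp
  qed
  with u show ?thesis by simp
qed

lemma inner_ext: "(\<And>w. inner u w = inner v w) \<Longrightarrow> u = v"
  by (metis inner_diff_left inner_eq_zero_iff right_minus_eq)

lemma dual_spaceD:
  assumes "\<alpha> \<in> dual_space V"
  shows "x \<in> V \<Longrightarrow> y \<in> V \<Longrightarrow> \<alpha> (x + y) = \<alpha> x + \<alpha> y" "x \<in> V \<Longrightarrow> \<alpha> (c *\<^sub>R x) = c * \<alpha> x"
    "x \<notin> V \<Longrightarrow> \<alpha> x = 0"
  using assms by (auto simp: dual_space_def linear_on_set_def)

lemma dual_space_0: "\<alpha> \<in> dual_space V \<Longrightarrow> subspace V \<Longrightarrow> \<alpha> 0 = 0"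
  using dual_spaceD(2)[of \<alpha> V 0 0] by (simp add: subspace_0)

lemma dual_space_sum:
  assumes "\<alpha> \<in> dual_space V" "subspace V" "\<And>i. i \<in> I \<Longrightarrow> x i \<in> V"
  shows "\<alpha> (\<Sum>i\<in>I. c i *\<^sub>R x i) = (\<Sum>i\<in>I. c i * \<alpha> (x i))"
  using assms(3)
proof (induction I rule: infinite_finite_induct)
  case (insert i I)
  then have "c i *\<^sub>R x i \<in> V" "(\<Sum>i\<in>I. c i *\<^sub>R x i) \<in> V"
    by (auto intro: subspace_scale subspace_sum assms(2))
  with insert show ?case by (simp add: dual_spaceD[OF assms(1)])
qed (use dual_space_0[OF assms(1,2)] in auto)

lemma subspace_dual_space:
  assumes "subspace V" shows "subspace (dual_space V)"
  unfolding subspace_def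
proof (intro conjI ballI allI)
  show "0 \<in> dual_space V" by (simp add: dual_space_def linear_on_set_def)
  show "\<alpha> + \<beta> \<in> dual_space V" if "\<alpha> \<in> dual_space V" "\<beta> \<in> dual_space V" for \<alpha> \<beta>
    using that by (simp add: dual_space_def linear_on_set_def distrib_left)
  show "r *\<^sub>R \<alpha> \<in> dual_space V" if "\<alpha> \<in> dual_space V" for r \<alpha>
    using that by (simp add: dual_space_def linear_on_set_def distrib_left scaleR_fun_def)
qed

locale smooth_bundle =
  fixes E :: "('q, 'b::fd_inner, 'e::real_vector, 'c::fd_inner) vbundle"
  assumes vector_bundle: "vector_bundle E"

sublocale smooth_bundle \<subseteq> Q: manifold "base E"
  using vector_bundle by unfold_locales (simp add: vector_bundle_def)

context smooth_bundle
begin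

definition vec :: "('q \<Rightarrow> 'e \<Rightarrow> 'c) \<Rightarrow> 'q \<Rightarrow> 'c \<Rightarrow> 'e" where
  "vec \<Phi> q w = inv_into (fibre E q) (\<Phi> q) w"

text \<open>The covector with dual coordinates \<open>y\<close>, inverse to \<open>dcoord\<close>.
  The value 0 off the fibre is the normalization demanded by \<open>dual_space\<close>.\<close>

definition cov :: "('q \<Rightarrow> 'e \<Rightarrow> 'c) \<Rightarrow> 'q \<Rightarrow> 'c \<Rightarrow> 'e \<Rightarrow> real" where
  "cov \<Phi> q y = (\<lambda>e. if e \<in> fibre E q then inner y (\<Phi> q e) else 0)"

definition dcoord :: "('q \<Rightarrow> 'e \<Rightarrow> 'c) \<Rightarrow> 'q \<Rightarrow> ('e \<Rightarrow> real) \<Rightarrow> 'c" where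
  "dcoord \<Phi> q \<alpha> = riesz (\<alpha> \<circ> inv_into (fibre E q) (\<Phi> q))"

lemma subspace_fibre: "q \<in> points (base E) \<Longrightarrow> subspace (fibre E q)"
  using vector_bundle by (simp add: vector_bundle_def)

lemma triv_cover:
  assumes "q \<in> points (base E)" obtains V \<Phi> where "(V, \<Phi>) \<in> trivs E" "q \<in> V"
proof -
  have "\<Union>(fst ` trivs E) = points (base E)" using vector_bundle by (simp add: vector_bundle_def)
  with assms obtain c where "c \<in> trivs E" "q \<in> fst c" by blast
  then show ?thesis using that[of "fst c" "snd c"] by simp
qed

lemma triv_props:
  assumes "(V, \<Phi>) \<in> trivs E"
  shows "openin (mtop (base E)) V"
    "\<forall>q\<in>V. linear_on_set (fibre E q) (\<Phi> q) \<and> bij_betw (\<Phi> q) (fibre E q) UNIV"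
proof -
  have "\<forall>(U, \<Phi>)\<in>trivs E. openin (mtop (base E)) U \<and>
        (\<forall>q\<in>U. linear_on_set (fibre E q) (\<Phi> q) \<and> bij_betw (\<Phi> q) (fibre E q) UNIV)"
    using vector_bundle unfolding vector_bundle_def by (elim conjE)
  from bspec[OF this assms] show "openin (mtop (base E)) V"
    "\<forall>q\<in>V. linear_on_set (fibre E q) (\<Phi> q) \<and> bij_betw (\<Phi> q) (fibre E q) UNIV" by simp_all
qed

lemma
  assumes "(V, \<Phi>) \<in> trivs E"
  shows mopen_triv: "mopen (base E) V" and triv_subset: "V \<subseteq> points (base E)"
  using triv_props(1)[OF assms] by (auto simp: Q.openin_mtop)

lemma triv_linear:
  assumes "(V, \<Phi>) \<in> trivs E" "q \<in> V"
  shows "e \<in> fibre E q \<Longrightarrow> e' \<in> fibre E q \<Longrightarrow> \<Phi> q (e + e') = \<Phi> q e + \<Phi> q e'"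
    "e \<in> fibre E q \<Longrightarrow> \<Phi> q (r *\<^sub>R e) = r *\<^sub>R \<Phi> q e"
  using bspec[OF triv_props(2)[OF assms(1)] assms(2)] unfolding linear_on_set_def by blast+

lemma triv_bij: "(V, \<Phi>) \<in> trivs E \<Longrightarrow> q \<in> V \<Longrightarrow> bij_betw (\<Phi> q) (fibre E q) UNIV"
  using triv_props(2) by blast

lemma
  assumes "(V, \<Phi>) \<in> trivs E" "q \<in> V"
  shows vec_in: "vec \<Phi> q w \<in> fibre E q" and triv_vec: "\<Phi> q (vec \<Phi> q w) = w"
    and vec_triv: "e \<in> fibre E q \<Longrightarrow> vec \<Phi> q (\<Phi> q e) = e"
  using triv_bij[OF assms] unfolding vec_def bij_betw_def
  by (metis UNIV_I inv_into_into, metis UNIV_I f_inv_into_f, metis inv_into_f_f)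

lemma linear_vec:
  assumes V: "(V, \<Phi>) \<in> trivs E" "q \<in> V"
  shows "linear (vec \<Phi> q)"
proof -
  have sub: "subspace (fibre E q)" using subspace_fibre triv_subset V by blast
  show ?thesis
  proof (rule linearI)
    fix w w' :: 'c and r :: real
    have "vec \<Phi> q (w + w') = vec \<Phi> q (\<Phi> q (vec \<Phi> q w + vec \<Phi> q w'))"
      by (simp add: triv_linear[OF V] vec_in[OF V] triv_vec[OF V])
    then show "vec \<Phi> q (w + w') = vec \<Phi> q w + vec \<Phi> q w'"
      using vec_triv[OF V] vec_in[OF V] sub subspace_add by metis
    have "vec \<Phi> q (r *\<^sub>R w) = vec \<Phi> q (\<Phi> q (r *\<^sub>R vec \<Phi> q w))"
      by (simp add: triv_linear[OF V] vec_in[OF V] triv_vec[OF V])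
    then show "vec \<Phi> q (r *\<^sub>R w) = r *\<^sub>R vec \<Phi> q w"
      using vec_triv[OF V] vec_in[OF V] sub subspace_scale by metis
  qed
qed

lemma linear_triv_vec:
  assumes "(V, \<Phi>) \<in> trivs E" "(V', \<Psi>) \<in> trivs E" "q \<in> V" "q \<in> V'"
  shows "linear (\<lambda>w. \<Psi> q (vec \<Phi> q w))"
  using assms by (intro linearI) (simp_all add: linear_add[OF linear_vec] linear_scale[OF linear_vec] triv_linear vec_in)

lemma msmooth_transition:
  assumes "(V, \<Phi>) \<in> trivs E" "(V', \<Psi>) \<in> trivs E"
  shows "msmooth_on (base E) (V \<inter> V') (\<lambda>q. \<Psi> q (vec \<Phi> q w))"
proof -
  have "\<forall>(U, \<Phi>)\<in>trivs E. \<forall>(V, \<Psi>)\<in>trivs E. \<forall>w.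
        msmooth_on (base E) (U \<inter> V) (\<lambda>q. \<Psi> q (inv_into (fibre E q) (\<Phi> q) w))"
    using vector_bundle unfolding vector_bundle_def by (elim conjE)
  from bspec[OF this assms(1)] have "\<forall>(V', \<Psi>)\<in>trivs E. \<forall>w.
        msmooth_on (base E) (V \<inter> V') (\<lambda>q. \<Psi> q (inv_into (fibre E q) (\<Phi> q) w))"
    by (simp only: prod.case)
  from bspec[OF this assms(2)] show ?thesis by (simp add: vec_def)
qed

lemma linear_dual_vec:
  assumes V: "(V, \<Phi>) \<in> trivs E" "q \<in> V" and \<alpha>: "\<alpha> \<in> dual_space (fibre E q)"
  shows "linear (\<lambda>w. \<alpha> (vec \<Phi> q w))"
  by (rule linearI) (simp_all add: linear_add[OF linear_vec[OF V]] linear_scale[OF linear_vec[OF V]]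
      dual_spaceD[OF \<alpha>] vec_in[OF V])

lemma inner_dcoord:
  assumes V: "(V, \<Phi>) \<in> trivs E" "q \<in> V" and \<alpha>: "\<alpha> \<in> dual_space (fibre E q)"
  shows "inner (dcoord \<Phi> q \<alpha>) w = \<alpha> (vec \<Phi> q w)"
proof -
  have "dcoord \<Phi> q \<alpha> = riesz (\<lambda>w. \<alpha> (vec \<Phi> q w))" by (simp add: dcoord_def vec_def comp_def)
  then show ?thesis using linear_riesz[OF linear_dual_vec[OF assms]] by simp
qed

lemma inner_dcoord_triv:
  assumes "(V, \<Phi>) \<in> trivs E" "q \<in> V" "\<alpha> \<in> dual_space (fibre E q)" "e \<in> fibre E q"
  shows "inner (dcoord \<Phi> q \<alpha>) (\<Phi> q e) = \<alpha> e"
  using assms by (simp add: inner_dcoord vec_triv)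

lemma cov_dual:
  assumes V: "(V, \<Phi>) \<in> trivs E" "q \<in> V"
  shows "cov \<Phi> q y \<in> dual_space (fibre E q)"
proof -
  have sub: "subspace (fibre E q)" using subspace_fibre triv_subset V by blast
  show ?thesis unfolding dual_space_def linear_on_set_def cov_def
    using subspace_add[OF sub] subspace_scale[OF sub] by (auto simp: triv_linear[OF V] inner_add_right)
qed

lemma cov_vec: "(V, \<Phi>) \<in> trivs E \<Longrightarrow> q \<in> V \<Longrightarrow> cov \<Phi> q y (vec \<Phi> q w) = inner y w"
  by (simp add: cov_def vec_in triv_vec)

lemma dcoord_cov: "(V, \<Phi>) \<in> trivs E \<Longrightarrow> q \<in> V \<Longrightarrow> dcoord \<Phi> q (cov \<Phi> q y) = y"
  by (rule inner_ext) (simp add: inner_dcoord cov_dual cov_vec)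

lemma cov_dcoord:
  "(V, \<Phi>) \<in> trivs E \<Longrightarrow> q \<in> V \<Longrightarrow> \<alpha> \<in> dual_space (fibre E q) \<Longrightarrow> cov \<Phi> q (dcoord \<Phi> q \<alpha>) = \<alpha>"
  by (auto simp: cov_def fun_eq_iff inner_dcoord_triv dual_spaceD)

text \<open>The change of trivialization of the dual bundle is the transpose of the inverse change of
  trivialization of \<^term>\<open>E\<close>.\<close>

lemma dcoord_change:
  assumes V: "(V, \<Phi>) \<in> trivs E" "q \<in> V" and V': "(V', \<Psi>) \<in> trivs E" "q \<in> V'"
    and \<alpha>: "\<alpha> \<in> dual_space (fibre E q)"
  shows "dcoord \<Psi> q \<alpha> = (\<Sum>c\<in>onb. inner (dcoord \<Phi> q \<alpha>) (\<Phi> q (vec \<Psi> q c)) *\<^sub>R c)"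
  by (subst onb_expand[of "dcoord \<Psi> q \<alpha>"])
    (simp only: inner_dcoord[OF V' \<alpha>] inner_dcoord_triv[OF V \<alpha> vec_in[OF V']])

section \<open>Charts and smooth functions on the total space of the dual bundle\<close>

lemma total_chartE:
  assumes "(A, X) \<in> dual_total E"
  obtains U \<phi> V \<Phi> where "(U, \<phi>) \<in> base E" "(V, \<Phi>) \<in> trivs E"
    "A = {(q, \<alpha>). q \<in> U \<inter> V \<and> \<alpha> \<in> dual_space (fibre E q)}"
    "X = (\<lambda>(q, \<alpha>). (\<phi> q, dcoord \<Phi> q \<alpha>))"
  using assms unfolding total_space_def dual_bundle_def dcoord_def by auto

lemma total_chartI:
  assumes "(U, \<phi>) \<in> base E" "(V, \<Phi>) \<in> trivs E"
  shows "({(q, \<alpha>). q \<in> U \<inter> V \<and> \<alpha> \<in> dual_space (fibre E q)}, \<lambda>(q, \<alpha>). (\<phi> q, dcoord \<Phi> q \<alpha>)) \<in> dual_total E"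
proof -
  have "(V, dcoord \<Phi>) \<in> trivs (dual_bundle E)"
    using assms(2) unfolding dual_bundle_def dcoord_def by auto
  then show ?thesis using assms(1) unfolding total_space_def mem_Collect_eq
    by (intro exI[of _ U] exI[of _ \<phi>] exI[of _ V] exI[of _ "dcoord \<Phi>"]) (simp add: dual_bundle_def)
qed

lemma points_total: "points (dual_total E) = {(q, \<alpha>). q \<in> points (base E) \<and> \<alpha> \<in> dual_space (fibre E q)}"
proof (intro equalityI subsetI)
  fix p assume "p \<in> points (dual_total E)"
  then obtain A X where "(A, X) \<in> dual_total E" "p \<in> A" by (auto simp: points_def)
  then show "p \<in> {(q, \<alpha>). q \<in> points (base E) \<and> \<alpha> \<in> dual_space (fibre E q)}"
    by (elim total_chartE) (use Q.chart_subset_points in auto)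
next
  fix p assume "p \<in> {(q, \<alpha>). q \<in> points (base E) \<and> \<alpha> \<in> dual_space (fibre E q)}"
  then obtain q \<alpha> where p: "p = (q, \<alpha>)" "q \<in> points (base E)" "\<alpha> \<in> dual_space (fibre E q)" by auto
  obtain U \<phi> where U: "(U, \<phi>) \<in> base E" "q \<in> U" using p(2) Q.pointsE by blast
  obtain V \<Phi> where V: "(V, \<Phi>) \<in> trivs E" "q \<in> V" using p(2) triv_cover by blast
  show "p \<in> points (dual_total E)"
    using total_chartI[OF U(1) V(1)] U V p by (force simp: points_def)
qed

lemma total_image:
  assumes U: "(U, \<phi>) \<in> base E" and V: "(V, \<Phi>) \<in> trivs E"
  shows "(\<lambda>(q, \<alpha>). (\<phi> q, dcoord \<Phi> q \<alpha>)) `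
      ({(q, \<alpha>). q \<in> U \<inter> V \<and> \<alpha> \<in> dual_space (fibre E q)} \<inter> {p. fst p \<in> W}) = \<phi> ` (U \<inter> (V \<inter> W)) \<times> UNIV"
proof (intro equalityI subsetI)
  fix z assume "z \<in> \<phi> ` (U \<inter> (V \<inter> W)) \<times> (UNIV :: 'c set)"
  then obtain q y where "q \<in> U" "q \<in> V" "q \<in> W" "z = (\<phi> q, y)" by auto
  then show "z \<in> (\<lambda>(q, \<alpha>). (\<phi> q, dcoord \<Phi> q \<alpha>)) `
      ({(q, \<alpha>). q \<in> U \<inter> V \<and> \<alpha> \<in> dual_space (fibre E q)} \<inter> {p. fst p \<in> W})"
    by (intro image_eqI[of _ _ "(q, cov \<Phi> q y)"]) (auto simp: dcoord_cov[OF V] cov_dual[OF V])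
qed auto

lemma total_inj:
  assumes U: "(U, \<phi>) \<in> base E" and V: "(V, \<Phi>) \<in> trivs E"
  shows "inj_on (\<lambda>(q, \<alpha>). (\<phi> q, dcoord \<Phi> q \<alpha>)) {(q, \<alpha>). q \<in> U \<inter> V \<and> \<alpha> \<in> dual_space (fibre E q)}"
proof (rule inj_onI, clarsimp)
  fix q \<alpha> q' \<alpha>' assume *: "q \<in> U" "q \<in> V" "\<alpha> \<in> dual_space (fibre E q)" "q' \<in> U" "q' \<in> V"
    "\<alpha>' \<in> dual_space (fibre E q')" "\<phi> q = \<phi> q'" "dcoord \<Phi> q \<alpha> = dcoord \<Phi> q' \<alpha>'"
  then have "q = q'" using Q.inj_chart[OF U] by (auto simp: inj_on_def)
  with * show "q = q' \<and> \<alpha> = \<alpha>'" using cov_dcoord[OF V] by metis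
qed

lemma total_inv:
  assumes U: "(U, \<phi>) \<in> base E" and V: "(V, \<Phi>) \<in> trivs E" and x: "x \<in> \<phi> ` (U \<inter> V)"
  shows "inv_into {(q, \<alpha>). q \<in> U \<inter> V \<and> \<alpha> \<in> dual_space (fibre E q)} (\<lambda>(q, \<alpha>). (\<phi> q, dcoord \<Phi> q \<alpha>)) (x, y) =
    (inv_into U \<phi> x, cov \<Phi> (inv_into U \<phi> x) y)"
proof (rule inv_into_f_eq[OF total_inj[OF U V]])
  have q: "inv_into U \<phi> x \<in> U \<inter> V" using Q.inv_chart[OF U x] .
  then show "(inv_into U \<phi> x, cov \<Phi> (inv_into U \<phi> x) y) \<in> {(q, \<alpha>). q \<in> U \<inter> V \<and> \<alpha> \<in> dual_space (fibre E q)}"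
    by (auto simp: cov_dual[OF V])
  show "(case (inv_into U \<phi> x, cov \<Phi> (inv_into U \<phi> x) y) of (q, \<alpha>) \<Rightarrow> (\<phi> q, dcoord \<Phi> q \<alpha>)) = (x, y)"
    using q x by (auto simp: dcoord_cov[OF V] f_inv_into_f)
qed

end

sublocale smooth_bundle \<subseteq> T: charted "dual_total E"
proof
  fix A X assume "(A, X) \<in> dual_total E"
  then obtain U \<phi> V \<Phi> where UV: "(U, \<phi>) \<in> base E" "(V, \<Phi>) \<in> trivs E"
    and AX: "A = {(q, \<alpha>). q \<in> U \<inter> V \<and> \<alpha> \<in> dual_space (fibre E q)}" "X = (\<lambda>(q, \<alpha>). (\<phi> q, dcoord \<Phi> q \<alpha>))"
    by (rule total_chartE)
  show "inj_on X A" unfolding AX by (rule total_inj[OF UV])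
  have "X ` A = \<phi> ` (U \<inter> V) \<times> UNIV" using total_image[OF UV, of UNIV] by (simp add: AX)
  then show "open (X ` A)" using Q.mopenD[OF mopen_triv[OF UV(2)] UV(1)] by (simp add: open_Times)
qed

context smooth_bundle
begin

abbreviation "TE \<equiv> dual_total E"

text \<open>Over a trivialization the inverse chart sends \<open>(x, y)\<close> to the covector with
  coordinates \<open>y\<close> at the point with coordinates \<open>x\<close>. Rewriting smoothness
  over an open set of the base in this explicit form keeps \<open>inv_into\<close> of the charts of
  the total space out of all later proofs.\<close>

lemma
  assumes W: "mopen (base E) W"
  shows mopen_total: "mopen TE {p \<in> points TE. fst p \<in> W}"
    and msmooth_total_I:
      "(\<And>U \<phi> V \<Phi>. (U, \<phi>) \<in> base E \<Longrightarrow> (V, \<Phi>) \<in> trivs E \<Longrightarrow> open (\<phi> ` (U \<inter> (V \<inter> W)) \<times> (UNIV::'c set)) \<Longrightarrow>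
        smooth_on (\<phi> ` (U \<inter> (V \<inter> W)) \<times> UNIV) (\<lambda>z. F (inv_into U \<phi> (fst z), cov \<Phi> (inv_into U \<phi> (fst z)) (snd z)))) \<Longrightarrow>
      msmooth_on TE {p \<in> points TE. fst p \<in> W} F"
    and msmooth_total_D:
      "\<And>U \<phi> V \<Phi>. msmooth_on TE {p \<in> points TE. fst p \<in> W} F \<Longrightarrow> (U, \<phi>) \<in> base E \<Longrightarrow>
        (V, \<Phi>) \<in> trivs E \<Longrightarrow>
        smooth_on (\<phi> ` (U \<inter> (V \<inter> W)) \<times> UNIV) (\<lambda>z. F (inv_into U \<phi> (fst z), cov \<Phi> (inv_into U \<phi> (fst z)) (snd z)))"
proof -
  let ?W = "{p \<in> points TE. fst p \<in> W}"
  let ?A = "\<lambda>U V. {(q, \<alpha>). q \<in> U \<inter> V \<and> \<alpha> \<in> dual_space (fibre E q)}"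
  let ?X = "\<lambda>\<phi> \<Phi>. (\<lambda>(q, \<alpha>). (\<phi> q, dcoord \<Phi> q \<alpha>))"
  let ?F = "\<lambda>U \<phi> \<Phi> z. F (inv_into U \<phi> (fst z), cov \<Phi> (inv_into U \<phi> (fst z)) (snd z))"
  have im: "?X \<phi> \<Phi> ` (?A U V \<inter> ?W) = \<phi> ` (U \<inter> (V \<inter> W)) \<times> UNIV" if "(U, \<phi>) \<in> base E" "(V, \<Phi>) \<in> trivs E" for U \<phi> V \<Phi>
  proof -
    have "?A U V \<inter> ?W = ?A U V \<inter> {p. fst p \<in> W}"
      using T.chart_subset_points[OF total_chartI[OF that]] by auto
    then show ?thesis using total_image[OF that] by simp
  qed
  have op: "open (\<phi> ` (U \<inter> (V \<inter> W)) \<times> (UNIV::'c set))" if "(U, \<phi>) \<in> base E" "(V, \<Phi>) \<in> trivs E" for U \<phi> V \<Phi>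
    using Q.mopenD[OF Q.mopen_Int[OF mopen_triv[OF that(2)] W] that(1)] by (simp add: open_Times)
  have F: "F (inv_into (?A U V) (?X \<phi> \<Phi>) z) = ?F U \<phi> \<Phi> z"
    if "(U, \<phi>) \<in> base E" "(V, \<Phi>) \<in> trivs E" "z \<in> \<phi> ` (U \<inter> (V \<inter> W)) \<times> UNIV" for U \<phi> V \<Phi> z
  proof -
    have "fst z \<in> \<phi> ` (U \<inter> V)" using that(3) by auto
    then have "inv_into (?A U V) (?X \<phi> \<Phi>) (fst z, snd z) = (inv_into U \<phi> (fst z), cov \<Phi> (inv_into U \<phi> (fst z)) (snd z))"
      by (rule total_inv[OF that(1,2)])
    then show ?thesis by simp
  qed
  show "mopen TE ?W"
    unfolding mopen_def using im op by (auto elim!: total_chartE)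
  show "msmooth_on TE ?W F"
    if *: "\<And>U \<phi> V \<Phi>. (U, \<phi>) \<in> base E \<Longrightarrow> (V, \<Phi>) \<in> trivs E \<Longrightarrow> open (\<phi> ` (U \<inter> (V \<inter> W)) \<times> (UNIV::'c set)) \<Longrightarrow>
        smooth_on (\<phi> ` (U \<inter> (V \<inter> W)) \<times> UNIV) (?F U \<phi> \<Phi>)"
  proof (rule T.msmooth_on_I)
    fix A X assume "(A, X) \<in> TE"
    then obtain U \<phi> V \<Phi> where UV: "(U, \<phi>) \<in> base E" "(V, \<Phi>) \<in> trivs E"
      and AX: "A = ?A U V" "X = ?X \<phi> \<Phi>"
      by (rule total_chartE)
    show "smooth_on (X ` (A \<inter> ?W)) (\<lambda>z. F (inv_into A X z))"
      unfolding AX im[OF UV]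
      by (rule smooth_on_cong[OF op[OF UV] _ *[OF UV op[OF UV]]]) (rule F[OF UV, symmetric])
  qed
  show "smooth_on (\<phi> ` (U \<inter> (V \<inter> W)) \<times> UNIV) (?F U \<phi> \<Phi>)"
    if "msmooth_on TE ?W F" and UV: "(U, \<phi>) \<in> base E" "(V, \<Phi>) \<in> trivs E" for U \<phi> V \<Phi>
    using T.msmooth_on_D[OF that(1) total_chartI[OF UV]] unfolding im[OF UV]
    by (rule smooth_on_cong[OF op[OF UV], rotated]) (rule F[OF UV])
qed

lemma smooth_on_base_total:
  assumes "mopen (base E) W" "msmooth_on (base E) W f" "(U, \<phi>) \<in> base E" "W' \<subseteq> W" "open (\<phi> ` (U \<inter> W') \<times> (UNIV::'c set))"
  shows "smooth_on (\<phi> ` (U \<inter> W') \<times> (UNIV::'c set)) (\<lambda>z. f (inv_into U \<phi> (fst z)))"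
  by (rule smooth_on_compose[OF assms(5) Q.mopenD[OF assms(1,3)] _ smooth_on_fst[OF assms(5)] Q.msmooth_on_D[OF assms(2,3)]])
    (use assms(4) in auto)

lemma smooth_map_fst: "smooth_map TE fst (base E)"
  unfolding smooth_map_def
proof (intro conjI ballI, safe)
  show "charted TE" ..
  show "(q, \<alpha>) \<in> points TE \<Longrightarrow> fst (q, \<alpha>) \<in> points (base E)" for q \<alpha> by (simp add: points_total)
  fix U' \<phi>' assume U': "(U', \<phi>') \<in> base E"
  show "mopen TE {p \<in> points TE. fst p \<in> U'}" by (rule mopen_total[OF Q.mopen_chart[OF U']])
  show "msmooth_on TE {p \<in> points TE. fst p \<in> U'} (\<lambda>p. \<phi>' (fst p))"
    by (rule msmooth_total_I[OF Q.mopen_chart[OF U']])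
      (auto intro!: smooth_on_base_total[OF Q.mopen_chart[OF U'] Q.msmooth_on_chart[OF U']])
qed

text \<open>In the coordinates \<open>(x, y)\<close> of another trivialization these dual
  coordinates are linear in \<open>y\<close>, with coefficients given by the transition functions of
  \<open>E\<close>.\<close>

lemma msmooth_dcoord:
  assumes V': "(V', \<Psi>) \<in> trivs E"
  shows "msmooth_on TE {p \<in> points TE. fst p \<in> V'} (\<lambda>p. dcoord \<Psi> (fst p) (snd p))"
proof (rule msmooth_total_I[OF mopen_triv[OF V']])
  fix U \<phi> V \<Phi> assume U: "(U, \<phi>) \<in> base E" and V: "(V, \<Phi>) \<in> trivs E"
    and op: "open (\<phi> ` (U \<inter> (V \<inter> V')) \<times> (UNIV::'c set))"
  have "smooth_on (\<phi> ` (U \<inter> (V \<inter> V')) \<times> UNIV)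
      (\<lambda>z. \<Sum>c\<in>onb. inner (snd z) (\<Phi> (inv_into U \<phi> (fst z)) (vec \<Psi> (inv_into U \<phi> (fst z)) c)) *\<^sub>R c)"
    by (intro smooth_on_sum smooth_on_scaleR smooth_on_inner smooth_on_snd smooth_on_const op
        smooth_on_base_total[OF Q.mopen_Int[OF mopen_triv[OF V'] mopen_triv[OF V]] msmooth_transition[OF V' V] U])
      auto
  then show "smooth_on (\<phi> ` (U \<inter> (V \<inter> V')) \<times> UNIV)
      (\<lambda>z. dcoord \<Psi> (fst (inv_into U \<phi> (fst z), cov \<Phi> (inv_into U \<phi> (fst z)) (snd z)))
        (snd (inv_into U \<phi> (fst z), cov \<Phi> (inv_into U \<phi> (fst z)) (snd z))))"
  proof (rule smooth_on_cong[OF op, rotated])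
    fix z assume z: "z \<in> \<phi> ` (U \<inter> (V \<inter> V')) \<times> (UNIV::'c set)"
    then have "inv_into U \<phi> (fst z) \<in> V \<inter> V'" using Q.inv_chart[OF U, of "fst z" "V \<inter> V'"] by auto
    then show "(\<Sum>c\<in>onb. inner (snd z) (\<Phi> (inv_into U \<phi> (fst z)) (vec \<Psi> (inv_into U \<phi> (fst z)) c)) *\<^sub>R c) =
      dcoord \<Psi> (fst (inv_into U \<phi> (fst z), cov \<Phi> (inv_into U \<phi> (fst z)) (snd z)))
        (snd (inv_into U \<phi> (fst z), cov \<Phi> (inv_into U \<phi> (fst z)) (snd z)))"
      by (subst dcoord_change[OF V _ V']) (auto simp: cov_dual[OF V] dcoord_cov[OF V])
  qed
qed

end

lemma sum_fun_apply: "(\<Sum>i\<in>I. f i) x = (\<Sum>i\<in>I. f i x)"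
  by (induction I rule: infinite_finite_induct) simp_all

context smooth_bundle
begin

section \<open>Sections\<close>

lemma sections_along_iff:
  "s \<in> sections_along N h E \<longleftrightarrow> (\<forall>x\<in>points N. s x \<in> fibre E (h x)) \<and> (\<forall>x. x \<notin> points N \<longrightarrow> s x = 0) \<and>
     (\<forall>V \<Phi>. (V, \<Phi>) \<in> trivs E \<longrightarrow> msmooth_on N {x \<in> points N. h x \<in> V} (\<lambda>x. \<Phi> (h x) (s x)))"
  by (auto simp: sections_along_def)

lemma dual_sections_along_iff:
  "\<nu> \<in> sections_along N h (dual_bundle E) \<longleftrightarrow>
     (\<forall>x\<in>points N. \<nu> x \<in> dual_space (fibre E (h x))) \<and> (\<forall>x. x \<notin> points N \<longrightarrow> \<nu> x = 0) \<and>
     (\<forall>V \<Phi>. (V, \<Phi>) \<in> trivs E \<longrightarrow> msmooth_on N {x \<in> points N. h x \<in> V} (\<lambda>x. dcoord \<Phi> (h x) (\<nu> x)))"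
proof -
  have "trivs (dual_bundle E) = (\<lambda>(V, \<Phi>). (V, dcoord \<Phi>)) ` trivs E"
    by (auto simp: dual_bundle_def dcoord_def[abs_def])
  moreover have "fibre (dual_bundle E) = (\<lambda>q. dual_space (fibre E q))" by (simp add: dual_bundle_def)
  ultimately show ?thesis by (auto simp: sections_along_def)
qed

lemma sections_along_id:
  "s \<in> sections E \<longleftrightarrow> s \<in> sections_along (base E) (\<lambda>q. q) E"
  "\<nu> \<in> sections (dual_bundle E) \<longleftrightarrow> \<nu> \<in> sections_along (base E) (\<lambda>q. q) (dual_bundle E)"
  by (simp_all add: sections_def dual_bundle_def)

lemma section_in: "s \<in> sections E \<Longrightarrow> q \<in> points (base E) \<Longrightarrow> s q \<in> fibre E q"
  by (simp add: sections_along_id sections_along_iff)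

lemma section_off: "s \<in> sections E \<Longrightarrow> q \<notin> points (base E) \<Longrightarrow> s q = 0"
  by (simp add: sections_along_id sections_along_iff)

lemma dual_section_in: "\<nu> \<in> sections (dual_bundle E) \<Longrightarrow> q \<in> points (base E) \<Longrightarrow> \<nu> q \<in> dual_space (fibre E q)"
  by (simp add: sections_along_id dual_sections_along_iff)

lemma triv_points: "(V, \<Phi>) \<in> trivs E \<Longrightarrow> {q \<in> points (base E). q \<in> V} = V"
  using triv_subset by blast

lemma section_msmooth:
  assumes "s \<in> sections E" "(V, \<Phi>) \<in> trivs E"
  shows "msmooth_on (base E) V (\<lambda>q. \<Phi> q (s q))"
proof -
  have "msmooth_on (base E) {q \<in> points (base E). q \<in> V} (\<lambda>q. \<Phi> q (s q))"
    using assms unfolding sections_along_id sections_along_iff by blast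
  then show ?thesis by (simp only: triv_points[OF assms(2)])
qed

lemma dual_section_msmooth:
  assumes "\<nu> \<in> sections (dual_bundle E)" "(V, \<Phi>) \<in> trivs E"
  shows "msmooth_on (base E) V (\<lambda>q. dcoord \<Phi> q (\<nu> q))"
proof -
  have "msmooth_on (base E) {q \<in> points (base E). q \<in> V} (\<lambda>q. dcoord \<Phi> q (\<nu> q))"
    using assms unfolding sections_along_id dual_sections_along_iff by blast
  then show ?thesis by (simp only: triv_points[OF assms(2)])
qed

lemma pairing_Cinf:
  assumes h: "smooth_map N h (base E)" and s: "s \<in> sections_along N h E"
    and \<nu>: "\<nu> \<in> sections_along N h (dual_bundle E)"
  shows "(\<lambda>x. \<nu> x (s x)) \<in> Cinf N"
  unfolding Cinf_def mem_Collect_eq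
proof -
  interpret N: charted N using h by (simp add: smooth_map_def)
  show "msmooth_on N (points N) (\<lambda>x. \<nu> x (s x))"
  proof (rule N.msmooth_on_locally)
    fix x assume x: "x \<in> points N"
    then have "h x \<in> points (base E)" using h by (simp add: smooth_map_def)
    then obtain V \<Phi> where V: "(V, \<Phi>) \<in> trivs E" "h x \<in> V" by (rule triv_cover)
    let ?W = "{x \<in> points N. h x \<in> V}"
    have W: "mopen N ?W" by (rule Q.mopen_smooth_map[OF h mopen_triv[OF V(1)]])
    have "msmooth_on N ?W (\<lambda>x. inner (dcoord \<Phi> (h x) (\<nu> x)) (\<Phi> (h x) (s x)))"
      using s \<nu> V(1) by (intro N.msmooth_on_inner W) (auto simp: sections_along_iff dual_sections_along_iff)
    then have "msmooth_on N ?W (\<lambda>x. \<nu> x (s x))"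
      by (rule N.msmooth_on_cong[OF W, rotated])
        (use s \<nu> in \<open>auto simp: sections_along_iff dual_sections_along_iff inner_dcoord_triv[OF V(1)]\<close>)
    with W V(2) x show "\<exists>W'. mopen N W' \<and> x \<in> W' \<and> msmooth_on N W' (\<lambda>x. \<nu> x (s x))" by blast
  qed
qed

lemma pairing_Cinf_base: "s \<in> sections E \<Longrightarrow> \<nu> \<in> sections (dual_bundle E) \<Longrightarrow> (\<lambda>q. \<nu> q (s q)) \<in> Cinf (base E)"
  using pairing_Cinf[OF Q.smooth_map_id] by (simp add: sections_along_id)

lemma pullback_section:
  assumes h: "smooth_map N h (base E)" and s: "s \<in> sections E"
  shows "(\<lambda>x. if x \<in> points N then s (h x) else 0) \<in> sections_along N h E"
proof -
  interpret N: charted N using h by (simp add: smooth_map_def)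
  have "msmooth_on N {x \<in> points N. h x \<in> V} (\<lambda>x. \<Phi> (h x) (if x \<in> points N then s (h x) else 0))"
    if V: "(V, \<Phi>) \<in> trivs E" for V \<Phi>
  proof (rule N.msmooth_on_cong[OF Q.mopen_smooth_map[OF h mopen_triv[OF V]]])
    show "msmooth_on N {x \<in> points N. h x \<in> V} (\<lambda>x. \<Phi> (h x) (s (h x)))"
      by (rule Q.msmooth_on_smooth_map[OF h mopen_triv[OF V] section_msmooth[OF s V]])
  qed auto
  then show ?thesis using s h by (auto simp: sections_along_iff section_in smooth_map_def)
qed

lemma pullback_dual_section:
  assumes h: "smooth_map N h (base E)" and \<nu>: "\<nu> \<in> sections (dual_bundle E)"
  shows "(\<lambda>x. if x \<in> points N then \<nu> (h x) else 0) \<in> sections_along N h (dual_bundle E)"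
proof -
  interpret N: charted N using h by (simp add: smooth_map_def)
  have "msmooth_on N {x \<in> points N. h x \<in> V} (\<lambda>x. dcoord \<Phi> (h x) (if x \<in> points N then \<nu> (h x) else 0))"
    if V: "(V, \<Phi>) \<in> trivs E" for V \<Phi>
  proof (rule N.msmooth_on_cong[OF Q.mopen_smooth_map[OF h mopen_triv[OF V]]])
    show "msmooth_on N {x \<in> points N. h x \<in> V} (\<lambda>x. dcoord \<Phi> (h x) (\<nu> (h x)))"
      by (rule Q.msmooth_on_smooth_map[OF h mopen_triv[OF V] dual_section_msmooth[OF \<nu> V]])
  qed auto
  then show ?thesis using \<nu> h by (auto simp: dual_sections_along_iff dual_section_in smooth_map_def)
qed

text \<open>A point of the dual bundle, read as a covector over its base point. Pairing with this
  section makes \<open>hat t\<close> and the contractions with the Liouville section smooth.\<close>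

lemma tautological_section:
  "(\<lambda>p. if p \<in> points TE then snd p else 0) \<in> sections_along TE fst (dual_bundle E)"
proof -
  have "msmooth_on TE {p \<in> points TE. fst p \<in> V}
      (\<lambda>p. dcoord \<Phi> (fst p) (if p \<in> points TE then snd p else 0))" if V: "(V, \<Phi>) \<in> trivs E" for V \<Phi>
    by (rule T.msmooth_on_cong[OF mopen_total[OF mopen_triv[OF V]] _ msmooth_dcoord[OF V]]) auto
  then show ?thesis by (auto simp: dual_sections_along_iff points_total)
qed

lemma section_along_pairing_Cinf:
  assumes "s \<in> sections_along TE fst E"
  shows "(\<lambda>p. snd p (s p)) \<in> Cinf TE"
  by (rule T.Cinf_cong[OF pairing_Cinf[OF smooth_map_fst assms tautological_section]]) simp

lemma hat_Cinf:
  assumes "t \<in> sections E" shows "hat t \<in> Cinf TE"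
  by (rule T.Cinf_cong[OF section_along_pairing_Cinf[OF pullback_section[OF smooth_map_fst assms]]])
    (auto simp: hat_def)

lemma comp_fst_Cinf: "f \<in> Cinf (base E) \<Longrightarrow> (\<lambda>p. f (fst p)) \<in> Cinf TE"
  by (rule Q.Cinf_smooth_map[OF smooth_map_fst])

lemma sections_along_add:
  assumes h: "smooth_map N h (base E)" and s: "s \<in> sections_along N h E" and t: "t \<in> sections_along N h E"
  shows "s + t \<in> sections_along N h E"
proof -
  interpret N: charted N using h by (simp add: smooth_map_def)
  have "msmooth_on N {x \<in> points N. h x \<in> V} (\<lambda>x. \<Phi> (h x) ((s + t) x))" if V: "(V, \<Phi>) \<in> trivs E" for V \<Phi>
  proof (rule N.msmooth_on_cong[OF Q.mopen_smooth_map[OF h mopen_triv[OF V]]])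
    show "msmooth_on N {x \<in> points N. h x \<in> V} (\<lambda>x. \<Phi> (h x) (s x) + \<Phi> (h x) (t x))"
      using s t V by (intro N.msmooth_on_add Q.mopen_smooth_map[OF h mopen_triv[OF V]]) (auto simp: sections_along_iff)
  qed (use s t in \<open>auto simp: sections_along_iff triv_linear[OF V]\<close>)
  then show ?thesis using s t h
    by (auto simp: sections_along_iff smooth_map_def intro: subspace_add[OF subspace_fibre])
qed

lemma sections_along_fmul:
  assumes h: "smooth_map N h (base E)" and s: "s \<in> sections_along N h E" and f: "f \<in> Cinf N"
  shows "fmul f s \<in> sections_along N h E"
proof -
  interpret N: charted N using h by (simp add: smooth_map_def)
  have "msmooth_on N {x \<in> points N. h x \<in> V} (\<lambda>x. \<Phi> (h x) (fmul f s x))" if V: "(V, \<Phi>) \<in> trivs E" for V \<Phi>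
  proof (rule N.msmooth_on_cong[OF Q.mopen_smooth_map[OF h mopen_triv[OF V]]])
    show "msmooth_on N {x \<in> points N. h x \<in> V} (\<lambda>x. f x *\<^sub>R \<Phi> (h x) (s x))"
      using s V by (intro N.msmooth_on_scaleR N.Cinf_subset[OF f] Q.mopen_smooth_map[OF h mopen_triv[OF V]]) (auto simp: sections_along_iff)
  qed (use s in \<open>auto simp: sections_along_iff triv_linear[OF V] fmul_def\<close>)
  then show ?thesis using s h
    by (auto simp: sections_along_iff smooth_map_def fmul_def intro: subspace_scale[OF subspace_fibre])
qed

lemma sections_add: "s \<in> sections E \<Longrightarrow> t \<in> sections E \<Longrightarrow> s + t \<in> sections E"
  using sections_along_add[OF Q.smooth_map_id] by (simp add: sections_along_id)

lemma sections_fmul: "s \<in> sections E \<Longrightarrow> f \<in> Cinf (base E) \<Longrightarrow> fmul f s \<in> sections E"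
  using sections_along_fmul[OF Q.smooth_map_id] by (simp add: sections_along_id)

lemma sections_0: "0 \<in> sections E"
proof -
  have "\<Phi> q 0 = 0" if V: "(V, \<Phi>) \<in> trivs E" "q \<in> V" for V \<Phi> q
    using triv_linear(2)[OF V, of 0 0] subspace_0[OF subspace_fibre[of q]] triv_subset[OF V(1)] V(2) by auto
  then have "msmooth_on (base E) {x \<in> points (base E). x \<in> V} (\<lambda>x. \<Phi> x ((0::'q \<Rightarrow> 'e) x))" if V: "(V, \<Phi>) \<in> trivs E" for V \<Phi>
    unfolding triv_points[OF V] using V
    by (intro Q.msmooth_on_cong[OF _ _ Q.msmooth_on_const[of V 0]] mopen_triv[OF V]) simp
  then show ?thesis by (auto simp: sections_along_id sections_along_iff subspace_0 subspace_fibre)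
qed

lemma sections_sum: "(\<And>i. i \<in> I \<Longrightarrow> s i \<in> sections E) \<Longrightarrow> (\<Sum>i\<in>I. s i) \<in> sections E"
  by (induction I rule: infinite_finite_induct) (auto intro: sections_add sections_0)

section \<open>Cut-off frames and the extension of vectors and covectors to global sections\<close>

definition cut :: "('q \<Rightarrow> real) \<Rightarrow> 'q set \<Rightarrow> ('q \<Rightarrow> 'e \<Rightarrow> 'c) \<Rightarrow> 'c \<Rightarrow> 'q \<Rightarrow> 'e" where
  "cut \<psi> V \<Phi> w = (\<lambda>q. if q \<in> V then \<psi> q *\<^sub>R vec \<Phi> q w else 0)"

definition cut_cov :: "('q \<Rightarrow> real) \<Rightarrow> 'q set \<Rightarrow> ('q \<Rightarrow> 'e \<Rightarrow> 'c) \<Rightarrow> 'c \<Rightarrow> 'q \<Rightarrow> 'e \<Rightarrow> real" where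
  "cut_cov \<psi> V \<Phi> y = (\<lambda>q. if q \<in> V then \<psi> q *\<^sub>R cov \<Phi> q y else 0)"

context
  fixes \<psi> K V \<Phi>
  assumes \<psi>: "\<psi> \<in> Cinf (base E)" and off: "\<And>q. q \<notin> K \<Longrightarrow> \<psi> q = (0::real)" and KV: "K \<subseteq> V"
    and K: "mopen (base E) (points (base E) - K)" and V: "(V, \<Phi>) \<in> trivs E"
begin

lemma cut_section: "cut \<psi> V \<Phi> w \<in> sections E"
  unfolding sections_along_id sections_along_iff
proof (intro conjI ballI allI impI)
  fix q assume q: "q \<in> points (base E)"
  show "cut \<psi> V \<Phi> w q \<in> fibre E q"
    using subspace_fibre[OF q] by (auto simp: cut_def vec_in[OF V] subspace_0 subspace_scale)
next
  fix q assume "q \<notin> points (base E)"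
  then show "cut \<psi> V \<Phi> w q = 0" using triv_subset[OF V] by (auto simp: cut_def)
next
  fix V' \<Psi> assume V': "(V', \<Psi>) \<in> trivs E"
  have "msmooth_on (base E) V' (\<lambda>q. \<psi> q *\<^sub>R \<Psi> q (vec \<Phi> q w))"
    by (rule Q.msmooth_on_cutoff[OF \<psi> off K KV mopen_triv[OF V] mopen_triv[OF V'] msmooth_transition[OF V V']])
  then show "msmooth_on (base E) {q \<in> points (base E). q \<in> V'} (\<lambda>q. \<Psi> q (cut \<psi> V \<Phi> w q))"
    unfolding triv_points[OF V']
  proof (rule Q.msmooth_on_cong[OF mopen_triv[OF V'], rotated])
    fix q assume q: "q \<in> V'" "q \<in> points (base E)"
    show "\<psi> q *\<^sub>R \<Psi> q (vec \<Phi> q w) = \<Psi> q (cut \<psi> V \<Phi> w q)"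
    proof (cases "q \<in> V")
      case True
      then show ?thesis by (simp add: cut_def triv_linear[OF V' q(1)] vec_in[OF V])
    next
      case False
      then have "\<psi> q = 0" using off KV by blast
      moreover have "\<Psi> q 0 = 0"
        using triv_linear(2)[OF V' q(1), of 0 0] subspace_0[OF subspace_fibre[OF q(2)]] by simp
      ultimately show ?thesis using False by (simp add: cut_def)
    qed
  qed
qed

lemma cut_cov_section: "cut_cov \<psi> V \<Phi> y \<in> sections (dual_bundle E)"
  unfolding sections_along_id dual_sections_along_iff
proof (intro conjI ballI allI impI)
  fix q assume q: "q \<in> points (base E)"
  show "cut_cov \<psi> V \<Phi> y q \<in> dual_space (fibre E q)"
    using subspace_dual_space[OF subspace_fibre[OF q]]
    by (auto simp: cut_cov_def cov_dual[OF V] subspace_0 subspace_scale)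
next
  fix q assume "q \<notin> points (base E)"
  then show "cut_cov \<psi> V \<Phi> y q = 0" using triv_subset[OF V] by (auto simp: cut_cov_def)
next
  fix V' \<Psi> assume V': "(V', \<Psi>) \<in> trivs E"
  have VV': "mopen (base E) (V \<inter> V')" by (intro Q.mopen_Int mopen_triv[OF V] mopen_triv[OF V'])
  have "msmooth_on (base E) (V \<inter> V') (\<lambda>q. \<Sum>c\<in>onb. inner y (\<Phi> q (vec \<Psi> q c)) *\<^sub>R c)"
    using msmooth_transition[OF V' V]
    by (intro Q.msmooth_on_sum Q.msmooth_on_scaleR Q.msmooth_on_inner Q.msmooth_on_const VV') (simp add: Int_commute)
  then have "msmooth_on (base E) V' (\<lambda>q. \<psi> q *\<^sub>R (\<Sum>c\<in>onb. inner y (\<Phi> q (vec \<Psi> q c)) *\<^sub>R c))"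
    using Q.msmooth_on_cutoff[OF \<psi> off K KV mopen_triv[OF V] mopen_triv[OF V'],
        of "\<lambda>q. \<Sum>c\<in>onb. inner y (\<Phi> q (vec \<Psi> q c)) *\<^sub>R c"] by simp
  then show "msmooth_on (base E) {q \<in> points (base E). q \<in> V'} (\<lambda>q. dcoord \<Psi> q (cut_cov \<psi> V \<Phi> y q))"
    unfolding triv_points[OF V']
  proof (rule Q.msmooth_on_cong[OF mopen_triv[OF V'], rotated])
    fix q assume q: "q \<in> V'" "q \<in> points (base E)"
    have sub: "subspace (dual_space (fibre E q))" by (rule subspace_dual_space[OF subspace_fibre[OF q(2)]])
    show "\<psi> q *\<^sub>R (\<Sum>c\<in>onb. inner y (\<Phi> q (vec \<Psi> q c)) *\<^sub>R c) = dcoord \<Psi> q (cut_cov \<psi> V \<Phi> y q)"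
    proof (cases "q \<in> V")
      case True
      have "dcoord \<Psi> q (\<psi> q *\<^sub>R cov \<Phi> q y) = \<psi> q *\<^sub>R dcoord \<Psi> q (cov \<Phi> q y)"
        by (rule inner_ext)
          (simp add: inner_dcoord[OF V' q(1)] subspace_scale[OF sub] cov_dual[OF V True], simp add: scaleR_fun_def)
      with True show ?thesis
        by (simp add: cut_cov_def dcoord_change[OF V True V' q(1)] cov_dual[OF V True] dcoord_cov[OF V True])
    next
      case False
      then have "\<psi> q = 0" using off KV by blast
      moreover have "dcoord \<Psi> q 0 = 0"
        by (rule inner_ext) (simp add: inner_dcoord[OF V' q(1)] subspace_0[OF sub])
      ultimately show ?thesis using False by (simp add: cut_cov_def)
    qed
  qed
qed

end

text \<open>A local frame and its dual, each multiplied by a bump function \<psi>, become global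
  sections. Their contraction is the identity up to the factor \<open>\<theta> = \<psi>^2\<close>,
  and off the trivialization both sides vanish, so the identity holds over the whole base.\<close>

lemma frame_exists:
  assumes "q0 \<in> points (base E)"
  obtains \<theta> b \<beta> where "\<theta> \<in> Cinf (base E)" "\<theta> q0 = 1" "\<And>c. b c \<in> sections E" "\<And>c. \<beta> c \<in> sections (dual_bundle E)"
    "\<And>q e. q \<in> points (base E) \<Longrightarrow> e \<in> fibre E q \<Longrightarrow> \<theta> q *\<^sub>R e = (\<Sum>c\<in>(onb::'c set). \<beta> c q e *\<^sub>R b c q)"
proof -
  obtain V \<Phi> where V: "(V, \<Phi>) \<in> trivs E" "q0 \<in> V" using assms by (rule triv_cover)
  obtain \<psi> K where \<psi>: "\<psi> \<in> Cinf (base E)" "\<psi> q0 = 1" "\<And>x. x \<notin> K \<Longrightarrow> \<psi> x = 0" "K \<subseteq> V"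
    "mopen (base E) (points (base E) - K)"
    using Q.manifold_bump_exists[OF mopen_triv[OF V(1)] V(2) assms] by blast
  show ?thesis
  proof (rule that[of "\<lambda>q. \<psi> q * \<psi> q" "cut \<psi> V \<Phi>" "cut_cov \<psi> V \<Phi>"])
    show "(\<lambda>q. \<psi> q * \<psi> q) \<in> Cinf (base E)" by (rule Q.Cinf_mult[OF \<psi>(1) \<psi>(1)])
    show "cut \<psi> V \<Phi> c \<in> sections E" "cut_cov \<psi> V \<Phi> c \<in> sections (dual_bundle E)" for c
      using cut_section[OF \<psi>(1,3,4,5) V(1)] cut_cov_section[OF \<psi>(1,3,4,5) V(1)] by auto
    fix q e assume q: "q \<in> points (base E)" and e: "e \<in> fibre E q"
    show "(\<psi> q * \<psi> q) *\<^sub>R e = (\<Sum>c\<in>onb. cut_cov \<psi> V \<Phi> c q e *\<^sub>R cut \<psi> V \<Phi> c q)"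
    proof (cases "q \<in> V")
      case True
      have "e = vec \<Phi> q (\<Phi> q e)" using vec_triv[OF V(1) True e] by simp
      also have "\<dots> = (\<Sum>c\<in>onb. inner (\<Phi> q e) c *\<^sub>R vec \<Phi> q c)"
        by (rule linear_onb[OF linear_vec[OF V(1) True]])
      finally have "(\<psi> q * \<psi> q) *\<^sub>R e = (\<psi> q * \<psi> q) *\<^sub>R (\<Sum>c\<in>onb. inner (\<Phi> q e) c *\<^sub>R vec \<Phi> q c)"
        by (rule arg_cong)
      also have "\<dots> = (\<Sum>c\<in>onb. (\<psi> q * \<psi> q * inner (\<Phi> q e) c) *\<^sub>R vec \<Phi> q c)"
        by (simp add: scaleR_sum_right)
      finally show ?thesis using True e
        by (simp add: cut_def cut_cov_def cov_def scaleR_fun_def inner_commute mult_ac)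
    next
      case False
      then have "\<psi> q = 0" using \<psi> by blast
      with False show ?thesis by (simp add: cut_def)
    qed
  qed (use \<psi> in auto)
qed

lemma section_through:
  assumes "q \<in> points (base E)" "e \<in> fibre E q"
  shows "\<exists>s\<in>sections E. s q = e"
proof -
  obtain \<theta> b \<beta> where "\<theta> \<in> Cinf (base E)" and fr: "\<theta> q = 1" "\<And>c. b c \<in> sections E"
    and "\<And>c. \<beta> c \<in> sections (dual_bundle E)"
    and fr': "\<And>q e. q \<in> points (base E) \<Longrightarrow> e \<in> fibre E q \<Longrightarrow> \<theta> q *\<^sub>R e = (\<Sum>c\<in>(onb::'c set). \<beta> c q e *\<^sub>R b c q)"
    by (rule frame_exists[OF assms(1)]) (rule that)
  have "(\<Sum>c\<in>onb. fmul (\<lambda>_. \<beta> c q e) (b c)) \<in> sections E"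
    by (intro sections_sum sections_fmul fr Q.Cinf_const)
  moreover have "(\<Sum>c\<in>onb. fmul (\<lambda>_. \<beta> c q e) (b c)) q = e"
    using fr'[OF assms] fr(1) by (simp add: sum_fun_apply fmul_def)
  ultimately show ?thesis by blast
qed

lemma dual_section_through:
  assumes q: "q \<in> points (base E)" and \<alpha>: "\<alpha> \<in> dual_space (fibre E q)"
  shows "\<exists>\<nu>\<in>sections (dual_bundle E). \<nu> q = \<alpha>"
proof -
  obtain V \<Phi> where V: "(V, \<Phi>) \<in> trivs E" "q \<in> V" using assms(1) by (rule triv_cover)
  obtain \<psi> K where \<psi>: "\<psi> \<in> Cinf (base E)" "\<psi> q = 1" "\<And>x. x \<notin> K \<Longrightarrow> \<psi> x = 0" "K \<subseteq> V"
    "mopen (base E) (points (base E) - K)"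
    using Q.manifold_bump_exists[OF mopen_triv[OF V(1)] V(2) assms(1)] by blast
  have "cut_cov \<psi> V \<Phi> (dcoord \<Phi> q \<alpha>) q = \<alpha>"
    by (simp add: cut_cov_def V(2) \<psi>(2) cov_dcoord[OF V \<alpha>])
  then show ?thesis using cut_cov_section[OF \<psi>(1,3,4,5) V(1)] by blast
qed

text \<open>Injectivity of the map to the bidual, read off from coordinates: the covectors
  \<open>cov \<Phi> q w\<close> test all components of \<open>\<Phi> q e\<close>.\<close>

lemma dual_space_separates:
  assumes q: "q \<in> points (base E)" and e: "e \<in> fibre E q" "e' \<in> fibre E q"
    and eq: "\<And>\<nu>. \<nu> \<in> dual_space (fibre E q) \<Longrightarrow> \<nu> e = \<nu> e'"
  shows "e = e'"
proof -
  obtain V \<Phi> where V: "(V, \<Phi>) \<in> trivs E" "q \<in> V" using q by (rule triv_cover)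
  have "inner w (\<Phi> q e) = inner w (\<Phi> q e')" for w
    using eq[OF cov_dual[OF V, of w]] e by (simp add: cov_def)
  then have "\<Phi> q e = \<Phi> q e'" by (metis inner_commute inner_ext)
  then show ?thesis using vec_triv[OF V] e by metis
qed


section \<open>Tangent vectors of the dual bundle\<close>

text \<open>Hadamard's lemma in coordinates \<^term>\<open>(x, y)\<close>, where affine functions of \<^term>\<open>x\<close> are
  functions on the base and linear functions of \<^term>\<open>y\<close> are of the form \<^term>\<open>hat t\<close>.\<close>

lemma differential_split:
  assumes p0: "p0 \<in> points TE" and H: "H \<in> Cinf TE"
  shows "\<exists>f\<in>Cinf (base E). \<exists>t\<in>sections E. \<forall>v\<in>tangent_space TE p0.
    v H = v (\<lambda>p. f (fst p)) + v (hat t)"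
proof -
  obtain q0 \<alpha>0 where p0': "p0 = (q0, \<alpha>0)" and q0: "q0 \<in> points (base E)" and \<alpha>0: "\<alpha>0 \<in> dual_space (fibre E q0)"
    using p0 by (auto simp: points_total)
  obtain U \<phi> where U: "(U, \<phi>) \<in> base E" "q0 \<in> U" using q0 by (rule Q.pointsE)
  obtain V \<Phi> where V: "(V, \<Phi>) \<in> trivs E" "q0 \<in> V" using q0 by (rule triv_cover)
  have UV: "mopen (base E) (U \<inter> V)" by (intro Q.mopen_Int Q.mopen_chart[OF U(1)] mopen_triv[OF V(1)])
  define x0 where "x0 = \<phi> q0"
  define y0 where "y0 = dcoord \<Phi> q0 \<alpha>0"
  have "open (\<phi> ` (U \<inter> V))" "x0 \<in> \<phi> ` (U \<inter> V)"
    using Q.mopenD[OF mopen_triv[OF V(1)] U(1)] U V by (auto simp: x0_def)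
  then obtain r where r: "r > 0" "ball x0 r \<subseteq> \<phi> ` (U \<inter> V)" by (meson open_contains_ball)
  define D where "D = ball x0 r \<times> (UNIV :: 'c set)"
  have D: "open D" "convex D" "(x0, y0) \<in> D"
    using r(1) by (auto simp: D_def intro: open_Times convex_Times)
  define h where "h z = H (inv_into U \<phi> (fst z), cov \<Phi> (inv_into U \<phi> (fst z)) (snd z))" for z
  have "smooth_on (\<phi> ` (U \<inter> (V \<inter> points (base E))) \<times> (UNIV::'c set)) h"
    unfolding h_def by (rule msmooth_total_D[OF Q.mopen_points T.Cinf_subset[OF H] U(1) V(1)])
  moreover have "V \<inter> points (base E) = V" using triv_subset[OF V(1)] by blast
  ultimately have "smooth_on (\<phi> ` (U \<inter> V) \<times> (UNIV::'c set)) h" by simp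
  then have "smooth_on D h" by (rule smooth_on_subset) (use r(2) in \<open>auto simp: D_def\<close>)
  from hadamard[OF D this] obtain g where g: "\<And>b. smooth_on D (g b)"
    and h_eq: "\<And>z. z \<in> D \<Longrightarrow> h z = h (x0, y0) + (\<Sum>b\<in>onb. inner (z - (x0, y0)) b * g b z)"
    by blast
  define W where "W = {q \<in> U \<inter> V. \<phi> q \<in> ball x0 r}"
  have W: "mopen (base E) W" "q0 \<in> W"
  proof -
    show "mopen (base E) W" unfolding W_def
      by (rule Q.mopen_vimage[OF UV Q.msmooth_on_subset[OF Q.msmooth_on_chart[OF U(1)]] open_ball]) auto
    show "q0 \<in> W" using r(1) U V by (simp add: W_def x0_def)
  qed
  obtain \<psi> K where \<psi>: "\<psi> \<in> Cinf (base E)" "\<psi> q0 = 1" "\<And>x. x \<notin> K \<Longrightarrow> \<psi> x = 0" "K \<subseteq> W"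
    "mopen (base E) (points (base E) - K)"
    using Q.manifold_bump_exists[OF W q0] by blast
  have KV: "K \<subseteq> V" using \<psi>(4) by (auto simp: W_def)
  define X where "X p = (\<phi> (fst p), dcoord \<Phi> (fst p) (snd p))" for p
  define P where "P p = \<psi> (fst p)" for p :: "'q \<times> ('e \<Rightarrow> real)"
  \<comment> \<open>The coordinate of \<open>z - (x0, y0)\<close> along \<open>b\<close> is the
    inner product of \<open>x - x0\<close> with \<open>fst b\<close> plus that of
    \<open>y - y0\<close> with \<open>snd b\<close>. The constant from \<open>y0\<close> is put into
    the base function, so that the remainder \<open>tb\<close> is linear on the fibres.\<close>
  define fb where "fb b q = \<psi> q * (inner (\<phi> q - x0) (fst b) - inner y0 (snd b))" for b q
  define tb where "tb b = cut \<psi> V \<Phi> (snd b)" for b :: "'b \<times> 'c"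
  define gb where "gb b p = P p * g b (X p)" for b p
  have P: "P \<in> Cinf TE" unfolding P_def by (rule comp_fst_Cinf[OF \<psi>(1)])
  have fb: "fb b \<in> Cinf (base E)" for b
    unfolding Cinf_def mem_Collect_eq fb_def real_scaleR_def[symmetric]
  proof (rule Q.msmooth_on_cutoff[OF \<psi>(1,3,5,4) W(1) Q.mopen_points])
    have WU: "mopen (base E) (W \<inter> points (base E))" "msmooth_on (base E) (W \<inter> points (base E)) \<phi>"
      by (rule Q.mopen_Int[OF W(1) Q.mopen_points],
        rule Q.msmooth_on_subset[OF Q.msmooth_on_chart[OF U(1)]]) (auto simp: W_def)
    have "msmooth_on (base E) (W \<inter> points (base E)) (\<lambda>q. inner (\<phi> q + - x0) (fst b) + - inner y0 (snd b))"
      by (intro Q.msmooth_on_add Q.msmooth_on_inner Q.msmooth_on_const WU)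
    then show "msmooth_on (base E) (W \<inter> points (base E)) (\<lambda>q. inner (\<phi> q - x0) (fst b) - inner y0 (snd b))" by simp
  qed
  have tb: "tb b \<in> sections E" for b
    unfolding tb_def by (rule cut_section[OF \<psi>(1,3) KV \<psi>(5) V(1)])
  have gb: "gb b \<in> Cinf TE" for b
    unfolding Cinf_def mem_Collect_eq gb_def real_scaleR_def[symmetric]
  \<comment> \<open>The carrier \<open>{p. fst p \<in> K}\<close> also contains pairs outside the
    total space. The complement of the total space is therefore added to the open set around it; it
    is \<open>mopen\<close> because it meets no chart.\<close>
  proof (rule T.msmooth_on_cutoff[OF P _ _ _ _ T.mopen_points, where K = "{p. fst p \<in> K}" and V = "{p \<in> points TE. fst p \<in> W} \<union> - points TE"])
    let ?W = "{p \<in> points TE. fst p \<in> W}"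
    have mW: "mopen TE ?W" by (rule mopen_total[OF W(1)])
    have X: "msmooth_on TE ?W X"
      unfolding X_def
    proof (rule T.msmooth_on_Pair[OF mW])
      show "msmooth_on TE ?W (\<lambda>p. \<phi> (fst p))"
        by (rule Q.msmooth_on_smooth_map[OF smooth_map_fst W(1)])
          (auto intro: Q.msmooth_on_subset[OF Q.msmooth_on_chart[OF U(1)]] simp: W_def)
      show "msmooth_on TE ?W (\<lambda>p. dcoord \<Phi> (fst p) (snd p))"
        by (rule T.msmooth_on_subset[OF msmooth_dcoord[OF V(1)]]) (auto simp: W_def)
    qed
    have "msmooth_on TE ?W (\<lambda>p. g b (X p))"
      by (rule T.msmooth_on_compose[OF mW D(1) _ X g]) (auto simp: X_def D_def W_def)
    then show "msmooth_on TE ((?W \<union> - points TE) \<inter> points TE) (\<lambda>p. g b (X p))"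
      by (rule T.msmooth_on_subset) auto
    have "mopen TE (- points TE)"
      unfolding mopen_def
    proof safe
      fix A Y assume "(A, Y) \<in> TE"
      then have "A \<inter> - points TE = {}" using T.chart_subset_points by blast
      then show "open (Y ` (A \<inter> - points TE))" by simp
    qed
    then show "mopen TE (?W \<union> - points TE)" by (rule T.mopen_Un[OF mW])
    have "points TE - {p. fst p \<in> K} = {p \<in> points TE. fst p \<in> points (base E) - K}"
      by (auto simp: points_total)
    then show "mopen TE (points TE - {p. fst p \<in> K})"
      using mopen_total[OF \<psi>(5)] by simp
    show "P p = 0" if "p \<notin> {p. fst p \<in> K}" for p using \<psi>(3) that by (simp add: P_def)
    show "{p. fst p \<in> K} \<subseteq> ?W \<union> - points TE" using \<psi>(4) by auto
  qed
  have tb_hat: "hat (tb b) (q, \<alpha>) = \<psi> q * inner (dcoord \<Phi> q \<alpha>) (snd b)"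
    if "q \<in> V" "\<alpha> \<in> dual_space (fibre E q)" for b q \<alpha>
    using that by (simp add: tb_def hat_def cut_def inner_dcoord[OF V(1)] dual_spaceD vec_in[OF V(1)])
  \<comment> \<open>Hadamard's formula multiplied by \<open>P^2\<close>: one factor \<open>P\<close>
    makes the coordinate functions global, the other one the coefficients. Where \<open>P\<close>
    vanishes both sides are 0, so the identity holds on the whole total space.\<close>
  have expand: "(P p * P p) * H p = H p0 * (P p * P p) + (\<Sum>b\<in>onb. (fb b (fst p) + hat (tb b) p) * gb b p)"
    if p: "p \<in> points TE" for p
  proof (cases "fst p \<in> K")
    case False
    then have "P p = 0" using \<psi>(3) by (simp add: P_def)
    then show ?thesis by (simp add: gb_def)
  next
    case True
    obtain q \<alpha> where qa: "p = (q, \<alpha>)" "\<alpha> \<in> dual_space (fibre E q)" using p by (auto simp: points_total)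
    have q: "q \<in> U" "q \<in> V" "\<phi> q \<in> ball x0 r" using True \<psi>(4) qa by (auto simp: W_def)
    have XD: "X p \<in> D" using q by (simp add: X_def D_def qa)
    have hX: "h (X p) = H p"
      using q by (simp add: h_def X_def qa inv_into_f_f[OF Q.inj_chart[OF U(1)]] cov_dcoord[OF V(1)])
    have h0: "h (x0, y0) = H p0"
      using U(2) V(2) by (simp add: h_def x0_def y0_def p0' inv_into_f_f[OF Q.inj_chart[OF U(1)]] cov_dcoord[OF V(1)] \<alpha>0)
    have "fb b (fst p) + hat (tb b) p = P p * inner (X p - (x0, y0)) b" for b
      using q qa by (simp add: fb_def tb_hat P_def X_def inner_prod_def[of "(u, w)" for u w] inner_diff_left algebra_simps)
    then have "(\<Sum>b\<in>onb. (fb b (fst p) + hat (tb b) p) * gb b p) =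
        (P p * P p) * (\<Sum>b\<in>onb. inner (X p - (x0, y0)) b * g b (X p))"
      by (simp add: gb_def sum_distrib_left mult_ac)
    with h_eq[OF XD] show ?thesis by (simp add: hX h0 algebra_simps)
  qed
  \<comment> \<open>The first-order part at \<open>p0\<close>: the coefficient functions are frozen
    at their values at \<open>(x0, y0)\<close>.\<close>
  define f where "f q = (\<Sum>b\<in>onb. g b (x0, y0) * fb b q)" for q
  define t where "t = cut \<psi> V \<Phi> (\<Sum>b\<in>onb. g b (x0, y0) *\<^sub>R snd b)"
  have f: "f \<in> Cinf (base E)" unfolding f_def by (intro Q.Cinf_sum Q.Cinf_mult Q.Cinf_const fb)
  have t: "t \<in> sections E" unfolding t_def by (rule cut_section[OF \<psi>(1,3) KV \<psi>(5) V(1)])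
  have hat_t: "(\<Sum>b\<in>onb. g b (x0, y0) * hat (tb b) p) = hat t p" if p: "p \<in> points TE" for p
  proof -
    obtain q \<alpha> where qa: "p = (q, \<alpha>)" "\<alpha> \<in> dual_space (fibre E q)" "q \<in> points (base E)" using p by (auto simp: points_total)
    show ?thesis
    proof (cases "q \<in> V")
      case True
      have "hat t p = \<psi> q * inner (dcoord \<Phi> q \<alpha>) (\<Sum>b\<in>onb. g b (x0, y0) *\<^sub>R snd b)"
        using True qa by (simp add: t_def hat_def cut_def inner_dcoord[OF V(1)] dual_spaceD vec_in[OF V(1)])
      then show ?thesis
        using tb_hat[OF True qa(2)] by (simp add: qa inner_sum_right sum_distrib_left mult_ac)
    next
      case False
      then show ?thesis using dual_space_0[OF qa(2) subspace_fibre[OF qa(3)]]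
        by (simp add: qa t_def tb_def hat_def cut_def)
    qed
  qed
  have "v H = v (\<lambda>p. f (fst p)) + v (hat t)" if v: "v \<in> tangent_space TE p0" for v
  proof -
    note D1 = T.tangent_spaceD(1)[OF v] and D2 = T.tangent_spaceD(2)[OF v] and D3 = T.tangent_spaceD(3)[OF v]
    have PP: "(\<lambda>p. P p * P p) \<in> Cinf TE" by (rule T.Cinf_mult[OF P P])
    have P0: "P p0 = 1" by (simp add: P_def p0' \<psi>(2))
    have fbT: "(\<lambda>p. fb b (fst p)) \<in> Cinf TE" for b by (rule comp_fst_Cinf[OF fb])
    have tbT: "hat (tb b) \<in> Cinf TE" for b by (rule hat_Cinf[OF tb])
    have sT: "(\<lambda>p. fb b (fst p) + hat (tb b) p) \<in> Cinf TE" for b by (rule T.Cinf_add[OF fbT tbT])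
    \<comment> \<open>Each coordinate function vanishes at \<open>p0\<close>, so the product rule
      keeps only its derivative times the value of the coefficient. The derivative of
      \<open>P^2\<close> occurs on both sides with the factor \<open>H p0\<close> and
      cancels.\<close>
    have s0: "fb b (fst p0) + hat (tb b) p0 = 0" for b
      using tb_hat[OF V(2) \<alpha>0] by (simp add: fb_def p0' x0_def y0_def \<psi>(2))
    have X0: "gb b p0 = g b (x0, y0)" for b by (simp add: gb_def P0) (simp add: X_def x0_def y0_def p0')
    have "v (\<lambda>p. (P p * P p) * H p) =
        v (\<lambda>p. H p0 * (P p * P p) + (\<Sum>b\<in>onb. (fb b (fst p) + hat (tb b) p) * gb b p))"
      by (rule T.tangent_cong[OF v p0 T.Cinf_mult[OF PP H] expand])
    moreover have "v (\<lambda>p. (P p * P p) * H p) = v H + H p0 * v (\<lambda>p. P p * P p)"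
      using D3[OF PP H] by (simp add: P0)
    moreover have "v (\<lambda>p. H p0 * (P p * P p) + (\<Sum>b\<in>onb. (fb b (fst p) + hat (tb b) p) * gb b p)) =
        H p0 * v (\<lambda>p. P p * P p) + (\<Sum>b\<in>onb. g b (x0, y0) * (v (\<lambda>p. fb b (fst p)) + v (hat (tb b))))"
    proof -
      have "v (\<lambda>p. \<Sum>b\<in>onb. (fb b (fst p) + hat (tb b) p) * gb b p) =
          (\<Sum>b\<in>onb. v (\<lambda>p. (fb b (fst p) + hat (tb b) p) * gb b p))"
        by (rule T.tangent_sum[OF v]) (rule T.Cinf_mult[OF sT gb])
      also have "\<dots> = (\<Sum>b\<in>onb. g b (x0, y0) * (v (\<lambda>p. fb b (fst p)) + v (hat (tb b))))"
        by (intro sum.cong refl) (simp add: D3[OF sT gb] s0 X0 D1[OF fbT tbT])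
      finally show ?thesis
        by (subst D1) (auto intro!: T.Cinf_mult T.Cinf_const T.Cinf_sum sT gb P simp: D2[OF PP PP])
    qed
    ultimately have "v H = (\<Sum>b\<in>onb. g b (x0, y0) * v (\<lambda>p. fb b (fst p))) + (\<Sum>b\<in>onb. g b (x0, y0) * v (hat (tb b)))"
      by (simp add: distrib_left sum.distrib)
    moreover have "v (\<lambda>p. f (fst p)) = (\<Sum>b\<in>onb. g b (x0, y0) * v (\<lambda>p. fb b (fst p)))"
      unfolding f_def
      by (subst T.tangent_sum[OF v]) (auto intro!: T.Cinf_mult T.Cinf_const fbT simp: D2[OF fbT fbT])
    moreover have "v (hat t) = (\<Sum>b\<in>onb. g b (x0, y0) * v (hat (tb b)))"
    proof -
      have "v (hat t) = v (\<lambda>p. \<Sum>b\<in>onb. g b (x0, y0) * hat (tb b) p)"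
        by (rule T.tangent_cong[OF v p0 hat_Cinf[OF t]]) (simp add: hat_t)
      also have "\<dots> = (\<Sum>b\<in>onb. g b (x0, y0) * v (hat (tb b)))"
        by (subst T.tangent_sum[OF v]) (auto intro!: T.Cinf_mult T.Cinf_const tbT simp: D2[OF tbT tbT])
      finally show ?thesis .
    qed
    ultimately show ?thesis by simp
  qed
  with f t show ?thesis by blast
qed

text \<open>By the splitting of differentials these test functions decide about all of
  \<open>Cinf TE\<close>; on other functions tangent vectors are 0. The uniqueness of all lifts
  rests on this.\<close>

lemma tangent_eqI:
  assumes p: "p \<in> points TE"
    and v: "v \<in> tangent_space TE p" and w: "w \<in> tangent_space TE p"
    and eq: "\<And>f. f \<in> Cinf (base E) \<Longrightarrow> v (\<lambda>p. f (fst p)) = w (\<lambda>p. f (fst p))"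
      "\<And>t. t \<in> sections E \<Longrightarrow> v (hat t) = w (hat t)"
  shows "v = w"
proof
  fix H
  show "v H = w H"
  proof (cases "H \<in> Cinf TE")
    case True
    from differential_split[OF p this] v w eq show ?thesis by (metis (no_types, lifting))
  next
    case False
    with v w show ?thesis by (simp add: tangent_space_def dual_space_def)
  qed
qed


section \<open>Vertical vectors and fibre derivatives\<close>

text \<open>The velocity at \<open>r = 0\<close> of the line
  \<open>snd p + r *\<^sub>R \<nu>\<close> in the fibre over \<open>fst p\<close>, as a
  derivation.\<close>

definition vert :: "'q \<times> ('e \<Rightarrow> real) \<Rightarrow> ('e \<Rightarrow> real) \<Rightarrow> ('q \<times> ('e \<Rightarrow> real)) tvec" where
  "vert p \<nu> = (\<lambda>F. if F \<in> Cinf TE then deriv (\<lambda>r. F (fst p, snd p + r *\<^sub>R \<nu>)) 0 else 0)"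

text \<open>Dual coordinates turn a line in the fibre into a line in the model space, so the
  derivative exists and is a directional derivative of the smooth coordinate expression
  \<open>h\<close>.\<close>

lemma vert_coord:
  assumes U: "(U, \<phi>) \<in> base E" "q \<in> U" and V: "(V, \<Phi>) \<in> trivs E" "q \<in> V"
    and \<alpha>: "\<alpha> \<in> dual_space (fibre E q)" and \<nu>: "\<nu> \<in> dual_space (fibre E q)"
    and F: "F \<in> Cinf TE"
  defines "h \<equiv> \<lambda>z. F (inv_into U \<phi> (fst z), cov \<Phi> (inv_into U \<phi> (fst z)) (snd z))"
  shows "((\<lambda>r. F (q, \<alpha> + r *\<^sub>R \<nu>)) has_real_derivative
      frechet_derivative h (at (\<phi> q, dcoord \<Phi> q \<alpha>)) (0, dcoord \<Phi> q \<nu>)) (at 0)"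
proof -
  have "smooth_on (\<phi> ` (U \<inter> (V \<inter> points (base E))) \<times> (UNIV::'c set)) h"
    unfolding h_def by (rule msmooth_total_D[OF Q.mopen_points T.Cinf_subset[OF F] U(1) V(1)])
  moreover have "(\<phi> q, dcoord \<Phi> q \<alpha>) \<in> \<phi> ` (U \<inter> (V \<inter> points (base E))) \<times> (UNIV::'c set)"
    using U V triv_subset[OF V(1)] by blast
  ultimately have h: "(h has_derivative frechet_derivative h (at (\<phi> q, dcoord \<Phi> q \<alpha>))) (at (\<phi> q, dcoord \<Phi> q \<alpha>))"
    by (rule smooth_on_has_derivative)
  let ?c = "\<lambda>r::real. (\<phi> q, dcoord \<Phi> q \<alpha> + r *\<^sub>R dcoord \<Phi> q \<nu>)"
  have c: "(?c has_derivative (\<lambda>r. (0, r *\<^sub>R dcoord \<Phi> q \<nu>))) (at 0)"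
    by (auto intro!: derivative_eq_intros)
  have "((\<lambda>r. h (?c r)) has_derivative
      (\<lambda>r. frechet_derivative h (at (\<phi> q, dcoord \<Phi> q \<alpha>)) (0, r *\<^sub>R dcoord \<Phi> q \<nu>))) (at 0)"
    by (rule has_derivative_compose[OF c]) (use h in simp)
  moreover have "frechet_derivative h (at (\<phi> q, dcoord \<Phi> q \<alpha>)) (0, r *\<^sub>R dcoord \<Phi> q \<nu>) =
      frechet_derivative h (at (\<phi> q, dcoord \<Phi> q \<alpha>)) (0, dcoord \<Phi> q \<nu>) * r" for r
    using linear_scale[OF has_derivative_linear[OF h], of r "(0, dcoord \<Phi> q \<nu>)"] by (simp add: mult.commute)
  moreover have "h (?c r) = F (q, \<alpha> + r *\<^sub>R \<nu>)" for r
  proof -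
    have "cov \<Phi> q (dcoord \<Phi> q \<alpha> + r *\<^sub>R dcoord \<Phi> q \<nu>) = cov \<Phi> q (dcoord \<Phi> q \<alpha>) + r *\<^sub>R cov \<Phi> q (dcoord \<Phi> q \<nu>)"
      by (auto simp: cov_def fun_eq_iff inner_add_left scaleR_fun_def)
    then show ?thesis
      using U(2) by (simp add: h_def inv_into_f_f[OF Q.inj_chart[OF U(1)]] cov_dcoord[OF V] \<alpha> \<nu>)
  qed
  ultimately show ?thesis by (simp add: has_field_derivative_def)
qed

lemma vert_DERIV:
  assumes p: "p \<in> points TE" and \<nu>: "\<nu> \<in> dual_space (fibre E (fst p))"
    and F: "F \<in> Cinf TE"
  shows "((\<lambda>r. F (fst p, snd p + r *\<^sub>R \<nu>)) has_real_derivative vert p \<nu> F) (at 0)"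
proof -
  have q: "fst p \<in> points (base E)" and \<alpha>: "snd p \<in> dual_space (fibre E (fst p))"
    using p by (auto simp: points_total)
  obtain U \<phi> where U: "(U, \<phi>) \<in> base E" "fst p \<in> U" using q by (rule Q.pointsE)
  obtain V \<Phi> where V: "(V, \<Phi>) \<in> trivs E" "fst p \<in> V" using q by (rule triv_cover)
  note D = vert_coord[OF U V \<alpha> \<nu> F]
  have "vert p \<nu> F = deriv (\<lambda>r. F (fst p, snd p + r *\<^sub>R \<nu>)) 0" using F by (simp add: vert_def)
  with DERIV_imp_deriv[OF D] D show ?thesis by metis
qed

lemma vert_eqI:
  assumes "p \<in> points TE" "\<nu> \<in> dual_space (fibre E (fst p))" "F \<in> Cinf TE"
    "((\<lambda>r. F (fst p, snd p + r *\<^sub>R \<nu>)) has_real_derivative D) (at 0)"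
  shows "vert p \<nu> F = D"
  using DERIV_unique[OF vert_DERIV[OF assms(1-3)] assms(4)] .

lemma vert_tangent:
  assumes p: "p \<in> points TE" and \<nu>: "\<nu> \<in> dual_space (fibre E (fst p))"
  shows "vert p \<nu> \<in> tangent_space TE p"
  unfolding tangent_space_def dual_space_def linear_on_set_def mem_Collect_eq
proof (intro conjI ballI allI impI)
  fix F G assume F: "F \<in> Cinf TE" and G: "G \<in> Cinf TE"
  note dF = vert_DERIV[OF p \<nu> F] and dG = vert_DERIV[OF p \<nu> G]
  show "vert p \<nu> (F + G) = vert p \<nu> F + vert p \<nu> G"
    using DERIV_add[OF dF dG] T.Cinf_add[OF F G] by (intro vert_eqI p \<nu>) (simp_all add: plus_fun_def)
  show "vert p \<nu> (\<lambda>x. F x * G x) = F p * vert p \<nu> G + G p * vert p \<nu> F"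
    using DERIV_mult[OF dF dG] T.Cinf_mult[OF F G]
    by (intro vert_eqI p \<nu>) (simp_all add: algebra_simps)
next
  fix F c assume F: "F \<in> Cinf TE"
  show "vert p \<nu> (c *\<^sub>R F) = c *\<^sub>R vert p \<nu> F"
    using DERIV_cmult[OF vert_DERIV[OF p \<nu> F], of c] T.Cinf_mult[OF T.Cinf_const[of c] F]
    by (intro vert_eqI p \<nu>) (simp_all add: scaleR_fun_def)
qed (simp add: vert_def)

lemma vert_fst:
  assumes "p \<in> points TE" "\<nu> \<in> dual_space (fibre E (fst p))" "f \<in> Cinf (base E)"
  shows "vert p \<nu> (\<lambda>p. f (fst p)) = 0"
  by (rule vert_eqI[OF assms(1,2) comp_fst_Cinf[OF assms(3)]]) simp

lemma vert_hat:
  assumes "p \<in> points TE" "\<nu> \<in> dual_space (fibre E (fst p))" "t \<in> sections E"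
  shows "vert p \<nu> (hat t) = \<nu> (t (fst p))"
  by (rule vert_eqI[OF assms(1,2) hat_Cinf[OF assms(3)]])
    (auto simp: hat_def scaleR_fun_def intro!: derivative_eq_intros)

text \<open>The derivative of \<open>H\<close> along the fibre is a functional on covectors;
  \<open>e\<close> represents it under the identification of the fibre with its bidual. Existence
  comes from the splitting of differentials, and the choice is unique because covectors separate
  vectors.\<close>

definition fibre_deriv :: "('q \<times> ('e \<Rightarrow> real) \<Rightarrow> real) \<Rightarrow> 'q \<times> ('e \<Rightarrow> real) \<Rightarrow> 'e" where
  "fibre_deriv H = (\<lambda>p. if p \<in> points TE then
     SOME e. e \<in> fibre E (fst p) \<and> (\<forall>\<nu>\<in>dual_space (fibre E (fst p)). vert p \<nu> H = \<nu> e) else 0)"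

lemma
  assumes p: "p \<in> points TE" and H: "H \<in> Cinf TE"
  shows fibre_deriv_in: "fibre_deriv H p \<in> fibre E (fst p)"
    and vert_fibre_deriv: "\<nu> \<in> dual_space (fibre E (fst p)) \<Longrightarrow> vert p \<nu> H = \<nu> (fibre_deriv H p)"
    and fibre_deriv_split: "f \<in> Cinf (base E) \<Longrightarrow> t \<in> sections E \<Longrightarrow>
      (\<And>v. v \<in> tangent_space TE p \<Longrightarrow> v H = v (\<lambda>p. f (fst p)) + v (hat t)) \<Longrightarrow>
      fibre_deriv H p = t (fst p)"
proof -
  have q: "fst p \<in> points (base E)" using p by (auto simp: points_total)
  have split: "t (fst p) \<in> fibre E (fst p) \<and> (\<forall>\<nu>\<in>dual_space (fibre E (fst p)). vert p \<nu> H = \<nu> (t (fst p)))"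
    if "f \<in> Cinf (base E)" "t \<in> sections E" "\<And>v. v \<in> tangent_space TE p \<Longrightarrow> v H = v (\<lambda>p. f (fst p)) + v (hat t)"
    for f t
  proof (intro conjI ballI)
    show "t (fst p) \<in> fibre E (fst p)" using that(2) q by (rule section_in)
    fix \<nu> assume \<nu>: "\<nu> \<in> dual_space (fibre E (fst p))"
    show "vert p \<nu> H = \<nu> (t (fst p))"
      using that(3)[OF vert_tangent[OF p \<nu>]] by (simp add: vert_fst[OF p \<nu> that(1)] vert_hat[OF p \<nu> that(2)])
  qed
  obtain f' t' where ft: "f' \<in> Cinf (base E)" "t' \<in> sections E"
    "\<And>v. v \<in> tangent_space TE p \<Longrightarrow> v H = v (\<lambda>p. f' (fst p)) + v (hat t')"
    using differential_split[OF p H] by blast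
  have eq: "fibre_deriv H p = (SOME e. e \<in> fibre E (fst p) \<and> (\<forall>\<nu>\<in>dual_space (fibre E (fst p)). vert p \<nu> H = \<nu> e))"
    by (simp only: fibre_deriv_def p if_True)
  have *: "fibre_deriv H p \<in> fibre E (fst p) \<and> (\<forall>\<nu>\<in>dual_space (fibre E (fst p)). vert p \<nu> H = \<nu> (fibre_deriv H p))"
  proof -
    have "\<exists>e. e \<in> fibre E (fst p) \<and> (\<forall>\<nu>\<in>dual_space (fibre E (fst p)). vert p \<nu> H = \<nu> e)"
      by (rule exI, rule split) (fact ft)+
    from someI_ex[OF this] show ?thesis unfolding eq .
  qed
  then show "fibre_deriv H p \<in> fibre E (fst p)"
    "\<nu> \<in> dual_space (fibre E (fst p)) \<Longrightarrow> vert p \<nu> H = \<nu> (fibre_deriv H p)" by auto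
  show "fibre_deriv H p = t (fst p)" if "f \<in> Cinf (base E)" "t \<in> sections E"
    "\<And>v. v \<in> tangent_space TE p \<Longrightarrow> v H = v (\<lambda>p. f (fst p)) + v (hat t)"
    using split[OF that] * by (intro dual_space_separates[OF q]) auto
qed

text \<open>In the trivialization of the chart the components of the fibre derivative are the
  partial derivatives of the coordinate expression of \<open>H\<close> in the directions
  \<open>(0, c)\<close>. A transition map of \<open>E\<close> carries them to any other
  trivialization.\<close>

lemma fibre_deriv_section:
  assumes H: "H \<in> Cinf TE"
  shows "fibre_deriv H \<in> sections_along TE fst E"
  unfolding sections_along_iff
proof (intro conjI ballI allI impI)
  fix V' \<Psi> assume V': "(V', \<Psi>) \<in> trivs E"
  show "msmooth_on TE {p \<in> points TE. fst p \<in> V'} (\<lambda>p. \<Psi> (fst p) (fibre_deriv H p))"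
  proof (rule msmooth_total_I[OF mopen_triv[OF V']])
    fix U \<phi> V \<Phi> assume U: "(U, \<phi>) \<in> base E" and V: "(V, \<Phi>) \<in> trivs E"
      and op: "open (\<phi> ` (U \<inter> (V \<inter> V')) \<times> (UNIV::'c set))"
    let ?S = "\<phi> ` (U \<inter> (V \<inter> V')) \<times> (UNIV::'c set)"
    let ?q = "\<lambda>z. inv_into U \<phi> (fst z)"
    let ?p = "\<lambda>z. (?q z, cov \<Phi> (?q z) (snd z))"
    let ?h = "\<lambda>z. H (?p z)"
    have "smooth_on (\<phi> ` (U \<inter> (V \<inter> points (base E))) \<times> (UNIV::'c set)) ?h"
      by (rule msmooth_total_D[OF Q.mopen_points T.Cinf_subset[OF H] U V])
    then have h: "smooth_on ?S ?h" by (rule smooth_on_subset) (use triv_subset[OF V] in auto)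
    have "smooth_on ?S (\<lambda>z. \<Sum>c\<in>onb. frechet_derivative ?h (at z) (0, c) *\<^sub>R \<Psi> (?q z) (vec \<Phi> (?q z) c))"
      by (intro smooth_on_sum smooth_on_scaleR op smooth_on_frechet_derivative[OF h]
          smooth_on_base_total[OF Q.mopen_Int[OF mopen_triv[OF V] mopen_triv[OF V']] msmooth_transition[OF V V'] U])
        auto
    then show "smooth_on ?S (\<lambda>z. \<Psi> (fst (?p z)) (fibre_deriv H (?p z)))"
    proof (rule smooth_on_cong[OF op, rotated])
      fix z assume z: "z \<in> ?S"
      then have q: "?q z \<in> U" "?q z \<in> V" "?q z \<in> V'" using Q.inv_chart[OF U, of "fst z" "V \<inter> V'"] by auto
      have p: "?p z \<in> points TE"
        using q triv_subset[OF V] by (auto simp: points_total cov_dual[OF V])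
      have z_eq: "(\<phi> (?q z), dcoord \<Phi> (?q z) (cov \<Phi> (?q z) (snd z))) = z"
        using z q by (auto simp: dcoord_cov[OF V] f_inv_into_f)
      let ?e = "fibre_deriv H (?p z)"
      have e: "?e \<in> fibre E (?q z)" using fibre_deriv_in[OF p H] by simp
      have comp: "inner (\<Phi> (?q z) ?e) c = frechet_derivative ?h (at z) (0, c)" for c
      proof -
        have c: "cov \<Phi> (?q z) c \<in> dual_space (fibre E (?q z))" by (rule cov_dual[OF V q(2)])
        have "vert (?p z) (cov \<Phi> (?q z) c) H = frechet_derivative ?h (at z) (0, c)"
          using vert_coord[OF U q(1) V q(2) cov_dual[OF V q(2)] c H, of "snd z"] c
          unfolding z_eq dcoord_cov[OF V q(2), of c] by (intro vert_eqI[OF p _ H]) simp_all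
        moreover have "vert (?p z) (cov \<Phi> (?q z) c) H = cov \<Phi> (?q z) c ?e"
          by (rule vert_fibre_deriv[OF p H]) (use c in simp)
        ultimately show ?thesis using e by (simp add: cov_def inner_commute)
      qed
      have "\<Psi> (?q z) ?e = \<Psi> (?q z) (vec \<Phi> (?q z) (\<Phi> (?q z) ?e))" using vec_triv[OF V q(2) e] by simp
      also have "\<dots> = (\<Sum>c\<in>onb. inner (\<Phi> (?q z) ?e) c *\<^sub>R \<Psi> (?q z) (vec \<Phi> (?q z) c))"
        by (rule linear_onb[OF linear_triv_vec[OF V V' q(2,3)]])
      finally show "(\<Sum>c\<in>onb. frechet_derivative ?h (at z) (0, c) *\<^sub>R \<Psi> (?q z) (vec \<Phi> (?q z) c)) =
          \<Psi> (fst (?p z)) (fibre_deriv H (?p z))"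
        by (simp add: comp)
    qed
  qed
qed (auto simp: fibre_deriv_in[OF _ H], simp add: fibre_deriv_def)

lemma vector_field_eqI:
  assumes X: "X \<in> vector_fields TE" and Y: "Y \<in> vector_fields TE"
    and "\<And>p f. p \<in> points TE \<Longrightarrow> f \<in> Cinf (base E) \<Longrightarrow> X p (\<lambda>p. f (fst p)) = Y p (\<lambda>p. f (fst p))"
    and "\<And>p t. p \<in> points TE \<Longrightarrow> t \<in> sections E \<Longrightarrow> X p (hat t) = Y p (hat t)"
  shows "X = Y"
proof
  fix p show "X p = Y p"
  proof (cases "p \<in> points TE")
    case True
    then show ?thesis using X Y assms(3,4) by (intro tangent_eqI[OF True]) (auto simp: vector_fields_def)
  next
    case False
    with X Y show ?thesis by (cases p) (simp add: vector_fields_def)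
  qed
qed

text \<open>Applied to \<open>F\<close>, the pointwise vertical vectors give the pairing of \<nu>
  with the fibre derivative of \<open>F\<close>, which is smooth. So they form a vector field, which
  satisfies the description of \<open>vlift\<close>.\<close>

lemma vlift_field:
  assumes \<nu>: "\<nu> \<in> sections (dual_bundle E)"
  shows "vlift E \<nu> = (\<lambda>p. if p \<in> points TE then vert p (\<nu> (fst p)) else 0)" (is "_ = ?X")
    and "vlift E \<nu> \<in> vector_fields TE"
proof -
  have mem: "\<nu> (fst p) \<in> dual_space (fibre E (fst p))" if "p \<in> points TE" for p
    using that dual_section_in[OF \<nu>] by (auto simp: points_total)
  have "(\<lambda>p. ?X p F) \<in> Cinf TE" if F: "F \<in> Cinf TE" for F
    by (rule T.Cinf_cong[OF pairing_Cinf[OF smooth_map_fst fibre_deriv_section[OF F] pullback_dual_section[OF smooth_map_fst \<nu>]]])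
      (simp add: vert_fibre_deriv F mem)
  then have X: "?X \<in> vector_fields TE"
    by (auto simp: vector_fields_def vert_tangent mem)
  have props: "\<forall>p\<in>points TE. (\<forall>f\<in>Cinf (base E). ?X p (f \<circ> fst) = 0) \<and>
     (\<forall>t\<in>sections E. ?X p (hat t) = \<nu> (fst p) (t (fst p)))"
    by (simp add: vert_hat vert_fst mem comp_def)
  show eq: "vlift E \<nu> = ?X"
    unfolding vlift_def
  proof (rule the_equality)
    show "?X \<in> vector_fields TE \<and> (\<forall>p\<in>points TE. (\<forall>f\<in>Cinf (base E). ?X p (f \<circ> fst) = 0) \<and>
     (\<forall>t\<in>sections E. ?X p (hat t) = \<nu> (fst p) (t (fst p))))" using X props by blast
    fix Y assume Y: "Y \<in> vector_fields TE \<and> (\<forall>p\<in>points TE. (\<forall>f\<in>Cinf (base E). Y p (f \<circ> fst) = 0) \<and>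
     (\<forall>t\<in>sections E. Y p (hat t) = \<nu> (fst p) (t (fst p))))"
    show "Y = ?X"
      using Y props by (intro vector_field_eqI X) (auto simp: comp_def)
  qed
  show "vlift E \<nu> \<in> vector_fields TE" unfolding eq by (rule X)
qed

lemma vlift_apply:
  "\<nu> \<in> sections (dual_bundle E) \<Longrightarrow> p \<in> points TE \<Longrightarrow> vlift E \<nu> p = vert p (\<nu> (fst p))"
  by (simp add: vlift_field(1))

end

section \<open>Vector fields and (2,0)-tensors\<close>

lemma scaleR_fun_apply: "(c *\<^sub>R f) x = c *\<^sub>R f x"
  by (simp add: scaleR_fun_def)

lemma fmul_apply: "fmul f s x = f x *\<^sub>R s x"
  by (simp add: fmul_def)

context charted
begin

lemma subspace_tangent_space: "subspace (tangent_space M p)"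
  unfolding subspace_def tangent_space_def dual_space_def linear_on_set_def
  by (auto simp: scaleR_fun_def algebra_simps)

lemma vector_fieldD:
  assumes "X \<in> vector_fields M"
  shows "p \<in> points M \<Longrightarrow> X p \<in> tangent_space M p" "f \<in> Cinf M \<Longrightarrow> (\<lambda>p. X p f) \<in> Cinf M"
    "p \<notin> points M \<Longrightarrow> X p = 0"
  using assms unfolding vector_fields_def by blast+

lemma vector_fields_add:
  assumes X: "X \<in> vector_fields M" and Y: "Y \<in> vector_fields M"
  shows "X + Y \<in> vector_fields M"
  unfolding vector_fields_def using vector_fieldD[OF X] vector_fieldD[OF Y]
  by (auto intro: subspace_add[OF subspace_tangent_space] Cinf_add)

lemma vector_fields_fmul:
  assumes f: "f \<in> Cinf M" and X: "X \<in> vector_fields M"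
  shows "fmul f X \<in> vector_fields M"
  unfolding vector_fields_def mem_Collect_eq
proof (intro conjI ballI allI impI)
  show "fmul f X p \<in> tangent_space M p" if "p \<in> points M" for p
    unfolding fmul_apply by (rule subspace_scale[OF subspace_tangent_space vector_fieldD(1)[OF X that]])
  show "fmul f X p = 0" if "p \<notin> points M" for p
    using vector_fieldD(3)[OF X that] by (simp add: fmul_apply)
  show "(\<lambda>p. fmul f X p g) \<in> Cinf M" if "g \<in> Cinf M" for g
    using Cinf_mult[OF f vector_fieldD(2)[OF X that]] by (simp add: fmul_apply scaleR_fun_apply)
qed

lemma differential_dual:
  assumes "f \<in> Cinf M"
  shows "differential M f p \<in> dual_space (tangent_space M p)"
  using subspace_add[OF subspace_tangent_space] subspace_scale[OF subspace_tangent_space]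
  unfolding dual_space_def linear_on_set_def differential_def by (auto simp: scaleR_fun_def[of _ "_ :: 'a tvec"])

lemma differential_add:
  "f \<in> Cinf M \<Longrightarrow> g \<in> Cinf M \<Longrightarrow> differential M (\<lambda>x. f x + g x) p = differential M f p + differential M g p"
  by (auto simp: differential_def fun_eq_iff tangent_spaceD)

lemma differential_cmult:
  "f \<in> Cinf M \<Longrightarrow> differential M (\<lambda>x. c * f x) p = c *\<^sub>R differential M f p"
  by (auto simp: differential_def fun_eq_iff tangent_spaceD scaleR_fun_def)

lemma differential_mult:
  "f \<in> Cinf M \<Longrightarrow> g \<in> Cinf M \<Longrightarrow>
    differential M (\<lambda>x. f x * g x) p = f p *\<^sub>R differential M g p + g p *\<^sub>R differential M f p"
  by (auto simp: differential_def fun_eq_iff tangent_spaceD scaleR_fun_def)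

text \<open>A linear functional on covectors, composed with the differential, inherits the product
  rule from \<open>differential_mult\<close>. Fixing either argument of a (2,0)-tensor gives such a
  functional.\<close>

lemma tangent_of_functional:
  assumes L: "\<And>\<omega> \<omega>'. \<omega> \<in> dual_space (tangent_space M p) \<Longrightarrow> \<omega>' \<in> dual_space (tangent_space M p) \<Longrightarrow> L (\<omega> + \<omega>') = L \<omega> + L \<omega>'"
    "\<And>\<omega> c. \<omega> \<in> dual_space (tangent_space M p) \<Longrightarrow> L (c *\<^sub>R \<omega>) = c * L \<omega>"
  shows "(\<lambda>F. if F \<in> Cinf M then L (differential M F p) else 0) \<in> tangent_space M p"
proof -
  have sub: "c *\<^sub>R differential M F p \<in> dual_space (tangent_space M p)" if "F \<in> Cinf M" for F c
    using subspace_scale[OF subspace_dual_space[OF subspace_tangent_space] differential_dual[OF that]] .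
  show ?thesis
    unfolding tangent_space_def dual_space_def linear_on_set_def mem_Collect_eq
  proof (intro conjI ballI allI impI)
    fix F G assume F: "F \<in> Cinf M" and G: "G \<in> Cinf M"
    show "(if F + G \<in> Cinf M then L (differential M (F + G) p) else 0) =
        (if F \<in> Cinf M then L (differential M F p) else 0) + (if G \<in> Cinf M then L (differential M G p) else 0)"
      using Cinf_add[OF F G] differential_add[OF F G] L(1)[OF differential_dual[OF F] differential_dual[OF G]] F G
      by (simp add: plus_fun_def[of F G])
    show "(if (\<lambda>x. F x * G x) \<in> Cinf M then L (differential M (\<lambda>x. F x * G x) p) else 0) =
        F p * (if G \<in> Cinf M then L (differential M G p) else 0) + G p * (if F \<in> Cinf M then L (differential M F p) else 0)"
      using Cinf_mult[OF F G] F G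
      by (simp add: differential_mult L(1)[OF sub sub] L(2)[OF differential_dual])
  next
    fix F c assume F: "F \<in> Cinf M"
    show "(if c *\<^sub>R F \<in> Cinf M then L (differential M (c *\<^sub>R F) p) else 0) =
        c *\<^sub>R (if F \<in> Cinf M then L (differential M F p) else 0)"
      using Cinf_mult[OF Cinf_const[of c] F] F
      by (simp add: scaleR_fun_def[of c F] differential_cmult L(2)[OF differential_dual])
  qed simp
qed

lemma tensor_2_0D:
  assumes "tensor_2_0 M P" "p \<in> points M"
    "\<omega> \<in> dual_space (tangent_space M p)" "\<omega>1 \<in> dual_space (tangent_space M p)" "\<omega>2 \<in> dual_space (tangent_space M p)"
  shows "P p \<omega> (\<omega>1 + \<omega>2) = P p \<omega> \<omega>1 + P p \<omega> \<omega>2" "P p \<omega> (c *\<^sub>R \<omega>1) = c * P p \<omega> \<omega>1"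
    "P p (\<omega>1 + \<omega>2) \<omega> = P p \<omega>1 \<omega> + P p \<omega>2 \<omega>" "P p (c *\<^sub>R \<omega>1) \<omega> = c * P p \<omega>1 \<omega>"
proof -
  have "bilinear_on_set (dual_space (tangent_space M p)) (P p)"
    using assms(1,2) by (simp add: tensor_2_0_def)
  then show "P p \<omega> (\<omega>1 + \<omega>2) = P p \<omega> \<omega>1 + P p \<omega> \<omega>2" "P p \<omega> (c *\<^sub>R \<omega>1) = c * P p \<omega> \<omega>1"
    "P p (\<omega>1 + \<omega>2) \<omega> = P p \<omega>1 \<omega> + P p \<omega>2 \<omega>" "P p (c *\<^sub>R \<omega>1) \<omega> = c * P p \<omega>1 \<omega>"
    using assms(3-5) by (simp_all add: bilinear_on_set_def linear_on_set_def)
qed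

lemma tensor_2_0_Cinf:
  "tensor_2_0 M P \<Longrightarrow> f \<in> Cinf M \<Longrightarrow> g \<in> Cinf M \<Longrightarrow> tensor_bracket M P f g \<in> Cinf M"
  by (simp add: tensor_2_0_def tensor_bracket_def)

lemma tensor_hamiltonian_field_vector_field:
  assumes P: "tensor_2_0 M P" and H: "H \<in> Cinf M"
  shows "tensor_hamiltonian_field M P H \<in> vector_fields M"
proof -
  have "tensor_hamiltonian_field M P H p \<in> tangent_space M p" if p: "p \<in> points M" for p
    using tangent_of_functional[of p "\<lambda>\<omega>. - P p (differential M H p) \<omega>"] p
    unfolding tensor_hamiltonian_field_def tensor_bracket_def
    by (simp add: tensor_2_0D[OF P p] differential_dual[OF H])
  moreover have "(\<lambda>p. tensor_hamiltonian_field M P H p F) \<in> Cinf M" if F: "F \<in> Cinf M" for F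
    by (rule Cinf_cong[OF Cinf_uminus[OF tensor_2_0_Cinf[OF P H F]]])
      (simp add: tensor_hamiltonian_field_def F)
  ultimately show ?thesis
    by (auto simp: vector_fields_def) (simp add: tensor_hamiltonian_field_def zero_fun_def)
qed

text \<open>The Hamiltonian field for the other slot of the tensor, without the sign. For
  \<open>hat s\<close> its projection to the base is given by the right anchor, whereas that of the
  Hamiltonian field is given by the left one.\<close>

definition tensor_cohamiltonian_field ::
    "('a \<Rightarrow> ('a tvec \<Rightarrow> real) \<Rightarrow> ('a tvec \<Rightarrow> real) \<Rightarrow> real) \<Rightarrow> ('a \<Rightarrow> real) \<Rightarrow> 'a \<Rightarrow> 'a tvec" where
  "tensor_cohamiltonian_field P H =
     (\<lambda>p F. if p \<in> points M \<and> F \<in> Cinf M then tensor_bracket M P F H p else 0)"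

lemma tensor_cohamiltonian_field_vector_field:
  assumes P: "tensor_2_0 M P" and H: "H \<in> Cinf M"
  shows "tensor_cohamiltonian_field P H \<in> vector_fields M"
proof -
  have "tensor_cohamiltonian_field P H p \<in> tangent_space M p" if p: "p \<in> points M" for p
    using tangent_of_functional[of p "\<lambda>\<omega>. P p \<omega> (differential M H p)"] p
    unfolding tensor_cohamiltonian_field_def tensor_bracket_def
    by (simp add: tensor_2_0D[OF P p] differential_dual[OF H])
  moreover have "(\<lambda>p. tensor_cohamiltonian_field P H p F) \<in> Cinf M" if F: "F \<in> Cinf M" for F
    by (rule Cinf_cong[OF tensor_2_0_Cinf[OF P F H]]) (simp add: tensor_cohamiltonian_field_def F)
  ultimately show ?thesis
    by (auto simp: vector_fields_def) (simp add: tensor_cohamiltonian_field_def zero_fun_def)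
qed

end


section \<open>Vertical lifts of (1,1)-tensors and horizontal lifts\<close>

context smooth_bundle
begin

text \<open>The instances used below are \<open>\<lambda>s. D s t\<close> for a connection
  \<open>D\<close>, the covariant derivative as a function of its direction.\<close>

definition tensor_1_1 :: "(('q \<Rightarrow> 'e) \<Rightarrow> 'q \<Rightarrow> 'e) \<Rightarrow> bool" where
  "tensor_1_1 S \<longleftrightarrow> (\<forall>s\<in>sections E. S s \<in> sections E) \<and>
     (\<forall>s\<in>sections E. \<forall>t\<in>sections E. S (s + t) = S s + S t) \<and>
     (\<forall>f\<in>Cinf (base E). \<forall>s\<in>sections E. S (fmul f s) = fmul f (S s))"

lemma tensor_1_1D:
  assumes "tensor_1_1 S" "s \<in> sections E"
  shows "S s \<in> sections E" "t \<in> sections E \<Longrightarrow> S (s + t) = S s + S t"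
    "f \<in> Cinf (base E) \<Longrightarrow> S (fmul f s) = fmul f (S s)"
  using assms by (simp_all add: tensor_1_1_def)

lemma tensor_1_1_0: "tensor_1_1 S \<Longrightarrow> S 0 = 0"
  using tensor_1_1D(2)[of S 0 0] sections_0 by simp

lemma tensor_1_1_sum:
  assumes "tensor_1_1 S" "\<And>i. i \<in> I \<Longrightarrow> s i \<in> sections E"
  shows "S (\<Sum>i\<in>I. s i) = (\<Sum>i\<in>I. S (s i))"
  using assms(2)
  by (induction I rule: infinite_finite_induct) (simp_all add: tensor_1_1_0 tensor_1_1D[OF assms(1)] assms(1) sections_sum flip: zero_fun_def)

text \<open>The global frame identity turns linearity over functions into a pointwise formula: the
  right side involves \<open>s\<close> only through \<open>s q\<close>.\<close>

lemma tensor_1_1_frame: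
  assumes S: "tensor_1_1 S" and \<theta>: "\<theta> \<in> Cinf (base E)" and b: "\<And>c. b c \<in> sections E"
    and \<beta>: "\<And>c. \<beta> c \<in> sections (dual_bundle E)"
    and fr: "\<And>q e. q \<in> points (base E) \<Longrightarrow> e \<in> fibre E q \<Longrightarrow> \<theta> q *\<^sub>R e = (\<Sum>c\<in>(onb::'c set). \<beta> c q e *\<^sub>R b c q)"
    and s: "s \<in> sections E"
  shows "\<theta> q *\<^sub>R S s q = (\<Sum>c\<in>(onb::'c set). \<beta> c q (s q) *\<^sub>R S (b c) q)"
proof -
  have eq: "fmul \<theta> s = (\<Sum>c\<in>(onb::'c set). fmul (\<lambda>q. \<beta> c q (s q)) (b c))"
  proof
    fix q
    show "fmul \<theta> s q = (\<Sum>c\<in>(onb::'c set). fmul (\<lambda>q. \<beta> c q (s q)) (b c)) q"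
    proof (cases "q \<in> points (base E)")
      case True
      with fr[OF True section_in[OF s True]] show ?thesis by (simp add: fmul_def sum_fun_apply)
    next
      case False
      then show ?thesis by (simp add: fmul_def sum_fun_apply section_off s b)
    qed
  qed
  have "fmul \<theta> (S s) = S (fmul \<theta> s)" by (simp add: tensor_1_1D[OF S s] \<theta>)
  also have "\<dots> = (\<Sum>c\<in>(onb::'c set). S (fmul (\<lambda>q. \<beta> c q (s q)) (b c)))"
    unfolding eq by (intro tensor_1_1_sum S sections_fmul b pairing_Cinf_base s \<beta>)
  also have "\<dots> = (\<Sum>c\<in>(onb::'c set). fmul (\<lambda>q. \<beta> c q (s q)) (S (b c)))"
    by (intro sum.cong refl tensor_1_1D(3) S b pairing_Cinf_base s \<beta>)
  finally have "fmul \<theta> (S s) q = (\<Sum>c\<in>(onb::'c set). fmul (\<lambda>q. \<beta> c q (s q)) (S (b c))) q" by simp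
  then show ?thesis by (simp add: fmul_def sum_fun_apply)
qed

definition tensor_at :: "(('q \<Rightarrow> 'e) \<Rightarrow> 'q \<Rightarrow> 'e) \<Rightarrow> 'q \<Rightarrow> 'e \<Rightarrow> 'e" where
  "tensor_at S q e = S (SOME s. s \<in> sections E \<and> s q = e) q"

lemma tensor_1_1_local:
  assumes S: "tensor_1_1 S" and q: "q \<in> points (base E)" and s: "s \<in> sections E" "s' \<in> sections E" "s q = s' q"
  shows "S s q = S s' q"
proof -
  obtain \<theta> b \<beta> where fr: "\<theta> \<in> Cinf (base E)" and 1: "\<theta> q = 1" and fr': "\<And>c. b c \<in> sections E"
    "\<And>c. \<beta> c \<in> sections (dual_bundle E)"
    "\<And>q e. q \<in> points (base E) \<Longrightarrow> e \<in> fibre E q \<Longrightarrow> \<theta> q *\<^sub>R e = (\<Sum>c\<in>(onb::'c set). \<beta> c q e *\<^sub>R b c q)"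
    by (rule frame_exists[OF q]) (rule that)
  show ?thesis
    using tensor_1_1_frame[OF S fr fr' s(1), of q] tensor_1_1_frame[OF S fr fr' s(2), of q] 1 s(3) by simp
qed

lemma tensor_at:
  assumes "tensor_1_1 S" "q \<in> points (base E)" "s \<in> sections E"
  shows "tensor_at S q (s q) = S s q"
proof -
  have "\<exists>s'. s' \<in> sections E \<and> s' q = s q" using assms(3) by blast
  note * = someI_ex[OF this]
  show ?thesis
    unfolding tensor_at_def
    by (rule tensor_1_1_local[OF assms(1,2) conjunct1[OF *] assms(3) conjunct2[OF *]])
qed

text \<open>The covector \<open>snd p\<close> composed with the endomorphism that \<open>S\<close>
  induces on the fibre, set to 0 off the fibre. It is the direction of the vertical lift of
  \<open>S\<close> at \<open>p\<close>.\<close>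

definition transpose_at :: "(('q \<Rightarrow> 'e) \<Rightarrow> 'q \<Rightarrow> 'e) \<Rightarrow> 'q \<times> ('e \<Rightarrow> real) \<Rightarrow> 'e \<Rightarrow> real" where
  "transpose_at S p = (\<lambda>e. if e \<in> fibre E (fst p) then snd p (tensor_at S (fst p) e) else 0)"

lemma transpose_at:
  assumes "tensor_1_1 S" "p \<in> points TE" "s \<in> sections E"
  shows "transpose_at S p (s (fst p)) = snd p (S s (fst p))"
proof -
  have q: "fst p \<in> points (base E)" using assms(2) by (auto simp: points_total)
  then show ?thesis by (simp add: transpose_at_def section_in assms tensor_at)
qed

lemma transpose_at_dual:
  assumes S: "tensor_1_1 S" and p: "p \<in> points TE"
  shows "transpose_at S p \<in> dual_space (fibre E (fst p))"
proof -
  have q: "fst p \<in> points (base E)" and \<alpha>: "snd p \<in> dual_space (fibre E (fst p))"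
    using p by (auto simp: points_total)
  have "transpose_at S p (e + e') = transpose_at S p e + transpose_at S p e'"
    "transpose_at S p (c *\<^sub>R e) = c *\<^sub>R transpose_at S p e"
    if e: "e \<in> fibre E (fst p)" "e' \<in> fibre E (fst p)" for e e' c
  proof -
    obtain s s' where s: "s \<in> sections E" "s (fst p) = e" "s' \<in> sections E" "s' (fst p) = e'"
      using section_through[OF q e(1)] section_through[OF q e(2)] by blast
    have Sin: "S s (fst p) \<in> fibre E (fst p)" "S s' (fst p) \<in> fibre E (fst p)"
      using tensor_1_1D(1)[OF S] s section_in q by auto
    show "transpose_at S p (e + e') = transpose_at S p e + transpose_at S p e'"
      using transpose_at[OF S p sections_add[OF s(1,3)]] transpose_at[OF S p s(1)] transpose_at[OF S p s(3)] s
      by (simp add: tensor_1_1D[OF S] dual_spaceD[OF \<alpha>] Sin)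
    show "transpose_at S p (c *\<^sub>R e) = c *\<^sub>R transpose_at S p e"
      using transpose_at[OF S p sections_fmul[OF s(1) Q.Cinf_const[of c]]] transpose_at[OF S p s(1)] s
      by (simp add: tensor_1_1D[OF S] Q.Cinf_const dual_spaceD[OF \<alpha>] Sin fmul_apply)
  qed
  then show ?thesis by (auto simp: dual_space_def linear_on_set_def) (simp add: transpose_at_def)
qed

definition tensor_vert :: "(('q \<Rightarrow> 'e) \<Rightarrow> 'q \<Rightarrow> 'e) \<Rightarrow> 'q \<times> ('e \<Rightarrow> real) \<Rightarrow> ('q \<times> ('e \<Rightarrow> real)) tvec" where
  "tensor_vert S = (\<lambda>p. if p \<in> points TE then vert p (transpose_at S p) else 0)"

text \<open>Applied to \<open>F\<close>, the lift gives the covector evaluated at \<open>S\<close>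
  of the fibre derivative of \<open>F\<close>. Since the latter is a section along the projection,
  \<open>S\<close> is moved to a frame: after multiplication by \<theta> a sum of products of
  \<open>\<beta> c\<close> of the fibre derivative with \<open>hat (S (b c))\<close>
  remains.\<close>

lemma tensor_vert_vector_field:
  assumes S: "tensor_1_1 S"
  shows "tensor_vert S \<in> vector_fields TE"
proof -
  have "(\<lambda>p. tensor_vert S p F) \<in> Cinf TE" if F: "F \<in> Cinf TE" for F
  proof (rule T.Cinf_locally_mult)
    fix p0 assume p0: "p0 \<in> points TE"
    then have q0: "fst p0 \<in> points (base E)" by (auto simp: points_total)
    obtain \<theta> b \<beta> where fr: "\<theta> \<in> Cinf (base E)" and 1: "\<theta> (fst p0) = 1" and b: "\<And>c. b c \<in> sections E"
      and \<beta>: "\<And>c. \<beta> c \<in> sections (dual_bundle E)" and fr':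
      "\<And>q e. q \<in> points (base E) \<Longrightarrow> e \<in> fibre E q \<Longrightarrow> \<theta> q *\<^sub>R e = (\<Sum>c\<in>(onb::'c set). \<beta> c q e *\<^sub>R b c q)"
      by (rule frame_exists[OF q0]) (rule that)
    have "(\<lambda>p. \<Sum>c\<in>(onb::'c set). \<beta> c (fst p) (fibre_deriv F p) * hat (S (b c)) p) \<in> Cinf TE"
    proof (intro T.Cinf_sum T.Cinf_mult hat_Cinf tensor_1_1D(1)[OF S] b)
      show "(\<lambda>p. \<beta> c (fst p) (fibre_deriv F p)) \<in> Cinf TE" for c
        by (rule T.Cinf_cong[OF pairing_Cinf[OF smooth_map_fst fibre_deriv_section[OF F] pullback_dual_section[OF smooth_map_fst \<beta>]]])
          simp
    qed
    then have "(\<lambda>p. \<theta> (fst p) * tensor_vert S p F) \<in> Cinf TE"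
    proof (rule T.Cinf_cong)
      fix p assume p: "p \<in> points TE"
      then have q: "fst p \<in> points (base E)" and \<alpha>: "snd p \<in> dual_space (fibre E (fst p))"
        by (auto simp: points_total)
      obtain s where s: "s \<in> sections E" "s (fst p) = fibre_deriv F p"
        using section_through[OF q fibre_deriv_in[OF p F]] by blast
      have Sin: "S s (fst p) \<in> fibre E (fst p)" "S (b c) (fst p) \<in> fibre E (fst p)" for c
        using section_in[OF tensor_1_1D(1)[OF S] q] s b by auto
      have "tensor_vert S p F = snd p (S s (fst p))"
        using vert_fibre_deriv[OF p F transpose_at_dual[OF S p]] transpose_at[OF S p s(1)] p s(2)
        by (simp add: tensor_vert_def)
      then have "\<theta> (fst p) * tensor_vert S p F = snd p (\<theta> (fst p) *\<^sub>R S s (fst p))"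
        by (simp add: dual_spaceD[OF \<alpha>] Sin)
      also have "\<dots> = (\<Sum>c\<in>(onb::'c set). \<beta> c (fst p) (fibre_deriv F p) * hat (S (b c)) p)"
      proof -
        have "\<theta> (fst p) *\<^sub>R S s (fst p) = (\<Sum>c\<in>(onb::'c set). \<beta> c (fst p) (s (fst p)) *\<^sub>R S (b c) (fst p))"
          by (rule tensor_1_1_frame[OF S fr b \<beta> fr' s(1)])
        then show ?thesis
          by (simp add: s(2) dual_space_sum[OF \<alpha> subspace_fibre[OF q]] Sin hat_def split_beta)
      qed
      finally show "(\<Sum>c\<in>(onb::'c set). \<beta> c (fst p) (fibre_deriv F p) * hat (S (b c)) p) = \<theta> (fst p) * tensor_vert S p F" ..
    qed
    with comp_fst_Cinf[OF fr] 1 show "\<exists>\<theta>\<in>Cinf TE. \<theta> p0 \<noteq> 0 \<and> (\<lambda>p. \<theta> p * tensor_vert S p F) \<in> Cinf TE"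
      by (intro bexI[of _ "\<lambda>p. \<theta> (fst p)"]) auto
  qed
  then show ?thesis
    unfolding vector_fields_def by (auto simp: tensor_vert_def vert_tangent transpose_at_dual[OF S])
qed

text \<open>The description of \<open>hlift\<close> quantifies over all sections through the given
  vector; tensoriality in the direction makes these conditions agree, and \<open>tangent_eqI\<close>
  gives uniqueness.\<close>

lemma hlift_eqI:
  assumes D: "\<And>t. t \<in> sections E \<Longrightarrow> tensor_1_1 (\<lambda>s. D s t)"
    and p: "p \<in> points TE" and s: "s \<in> sections E"
    and v: "v \<in> tangent_space TE p"
      "\<And>f. f \<in> Cinf (base E) \<Longrightarrow> v (\<lambda>p. f (fst p)) = \<rho> (fst p) (s (fst p)) f"
      "\<And>t. t \<in> sections E \<Longrightarrow> v (hat t) = snd p (D s t (fst p))"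
  shows "hlift E \<rho> D p (s (fst p)) = v"
proof -
  obtain q \<alpha> where qa: "p = (q, \<alpha>)" by (cases p)
  have q: "q \<in> points (base E)" using p qa by (auto simp: points_total)
  show ?thesis
    unfolding hlift_def qa prod.case
  proof (rule the_equality)
    have "D s' t q = D s t q" if "s' \<in> sections E" "s' q = s q" "t \<in> sections E" for s' t
      using tensor_1_1_local[OF D[OF that(3)] q that(1) s that(2)] .
    then show "v \<in> tangent_space TE (q, \<alpha>) \<and> (\<forall>f\<in>Cinf (base E). v (f \<circ> fst) = \<rho> q (s (fst (q, \<alpha>))) f) \<and>
        (\<forall>s'\<in>sections E. s' q = s (fst (q, \<alpha>)) \<longrightarrow> (\<forall>t\<in>sections E. v (hat t) = \<alpha> (D s' t q)))"
      using v qa by (simp add: comp_def)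
    fix w assume w: "w \<in> tangent_space TE (q, \<alpha>) \<and> (\<forall>f\<in>Cinf (base E). w (f \<circ> fst) = \<rho> q (s (fst (q, \<alpha>))) f) \<and>
        (\<forall>s'\<in>sections E. s' q = s (fst (q, \<alpha>)) \<longrightarrow> (\<forall>t\<in>sections E. w (hat t) = \<alpha> (D s' t q)))"
    show "w = v"
    proof (rule tangent_eqI[OF p _ v(1)])
      show "w \<in> tangent_space TE p" using w qa by simp
      show "w (\<lambda>p. f (fst p)) = v (\<lambda>p. f (fst p))" if "f \<in> Cinf (base E)" for f
        using w v(2)[OF that] that qa by (simp add: comp_def)
      show "w (hat t) = v (hat t)" if "t \<in> sections E" for t
        using w v(3)[OF that] that qa s by simp
    qed
  qed
qed

text \<open>Reduces existence and smoothness of horizontal lifts to a vector field \<open>Z\<close>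
  with the right projection whose action on linear functions is wrong only by a (1,1)-tensor
  \<open>S\<close>: adding the vertical lift of \<open>S\<close> corrects it.\<close>

lemma hlift_field:
  assumes D: "\<And>t. t \<in> sections E \<Longrightarrow> tensor_1_1 (\<lambda>s. D s t)" and s: "s \<in> sections E" and S: "tensor_1_1 S"
    and Z: "Z \<in> vector_fields TE"
      "\<And>p f. p \<in> points TE \<Longrightarrow> f \<in> Cinf (base E) \<Longrightarrow> Z p (\<lambda>p. f (fst p)) = \<rho> (fst p) (s (fst p)) f"
      "\<And>p t. p \<in> points TE \<Longrightarrow> t \<in> sections E \<Longrightarrow>
        Z p (hat t) = snd p (D s t (fst p)) - snd p (S t (fst p))"
  shows "(\<lambda>p. if p \<in> points TE then hlift E \<rho> D p (s (fst p)) else 0) \<in> vector_fields TE"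
    and "p \<in> points TE \<Longrightarrow> f \<in> Cinf (base E) \<Longrightarrow>
      hlift E \<rho> D p (s (fst p)) (\<lambda>p. f (fst p)) = \<rho> (fst p) (s (fst p)) f"
    and "p \<in> points TE \<Longrightarrow> t \<in> sections E \<Longrightarrow>
      hlift E \<rho> D p (s (fst p)) (hat t) = snd p (D s t (fst p))"
proof -
  let ?X = "Z + tensor_vert S"
  have X: "?X \<in> vector_fields TE"
    by (rule T.vector_fields_add[OF Z(1) tensor_vert_vector_field[OF S]])
  have Xf: "?X p (\<lambda>p. f (fst p)) = \<rho> (fst p) (s (fst p)) f"
    if "p \<in> points TE" "f \<in> Cinf (base E)" for p f
    using that by (simp add: Z(2) tensor_vert_def vert_fst transpose_at_dual[OF S])
  have Xt: "?X p (hat t) = snd p (D s t (fst p))" if "p \<in> points TE" "t \<in> sections E" for p t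
    using that by (simp add: Z(3) tensor_vert_def vert_hat transpose_at_dual[OF S] transpose_at[OF S])
  have eq: "hlift E \<rho> D p (s (fst p)) = ?X p" if p: "p \<in> points TE" for p
    using Xf[OF p] Xt[OF p] by (intro hlift_eqI[OF D p s] T.vector_fieldD(1)[OF X p])
  have "(\<lambda>p. if p \<in> points TE then hlift E \<rho> D p (s (fst p)) else 0) = ?X"
    using eq T.vector_fieldD(3)[OF X] by auto
  then show "(\<lambda>p. if p \<in> points TE then hlift E \<rho> D p (s (fst p)) else 0) \<in> vector_fields TE"
    using X by simp
  show "p \<in> points TE \<Longrightarrow> f \<in> Cinf (base E) \<Longrightarrow>
      hlift E \<rho> D p (s (fst p)) (\<lambda>p. f (fst p)) = \<rho> (fst p) (s (fst p)) f"
    "p \<in> points TE \<Longrightarrow> t \<in> sections E \<Longrightarrow>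
      hlift E \<rho> D p (s (fst p)) (hat t) = snd p (D s t (fst p))"
    using eq Xf Xt by simp_all
qed

end

section \<open>The left tangent bundle\<close>

lemma (in charted) vector_fields_0: "0 \<in> vector_fields M"
proof -
  have "0 \<in> tangent_space M p" for p by (rule subspace_0[OF subspace_tangent_space])
  then show ?thesis using Cinf_const[of 0] by (simp add: vector_fields_def)
qed

lemma dual_space_diff:
  assumes "\<alpha> \<in> dual_space V" "subspace V" "x \<in> V" "y \<in> V"
  shows "\<alpha> (x - y) = \<alpha> x - \<alpha> y"
  using dual_spaceD(1)[OF assms(1) subspace_diff[OF assms(2-4)] assms(4)] by simp

lemma liouville_eq: "liouville p x = snd p (fst x)"
  by (simp add: liouville_def split_beta)

lemma LT_anchor_l_eq: "LT_anchor_l p x = snd x"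
  by (simp add: LT_anchor_l_def split_beta)

text \<open>Tensoriality in the direction is what makes the horizontal lift of a single vector well
  defined.\<close>

lemma (in smooth_bundle) connection_tensor_1_1:
  assumes "connection E \<rho> D" "t \<in> sections E"
  shows "tensor_1_1 (\<lambda>s. D s t)"
  using assms unfolding connection_def tensor_1_1_def bilinear_on_set_def linear_on_set_def by blast

locale left_tangent_bundle = smooth_bundle E
  for E :: "('q, 'b::fd_inner, 'e::real_vector, 'c::fd_inner) vbundle" +
  fixes B Dl Dr :: "('q \<Rightarrow> 'e) \<Rightarrow> ('q \<Rightarrow> 'e) \<Rightarrow> 'q \<Rightarrow> 'e"
    and \<rho>l \<rho>r :: "'q \<Rightarrow> 'e \<Rightarrow> 'q tvec"
    and R :: "('q \<Rightarrow> 'e) \<Rightarrow> ('q \<Rightarrow> 'e) \<Rightarrow> ('q \<Rightarrow> 'e) \<Rightarrow> 'q \<Rightarrow> 'e"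
    and BT :: "('q \<times> ('e \<Rightarrow> real) \<Rightarrow> ('q, 'e) lt_vec) \<Rightarrow> ('q \<times> ('e \<Rightarrow> real) \<Rightarrow> ('q, 'e) lt_vec) \<Rightarrow>
               'q \<times> ('e \<Rightarrow> real) \<Rightarrow> ('q, 'e) lt_vec"
    and P :: "'q \<times> ('e \<Rightarrow> real) \<Rightarrow> (('q \<times> ('e \<Rightarrow> real)) tvec \<Rightarrow> real) \<Rightarrow>
              (('q \<times> ('e \<Rightarrow> real)) tvec \<Rightarrow> real) \<Rightarrow> real"
  assumes alg: "algebroid_on E B \<rho>l \<rho>r"
    and con_l: "connection E \<rho>l Dl"
    and con_r: "connection E \<rho>r Dr"
    and B_eq: "\<And>s t. s \<in> sections E \<Longrightarrow> t \<in> sections E \<Longrightarrow> B s t = Dl s t - Dr t s"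
    and LT: "LT_algebroid E B \<rho>l \<rho>r Dl Dr R BT"
    and Pi: "Pi_tensor E B \<rho>l \<rho>r P"
begin

abbreviation "G \<equiv> LT_sections E \<rho>l"
abbreviation "hor \<equiv> LT_hor E \<rho>l Dl"
abbreviation "ver \<nu> \<equiv> LT_vert (vlift E \<nu>)"
abbreviation "ar \<equiv> LT_anchor_r E \<rho>l \<rho>r Dl Dr"
abbreviation "\<Omega> \<equiv> LT_Omega E \<rho>l \<rho>r Dl Dr BT"

lemma point:
  assumes "p \<in> points TE"
  shows "fst p \<in> points (base E)" "snd p \<in> dual_space (fibre E (fst p))"
  using assms by (auto simp: points_total)

lemma tensor_Dl: "t \<in> sections E \<Longrightarrow> tensor_1_1 (\<lambda>s. Dl s t)"
  and tensor_Dr: "t \<in> sections E \<Longrightarrow> tensor_1_1 (\<lambda>s. Dr s t)"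
  using connection_tensor_1_1 con_l con_r by blast+

lemma snd_B:
  assumes "p \<in> points TE" "s \<in> sections E" "t \<in> sections E"
  shows "snd p (B s t (fst p)) = snd p (Dl s t (fst p)) - snd p (Dr t s (fst p))"
  using section_in[OF tensor_1_1D(1)[OF tensor_Dl[OF assms(3)] assms(2)] point(1)[OF assms(1)]]
    section_in[OF tensor_1_1D(1)[OF tensor_Dr[OF assms(2)] assms(3)] point(1)[OF assms(1)]]
  by (simp add: B_eq assms dual_space_diff[OF point(2) subspace_fibre[OF point(1)]])

lemma P_tensor: "tensor_2_0 TE P"
  using Pi by (simp add: Pi_tensor_def)

lemma bracket_hat_hat:
    "s \<in> sections E \<Longrightarrow> t \<in> sections E \<Longrightarrow> p \<in> points TE \<Longrightarrow>
      tensor_bracket TE P (hat s) (hat t) p = - snd p (B s t (fst p))"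
  and bracket_hat_fst:
    "s \<in> sections E \<Longrightarrow> g \<in> Cinf (base E) \<Longrightarrow> p \<in> points TE \<Longrightarrow>
      tensor_bracket TE P (hat s) (\<lambda>p. g (fst p)) p = - \<rho>l (fst p) (s (fst p)) g"
  and bracket_fst_hat:
    "f \<in> Cinf (base E) \<Longrightarrow> t \<in> sections E \<Longrightarrow> p \<in> points TE \<Longrightarrow>
      tensor_bracket TE P (\<lambda>p. f (fst p)) (hat t) p = \<rho>r (fst p) (t (fst p)) f"
  and bracket_fst_fst:
    "f \<in> Cinf (base E) \<Longrightarrow> g \<in> Cinf (base E) \<Longrightarrow> p \<in> points TE \<Longrightarrow>
      tensor_bracket TE P (\<lambda>p. f (fst p)) (\<lambda>p. g (fst p)) p = 0"
proof -
  have *: "tensor_bracket TE P (hat s) (hat t) p = - snd p (B s t (fst p)) \<and>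
      tensor_bracket TE P (hat s) (\<lambda>p. g (fst p)) p = - \<rho>l (fst p) (s (fst p)) g \<and>
      tensor_bracket TE P (\<lambda>p. f (fst p)) (hat t) p = \<rho>r (fst p) (t (fst p)) f \<and>
      tensor_bracket TE P (\<lambda>p. f (fst p)) (\<lambda>p. g (fst p)) p = 0"
    if "s \<in> sections E" "t \<in> sections E" "f \<in> Cinf (base E)" "g \<in> Cinf (base E)" "p \<in> points TE" for s t f g p
    using Pi that unfolding Pi_tensor_def by (simp add: comp_def hat_def[of "B s t"] split_beta)
  show "s \<in> sections E \<Longrightarrow> t \<in> sections E \<Longrightarrow> p \<in> points TE \<Longrightarrow>
      tensor_bracket TE P (hat s) (hat t) p = - snd p (B s t (fst p))"
    using * Q.Cinf_const by blast
  show "s \<in> sections E \<Longrightarrow> g \<in> Cinf (base E) \<Longrightarrow> p \<in> points TE \<Longrightarrow>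
      tensor_bracket TE P (hat s) (\<lambda>p. g (fst p)) p = - \<rho>l (fst p) (s (fst p)) g"
    using * by blast
  show "f \<in> Cinf (base E) \<Longrightarrow> t \<in> sections E \<Longrightarrow> p \<in> points TE \<Longrightarrow>
      tensor_bracket TE P (\<lambda>p. f (fst p)) (hat t) p = \<rho>r (fst p) (t (fst p)) f"
    using * by blast
  show "f \<in> Cinf (base E) \<Longrightarrow> g \<in> Cinf (base E) \<Longrightarrow> p \<in> points TE \<Longrightarrow>
      tensor_bracket TE P (\<lambda>p. f (fst p)) (\<lambda>p. g (fst p)) p = 0"
    using * sections_0 by blast
qed

text \<open>The Hamiltonian vector field of \<^term>\<open>hat s\<close> differs from the horizontal lift of
  \<^term>\<open>s\<close> by the vertical lift of a (1,1)-tensor, which shows that the horizontal lifts exist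
  and are smooth.\<close>

lemma
  assumes s: "s \<in> sections E"
  shows hlift_l_field: "(\<lambda>p. if p \<in> points TE then hlift E \<rho>l Dl p (s (fst p)) else 0) \<in> vector_fields TE"
    and hlift_l_fst: "p \<in> points TE \<Longrightarrow> f \<in> Cinf (base E) \<Longrightarrow>
      hlift E \<rho>l Dl p (s (fst p)) (\<lambda>p. f (fst p)) = \<rho>l (fst p) (s (fst p)) f"
    and hlift_l_hat: "p \<in> points TE \<Longrightarrow> t \<in> sections E \<Longrightarrow>
      hlift E \<rho>l Dl p (s (fst p)) (hat t) = snd p (Dl s t (fst p))"
    and hlift_r_field: "(\<lambda>p. if p \<in> points TE then hlift E \<rho>r Dr p (s (fst p)) else 0) \<in> vector_fields TE"
    and hlift_r_fst: "p \<in> points TE \<Longrightarrow> f \<in> Cinf (base E) \<Longrightarrow>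
      hlift E \<rho>r Dr p (s (fst p)) (\<lambda>p. f (fst p)) = \<rho>r (fst p) (s (fst p)) f"
    and hlift_r_hat: "p \<in> points TE \<Longrightarrow> t \<in> sections E \<Longrightarrow>
      hlift E \<rho>r Dr p (s (fst p)) (hat t) = snd p (Dr s t (fst p))"
proof -
  let ?Zl = "tensor_hamiltonian_field TE P (hat s)" and ?Zr = "T.tensor_cohamiltonian_field P (hat s)"
  have Zl: "?Zl \<in> vector_fields TE" "?Zr \<in> vector_fields TE"
    by (rule T.tensor_hamiltonian_field_vector_field[OF P_tensor hat_Cinf[OF s]],
        rule T.tensor_cohamiltonian_field_vector_field[OF P_tensor hat_Cinf[OF s]])
  have f: "?Zl p (\<lambda>p. f (fst p)) = \<rho>l (fst p) (s (fst p)) f" "?Zr p (\<lambda>p. f (fst p)) = \<rho>r (fst p) (s (fst p)) f"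
    if "p \<in> points TE" "f \<in> Cinf (base E)" for p f
    using that by (simp_all add: tensor_hamiltonian_field_def T.tensor_cohamiltonian_field_def comp_fst_Cinf
        bracket_hat_fst bracket_fst_hat s)
  \<comment> \<open>Here \<open>B s t = Dl s t - Dr t s\<close> enters: the field of
    \<open>hat s\<close> acts on \<open>hat t\<close> through \<open>B s t\<close> for the left lift
    and through \<open>- B t s\<close> for the right one. In each case the unwanted term is
    tensorial in \<open>t\<close>, being a covariant derivative in direction
    \<open>t\<close>.\<close>
  have t: "?Zl p (hat t) = snd p (Dl s t (fst p)) - snd p (Dr t s (fst p))"
    "?Zr p (hat t) = snd p (Dr s t (fst p)) - snd p (Dl t s (fst p))"
    if "p \<in> points TE" "t \<in> sections E" for p t
    using that by (simp_all add: tensor_hamiltonian_field_def T.tensor_cohamiltonian_field_def hat_Cinf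
        bracket_hat_hat s snd_B)
  note l = hlift_field[where D = Dl and \<rho> = \<rho>l and S = "\<lambda>t. Dr t s", OF tensor_Dl s tensor_Dr[OF s] Zl(1) f(1) t(1)]
  note r = hlift_field[where D = Dr and \<rho> = \<rho>r and S = "\<lambda>t. Dl t s", OF tensor_Dr s tensor_Dl[OF s] Zl(2) f(2) t(2)]
  show "(\<lambda>p. if p \<in> points TE then hlift E \<rho>l Dl p (s (fst p)) else 0) \<in> vector_fields TE"
    by (rule l(1))
  show "(\<lambda>p. if p \<in> points TE then hlift E \<rho>r Dr p (s (fst p)) else 0) \<in> vector_fields TE"
    by (rule r(1))
  show "p \<in> points TE \<Longrightarrow> f \<in> Cinf (base E) \<Longrightarrow> hlift E \<rho>l Dl p (s (fst p)) (\<lambda>p. f (fst p)) = \<rho>l (fst p) (s (fst p)) f"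
    by (rule l(2))
  show "p \<in> points TE \<Longrightarrow> f \<in> Cinf (base E) \<Longrightarrow> hlift E \<rho>r Dr p (s (fst p)) (\<lambda>p. f (fst p)) = \<rho>r (fst p) (s (fst p)) f"
    by (rule r(2))
  show "p \<in> points TE \<Longrightarrow> t \<in> sections E \<Longrightarrow> hlift E \<rho>l Dl p (s (fst p)) (hat t) = snd p (Dl s t (fst p))"
    by (rule l(3))
  show "p \<in> points TE \<Longrightarrow> t \<in> sections E \<Longrightarrow> hlift E \<rho>r Dr p (s (fst p)) (hat t) = snd p (Dr s t (fst p))"
    by (rule r(3))
qed

lemma hlift_tangent:
  assumes "s \<in> sections E" "p \<in> points TE"
  shows "hlift E \<rho>l Dl p (s (fst p)) \<in> tangent_space TE p" "hlift E \<rho>r Dr p (s (fst p)) \<in> tangent_space TE p"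
  using T.vector_fieldD(1)[OF hlift_l_field[OF assms(1)] assms(2)]
    T.vector_fieldD(1)[OF hlift_r_field[OF assms(1)] assms(2)] assms(2) by simp_all

lemma anchor_linear:
  assumes "q \<in> points (base E)" "e \<in> fibre E q"
  shows "e' \<in> fibre E q \<Longrightarrow> \<rho>l q (e + e') = \<rho>l q e + \<rho>l q e'" "\<rho>l q (c *\<^sub>R e) = c *\<^sub>R \<rho>l q e"
    "\<rho>r q (c *\<^sub>R e) = c *\<^sub>R \<rho>r q e" "\<rho>l q e \<in> tangent_space (base E) q"
proof -
  have "anchor (base E) (fibre E) (sections E) \<rho>l" "anchor (base E) (fibre E) (sections E) \<rho>r"
    using alg by (simp_all only: algebroid_def)
  then have "linear_on_set (fibre E q) (\<rho>l q)" "\<rho>l q ` fibre E q \<subseteq> tangent_space (base E) q"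
    "linear_on_set (fibre E q) (\<rho>r q)"
    using assms(1) by (simp_all add: anchor_def)
  then show "e' \<in> fibre E q \<Longrightarrow> \<rho>l q (e + e') = \<rho>l q e + \<rho>l q e'" "\<rho>l q (c *\<^sub>R e) = c *\<^sub>R \<rho>l q e"
    "\<rho>r q (c *\<^sub>R e) = c *\<^sub>R \<rho>r q e" "\<rho>l q e \<in> tangent_space (base E) q"
    using assms(2) by (auto simp: linear_on_set_def)
qed

lemma anchor_0:
  assumes "q \<in> points (base E)" shows "\<rho>l q 0 = 0" "\<rho>r q 0 = 0"
  using anchor_linear(2,3)[OF assms subspace_0[OF subspace_fibre[OF assms]], of 0] by simp_all

text \<open>The zero vector satisfies the description of the lift of 0. It follows that the right
  anchor leaves vertical vectors unchanged.\<close>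

lemma hlift_0:
  assumes p: "p \<in> points TE"
  shows "hlift E \<rho>l Dl p 0 = 0" "hlift E \<rho>r Dr p 0 = 0"
proof -
  note 0 = subspace_0[OF T.subspace_tangent_space[of p]] and al = dual_space_0[OF point(2)[OF p] subspace_fibre[OF point(1)[OF p]]]
  show "hlift E \<rho>l Dl p 0 = 0"
    using hlift_eqI[where D = Dl and \<rho> = \<rho>l, OF tensor_Dl p sections_0 0] tensor_1_1_0[OF tensor_Dl]
    by (simp add: anchor_0 point[OF p] al)
  show "hlift E \<rho>r Dr p 0 = 0"
    using hlift_eqI[where D = Dr and \<rho> = \<rho>r, OF tensor_Dr p sections_0 0] tensor_1_1_0[OF tensor_Dr]
    by (simp add: anchor_0 point[OF p] al)
qed

section \<open>Fibres and sections of the left tangent bundle\<close>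

lemma LT_fibre_iff:
  assumes p: "p \<in> points TE"
  shows "x \<in> LT_fibre E \<rho>l p \<longleftrightarrow> fst x \<in> fibre E (fst p) \<and> snd x \<in> tangent_space TE p \<and>
    (\<forall>f\<in>Cinf (base E). snd x (\<lambda>p. f (fst p)) = \<rho>l (fst p) (fst x) f)"
proof -
  have "\<rho>l (fst p) e = tangent_map (base E) fst v \<longleftrightarrow> (\<forall>f\<in>Cinf (base E). v (\<lambda>p. f (fst p)) = \<rho>l (fst p) e f)"
    if "e \<in> fibre E (fst p)" for e v
    using anchor_linear(4)[OF point(1)[OF p] that]
    by (auto simp: fun_eq_iff tangent_map_def comp_def tangent_space_def dual_space_def)
  then show ?thesis unfolding LT_fibre_def by (auto simp: split_beta)
qed

lemma subspace_LT_fibre: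
  assumes p: "p \<in> points TE"
  shows "subspace (LT_fibre E \<rho>l p)"
  unfolding subspace_def
proof (intro conjI ballI allI)
  note q = point(1)[OF p] and sub = subspace_fibre[OF point(1)[OF p]]
  show "0 \<in> LT_fibre E \<rho>l p"
    by (simp add: LT_fibre_iff[OF p] subspace_0[OF sub] subspace_0[OF T.subspace_tangent_space] anchor_0[OF q])
  show "x + y \<in> LT_fibre E \<rho>l p" if "x \<in> LT_fibre E \<rho>l p" "y \<in> LT_fibre E \<rho>l p" for x y
    using that by (auto simp: LT_fibre_iff[OF p] subspace_add[OF sub] subspace_add[OF T.subspace_tangent_space] anchor_linear(1)[OF q])
  show "c *\<^sub>R x \<in> LT_fibre E \<rho>l p" if "x \<in> LT_fibre E \<rho>l p" for c x
    using that by (auto simp: LT_fibre_iff[OF p] subspace_scale[OF sub] subspace_scale[OF T.subspace_tangent_space]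
        anchor_linear(2)[OF q] scaleR_fun_apply)
qed

lemma G_D:
  assumes "X \<in> G"
  shows "p \<in> points TE \<Longrightarrow> X p \<in> LT_fibre E \<rho>l p" "fst \<circ> X \<in> sections_along TE fst E" "snd \<circ> X \<in> vector_fields TE"
    "p \<in> points TE \<Longrightarrow> fst (X p) \<in> fibre E (fst p)" "p \<in> points TE \<Longrightarrow> snd (X p) \<in> tangent_space TE p"
    "p \<in> points TE \<Longrightarrow> f \<in> Cinf (base E) \<Longrightarrow> snd (X p) (\<lambda>p. f (fst p)) = \<rho>l (fst p) (fst (X p)) f"
    "p \<notin> points TE \<Longrightarrow> X p = 0"
proof -
  show "p \<in> points TE \<Longrightarrow> X p \<in> LT_fibre E \<rho>l p" and s: "fst \<circ> X \<in> sections_along TE fst E" and v: "snd \<circ> X \<in> vector_fields TE"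
    using assms by (simp_all add: LT_sections_def)
  then show "p \<in> points TE \<Longrightarrow> fst (X p) \<in> fibre E (fst p)" "p \<in> points TE \<Longrightarrow> snd (X p) \<in> tangent_space TE p"
    "p \<in> points TE \<Longrightarrow> f \<in> Cinf (base E) \<Longrightarrow> snd (X p) (\<lambda>p. f (fst p)) = \<rho>l (fst p) (fst (X p)) f"
    by (simp_all add: LT_fibre_iff)
  show "X p = 0" if "p \<notin> points TE"
  proof (rule prod_eqI)
    show "fst (X p) = fst 0" using s that unfolding sections_along_iff comp_def by (metis fst_zero)
    show "snd (X p) = snd 0" using T.vector_fieldD(3)[OF v that] by simp
  qed
qed

lemma G_add: "X \<in> G \<Longrightarrow> Y \<in> G \<Longrightarrow> X + Y \<in> G"
proof -
  assume XY: "X \<in> G" "Y \<in> G"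
  have "fst \<circ> (X + Y) = (fst \<circ> X) + (fst \<circ> Y)" "snd \<circ> (X + Y) = (snd \<circ> X) + (snd \<circ> Y)"
    by (simp_all add: fun_eq_iff)
  then show ?thesis
    using sections_along_add[OF smooth_map_fst G_D(2)[OF XY(1)] G_D(2)[OF XY(2)]]
      T.vector_fields_add[OF G_D(3)[OF XY(1)] G_D(3)[OF XY(2)]] G_D(1)[OF XY(1)] G_D(1)[OF XY(2)]
    unfolding LT_sections_def by (auto intro: subspace_add[OF subspace_LT_fibre])
qed

lemma G_fmul: "f \<in> Cinf TE \<Longrightarrow> X \<in> G \<Longrightarrow> fmul f X \<in> G"
proof -
  assume f: "f \<in> Cinf TE" and X: "X \<in> G"
  have "fst \<circ> fmul f X = fmul f (fst \<circ> X)" "snd \<circ> fmul f X = fmul f (snd \<circ> X)"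
    by (simp_all add: fun_eq_iff fmul_apply)
  then show ?thesis
    using sections_along_fmul[OF smooth_map_fst G_D(2)[OF X] f] T.vector_fields_fmul[OF f G_D(3)[OF X]] G_D(1)[OF X]
    unfolding LT_sections_def by (auto simp: fmul_apply intro: subspace_scale[OF subspace_LT_fibre])
qed

lemma LT_vert_G:
  assumes V: "V \<in> vector_fields TE" "\<And>p f. p \<in> points TE \<Longrightarrow> f \<in> Cinf (base E) \<Longrightarrow> V p (\<lambda>p. f (fst p)) = 0"
  shows "LT_vert V \<in> G"
proof -
  have "fst \<circ> LT_vert V = (\<lambda>p. if p \<in> points TE then 0 (fst p) else 0)" "snd \<circ> LT_vert V = V"
    by (simp_all add: fun_eq_iff LT_vert_def)
  then show ?thesis
    using pullback_section[OF smooth_map_fst sections_0] V T.vector_fieldD(1)[OF V(1)]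
    by (auto simp: LT_sections_def LT_fibre_iff LT_vert_def anchor_0 point subspace_0[OF subspace_fibre])
qed

lemma ver_G: "\<nu> \<in> sections (dual_bundle E) \<Longrightarrow> ver \<nu> \<in> G"
  by (intro LT_vert_G vlift_field(2)) (simp_all add: vlift_apply vert_fst dual_section_in point)

lemma G_0: "0 \<in> G"
proof -
  have "LT_vert 0 = (0 :: 'q \<times> ('e \<Rightarrow> real) \<Rightarrow> ('q, 'e) lt_vec)" by (simp add: LT_vert_def fun_eq_iff zero_prod_def)
  with LT_vert_G[OF T.vector_fields_0] show ?thesis by simp
qed

lemma G_sum: "(\<And>i. i \<in> I \<Longrightarrow> X i \<in> G) \<Longrightarrow> (\<Sum>i\<in>I. X i) \<in> G"
  by (induction I rule: infinite_finite_induct) (auto intro: G_add G_0)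

lemma hor_G:
  assumes s: "s \<in> sections E" shows "hor s \<in> G"
proof -
  have "fst \<circ> hor s = (\<lambda>p. if p \<in> points TE then s (fst p) else 0)"
    "snd \<circ> hor s = (\<lambda>p. if p \<in> points TE then hlift E \<rho>l Dl p (s (fst p)) else 0)"
    by (simp_all add: fun_eq_iff LT_hor_def)
  then show ?thesis
    using pullback_section[OF smooth_map_fst s] hlift_l_field[OF s]
    by (simp add: LT_sections_def LT_fibre_iff) (simp add: LT_hor_def section_in[OF s] point hlift_tangent[OF s] hlift_l_fst[OF s])
qed


section \<open>Reduction of tensorial functionals to horizontal and vertical lifts\<close>

lemma hor_apply: "p \<in> points TE \<Longrightarrow> hor s p = (s (fst p), hlift E \<rho>l Dl p (s (fst p)))"
  by (simp add: LT_hor_def)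

lemma ver_apply:
  "\<nu> \<in> sections (dual_bundle E) \<Longrightarrow> p \<in> points TE \<Longrightarrow> ver \<nu> p = (0, vert p (\<nu> (fst p)))"
  by (simp add: LT_vert_def vlift_apply)

text \<open>Horizontal and vertical lifts generate the sections locally: multiplied by a function
  \<^term>\<open>\<theta>\<close> with \<^term>\<open>\<theta> q = 1\<close>, a section becomes a combination of horizontal lifts of a frame
  and a vertical field, which, multiplied by \<^term>\<open>\<theta>\<close> again, becomes a combination of vertical
  lifts of the dual frame.\<close>

lemma functional_eq_0:
  assumes p0: "p0 \<in> points TE" and X: "X \<in> G"
    and add: "\<And>X Y. X \<in> G \<Longrightarrow> Y \<in> G \<Longrightarrow> L (X + Y) = L X + L Y"
    and fmul: "\<And>f X. f \<in> Cinf TE \<Longrightarrow> X \<in> G \<Longrightarrow> L (fmul f X) = f p0 * L X"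
    and hor: "\<And>s. s \<in> sections E \<Longrightarrow> L (hor s) = 0"
    and ver: "\<And>\<nu>. \<nu> \<in> sections (dual_bundle E) \<Longrightarrow> L (ver \<nu>) = 0"
  shows "L X = (0::real)"
proof -
  obtain \<theta> b \<beta> where \<theta>: "\<theta> \<in> Cinf (base E)" and 1: "\<theta> (fst p0) = 1" and b: "\<And>c. b c \<in> sections E"
    and \<beta>: "\<And>c. \<beta> c \<in> sections (dual_bundle E)" and fr:
    "\<And>q e. q \<in> points (base E) \<Longrightarrow> e \<in> fibre E q \<Longrightarrow> \<theta> q *\<^sub>R e = (\<Sum>c\<in>(onb::'c set). \<beta> c q e *\<^sub>R b c q)"
    by (rule frame_exists[OF point(1)[OF p0]]) (rule that)
  define \<Theta> where "\<Theta> p = \<theta> (fst p)" for p :: "'q \<times> ('e \<Rightarrow> real)"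
  have \<Theta>: "\<Theta> \<in> Cinf TE" "\<Theta> p0 = 1" unfolding \<Theta>_def by (rule comp_fst_Cinf[OF \<theta>]) (rule 1)
  have L_0: "L 0 = 0" using add[OF G_0 G_0] by simp
  have L_sum: "L (\<Sum>i\<in>I. Y i) = (\<Sum>i\<in>I. L (Y i))" if "\<And>i. i \<in> I \<Longrightarrow> Y i \<in> G"
    for I :: "'c set" and Y
    using that by (induction I rule: infinite_finite_induct) (simp_all add: L_0 add G_sum del: zero_fun_apply)
  define a where "a c p = \<beta> c (fst p) (fst (X p))" for c p
  have a: "a c \<in> Cinf TE" for c
    unfolding a_def
    by (rule T.Cinf_cong[OF pairing_Cinf[OF smooth_map_fst G_D(2)[OF X] pullback_dual_section[OF smooth_map_fst \<beta>]]])
      simp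
  define Y where "Y = (\<Sum>c\<in>(onb::'c set). fmul (a c) (hor (b c)))"
  have Y: "Y \<in> G" unfolding Y_def by (intro G_sum G_fmul a hor_G b)
  have LY: "L Y = 0"
    unfolding Y_def
    by (subst L_sum) (auto intro!: G_fmul a hor_G b sum.neutral simp: fmul[OF a hor_G[OF b]] hor[OF b])
  \<comment> \<open>Removing the horizontal part \<open>Y\<close> leaves a section without component
    in \<open>E\<close>, whose vector part therefore annihilates functions from the base. As
    \<Theta> is 1 at \<open>p0\<close> and \<open>L\<close> vanishes on \<open>Y\<close>, the value
    of \<open>L\<close> is unchanged.\<close>
  define Z where "Z = fmul \<Theta> X + fmul (\<lambda>_. - 1) Y"
  have Z: "Z \<in> G" unfolding Z_def by (intro G_add G_fmul \<Theta> T.Cinf_const X Y)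
  have "L Z = L X" unfolding Z_def using \<Theta>
    by (simp add: add fmul G_fmul T.Cinf_const X Y LY)
  have Z_fst: "fst (Z p) = 0" if p: "p \<in> points TE" for p
    using fr[OF point(1)[OF p] G_D(4)[OF X p]]
    by (simp add: Z_def Y_def fmul_apply fst_sum sum_fun_apply hor_apply p a_def \<Theta>_def)
  have W: "snd \<circ> Z \<in> vector_fields TE" by (rule G_D(3)[OF Z])
  have W_fst: "snd (Z p) (\<lambda>p. f (fst p)) = 0" if p: "p \<in> points TE" and f: "f \<in> Cinf (base E)" for p f
    using G_D(6)[OF Z p f] by (simp add: Z_fst p anchor_0 point)
  \<comment> \<open>The components of the vertical field with respect to the dual frame: on
    \<open>hat (b c)\<close> a vertical vector takes the value of its covector at
    \<open>b c\<close>.\<close>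
  define w where "w c p = snd (Z p) (hat (b c))" for c p
  have w: "w c \<in> Cinf TE" for c
    using T.vector_fieldD(2)[OF W hat_Cinf[OF b]] by (simp add: w_def[abs_def] comp_def)
  let ?V = "\<Sum>c\<in>(onb::'c set). fmul (w c) (ver (\<beta> c))"
  have V: "?V \<in> G" by (intro G_sum G_fmul w ver_G \<beta>)
  have "fmul \<Theta> Z = ?V"
  proof -
    have snd_eq: "snd \<circ> fmul \<Theta> Z = snd \<circ> ?V"
    proof (rule vector_field_eqI)
      show "snd \<circ> fmul \<Theta> Z \<in> vector_fields TE" by (rule G_D(3)[OF G_fmul[OF \<Theta>(1) Z]])
      show "snd \<circ> ?V \<in> vector_fields TE" by (rule G_D(3)[OF V])
      fix p assume p: "p \<in> points TE"
      note q = point(1)[OF p] and \<alpha> = point(2)[OF p] and vZ = G_D(5)[OF Z p]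
      have \<beta>q: "\<beta> c (fst p) \<in> dual_space (fibre E (fst p))" for c by (rule dual_section_in[OF \<beta> q])
      show "(snd \<circ> fmul \<Theta> Z) p (\<lambda>p. f (fst p)) = (snd \<circ> ?V) p (\<lambda>p. f (fst p))" if f: "f \<in> Cinf (base E)" for f
        by (simp add: fmul_apply scaleR_fun_apply W_fst[OF p f] snd_sum sum_fun_apply ver_apply[OF \<beta> p] vert_fst[OF p \<beta>q f])
      show "(snd \<circ> fmul \<Theta> Z) p (hat t) = (snd \<circ> ?V) p (hat t)" if t: "t \<in> sections E" for t
      proof -
        have bt: "(\<lambda>p. \<beta> c (fst p) (t (fst p))) \<in> Cinf TE" for c
          by (rule comp_fst_Cinf[OF pairing_Cinf_base[OF t \<beta>]])
        \<comment> \<open>The frame identity applied to \<open>t\<close> expresses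
          \<open>\<Theta> * hat t\<close> through the functions \<open>hat (b c)\<close>. As the
          vertical field annihilates base functions, \<Theta> and the coefficients pass through it
          as scalars.\<close>
        have "snd (Z p) (\<lambda>p. \<Theta> p * hat t p) =
            snd (Z p) (\<lambda>p. \<Sum>c\<in>(onb::'c set). \<beta> c (fst p) (t (fst p)) * hat (b c) p)"
        proof (rule T.tangent_cong[OF vZ p T.Cinf_mult[OF \<Theta>(1) hat_Cinf[OF t]]])
          fix x assume x: "x \<in> points TE"
          note xq = point(1)[OF x] and x\<alpha> = point(2)[OF x]
          have "\<Theta> x * hat t x = snd x (\<theta> (fst x) *\<^sub>R t (fst x))"
            by (simp add: \<Theta>_def hat_def split_beta dual_spaceD[OF x\<alpha>] section_in[OF t xq])
          also have "\<dots> = (\<Sum>c\<in>(onb::'c set). \<beta> c (fst x) (t (fst x)) * hat (b c) x)"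
            by (simp add: fr[OF xq section_in[OF t xq]] dual_space_sum[OF x\<alpha> subspace_fibre[OF xq]] section_in[OF b xq]
                hat_def split_beta)
          finally show "\<Theta> x * hat t x = (\<Sum>c\<in>(onb::'c set). \<beta> c (fst x) (t (fst x)) * hat (b c) x)" .
        qed
        moreover have "snd (Z p) (\<lambda>p. \<Theta> p * hat t p) = \<Theta> p * snd (Z p) (hat t)"
          using T.tangent_spaceD(3)[OF vZ \<Theta>(1) hat_Cinf[OF t]] W_fst[OF p \<theta>] by (simp add: \<Theta>_def[abs_def])
        moreover have "snd (Z p) (\<lambda>p. \<Sum>c\<in>(onb::'c set). \<beta> c (fst p) (t (fst p)) * hat (b c) p) =
            (\<Sum>c\<in>(onb::'c set). \<beta> c (fst p) (t (fst p)) * w c p)"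
        proof -
          have "snd (Z p) (\<lambda>p. \<beta> c (fst p) (t (fst p)) * hat (b c) p) = \<beta> c (fst p) (t (fst p)) * w c p" for c
            using T.tangent_spaceD(3)[OF vZ bt hat_Cinf[OF b], of c c] W_fst[OF p pairing_Cinf_base[OF t \<beta>], of c]
            by (simp add: w_def)
          then show ?thesis
            by (subst T.tangent_sum[OF vZ]) (auto intro!: T.Cinf_mult bt hat_Cinf b)
        qed
        ultimately have "\<Theta> p * snd (Z p) (hat t) = (\<Sum>c\<in>(onb::'c set). \<beta> c (fst p) (t (fst p)) * w c p)" by simp
        then show ?thesis
          by (simp add: fmul_apply scaleR_fun_apply snd_sum sum_fun_apply ver_apply[OF \<beta> p] vert_hat[OF p \<beta>q t] mult.commute)
      qed
    qed
    have "snd (fmul \<Theta> Z p) = snd (?V p)" for p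
      using fun_cong[OF snd_eq, of p] by (simp only: comp_apply)
    moreover have "fst (fmul \<Theta> Z p) = fst (?V p)" for p
    proof (cases "p \<in> points TE")
      case True
      then show ?thesis by (simp add: fmul_apply Z_fst fst_sum sum_fun_apply ver_apply[OF \<beta>])
    next
      case False
      then show ?thesis by (simp add: G_D(7)[OF V False] fmul_apply G_D(7)[OF Z False])
    qed
    ultimately show ?thesis by (auto simp: fun_eq_iff prod_eq_iff)
  qed
  moreover have "L ?V = 0"
    by (subst L_sum) (auto intro!: G_fmul w ver_G \<beta> sum.neutral simp: fmul[OF w ver_G[OF \<beta>]] ver[OF \<beta>])
  ultimately show ?thesis using fmul[OF \<Theta>(1) Z] \<Theta>(2) \<open>L Z = L X\<close> by simp
qed


section \<open>The exact symplectic structure\<close>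

lemma BT_props:
  assumes X: "X \<in> G" and Y: "Y \<in> G"
  shows "BT X Y \<in> G" "X' \<in> G \<Longrightarrow> BT (X + X') Y = BT X Y + BT X' Y" "Y' \<in> G \<Longrightarrow> BT X (Y + Y') = BT X Y + BT X Y'"
proof -
  have alg': "algebroid TE (LT_fibre E \<rho>l) G BT LT_anchor_l ar" using LT by (simp add: LT_algebroid_def)
  then have "\<forall>s\<in>G. \<forall>t\<in>G. BT s t \<in> G" "bilinear_on_set G BT" by (simp_all add: algebroid_def)
  then show "BT X Y \<in> G" "X' \<in> G \<Longrightarrow> BT (X + X') Y = BT X Y + BT X' Y" "Y' \<in> G \<Longrightarrow> BT X (Y + Y') = BT X Y + BT X Y'"
    using X Y by (simp_all add: bilinear_on_set_def linear_on_set_def)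
qed

text \<open>The Leibniz rule for two functions, with one of them the constant 1, whose derivative
  along either anchor is 0.\<close>

lemma BT_Leibniz:
  assumes X: "X \<in> G" and Y: "Y \<in> G" and f: "f \<in> Cinf TE" and p: "p \<in> points TE"
  shows "BT (fmul f X) Y p = f p *\<^sub>R BT X Y p - ar p (Y p) f *\<^sub>R X p"
    "BT X (fmul f Y) p = f p *\<^sub>R BT X Y p + snd (X p) f *\<^sub>R Y p"
proof -
  have alg': "algebroid TE (LT_fibre E \<rho>l) G BT LT_anchor_l ar" using LT by (simp add: LT_algebroid_def)
  then have "\<forall>f\<in>Cinf TE. \<forall>g\<in>Cinf TE. \<forall>s\<in>G. \<forall>t\<in>G. \<forall>p\<in>points TE. BT (fmul f s) (fmul g t) p =
      (f p * LT_anchor_l p (s p) g) *\<^sub>R t p - (g p * ar p (t p) f) *\<^sub>R s p + (f p * g p) *\<^sub>R BT s t p"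
    unfolding algebroid_def by (elim conjE)
  note L = this[rule_format]
  have ar: "ar p (Y p) \<in> tangent_space TE p"
  proof -
    have "anchor TE (LT_fibre E \<rho>l) G ar" using alg' by (simp only: algebroid_def)
    then have "ar p ` LT_fibre E \<rho>l p \<subseteq> tangent_space TE p" using p by (simp add: anchor_def)
    then show ?thesis using G_D(1)[OF Y p] by blast
  qed
  have 1: "fmul (\<lambda>_. 1) X = X" for X :: "'q \<times> ('e \<Rightarrow> real) \<Rightarrow> ('q, 'e) lt_vec" by (simp add: fun_eq_iff fmul_apply)
  show "BT (fmul f X) Y p = f p *\<^sub>R BT X Y p - ar p (Y p) f *\<^sub>R X p"
    using L[OF f T.Cinf_const[of 1] X Y p] T.tangent_const[OF G_D(5)[OF X p], of 1]
    by (simp add: 1 LT_anchor_l_eq)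
  show "BT X (fmul f Y) p = f p *\<^sub>R BT X Y p + snd (X p) f *\<^sub>R Y p"
    using L[OF T.Cinf_const[of 1] f X Y p] T.tangent_const[OF ar, of 1]
    by (simp add: 1 LT_anchor_l_eq)
qed

lemma ar_props:
  assumes X: "X \<in> G" and p: "p \<in> points TE"
  shows "ar p (X p) \<in> tangent_space TE p" "Y \<in> G \<Longrightarrow> ar p ((X + Y) p) = ar p (X p) + ar p (Y p)"
    "ar p (fmul f X p) = f p *\<^sub>R ar p (X p)"
proof -
  have "algebroid TE (LT_fibre E \<rho>l) G BT LT_anchor_l ar" using LT by (simp add: LT_algebroid_def)
  then have "anchor TE (LT_fibre E \<rho>l) G ar" by (simp only: algebroid_def)
  then have "linear_on_set (LT_fibre E \<rho>l p) (ar p)" "ar p ` LT_fibre E \<rho>l p \<subseteq> tangent_space TE p"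
    using p by (simp_all add: anchor_def)
  then show "ar p (X p) \<in> tangent_space TE p" "Y \<in> G \<Longrightarrow> ar p ((X + Y) p) = ar p (X p) + ar p (Y p)"
    "ar p (fmul f X p) = f p *\<^sub>R ar p (X p)"
    using G_D(1)[OF _ p] X by (auto simp: linear_on_set_def fmul_apply)
qed

lemma ar_hor: "s \<in> sections E \<Longrightarrow> p \<in> points TE \<Longrightarrow> ar p (hor s p) = hlift E \<rho>r Dr p (s (fst p))"
  by (simp add: LT_anchor_r_def hor_apply)

lemma ar_ver: "\<nu> \<in> sections (dual_bundle E) \<Longrightarrow> p \<in> points TE \<Longrightarrow> ar p (ver \<nu> p) = vert p (\<nu> (fst p))"
  by (simp add: LT_anchor_r_def ver_apply hlift_0)

text \<open>The Liouville section contracted with \<open>X\<close>: it is \<open>hat s\<close> on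
  the horizontal lift of \<open>s\<close> and 0 on vertical lifts.\<close>

definition lam :: "('q \<times> ('e \<Rightarrow> real) \<Rightarrow> ('q, 'e) lt_vec) \<Rightarrow> 'q \<times> ('e \<Rightarrow> real) \<Rightarrow> real" where
  "lam X = (\<lambda>p. snd p (fst (X p)))"

lemma lam_Cinf: "X \<in> G \<Longrightarrow> lam X \<in> Cinf TE"
  unfolding lam_def using section_along_pairing_Cinf[OF G_D(2)] by simp

lemma lam_add: "X \<in> G \<Longrightarrow> Y \<in> G \<Longrightarrow> p \<in> points TE \<Longrightarrow> lam (X + Y) p = lam X p + lam Y p"
  by (simp add: lam_def dual_spaceD[OF point(2)] G_D(4))

lemma lam_fmul: "X \<in> G \<Longrightarrow> p \<in> points TE \<Longrightarrow> lam (fmul f X) p = f p * lam X p"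
  by (simp add: lam_def dual_spaceD[OF point(2)] G_D(4) fmul_apply)

lemma \<Omega>_eq: "\<Omega> X Y p = ar p (Y p) (lam X) + lam (BT X Y) p - snd (X p) (lam Y)"
  by (simp add: LT_Omega_def d_lr_def liouville_eq LT_anchor_l_eq lam_def)

lemma tangent_lam_add:
  assumes "v \<in> tangent_space TE p" "p \<in> points TE" "X \<in> G" "Y \<in> G"
  shows "v (lam (X + Y)) = v (lam X) + v (lam Y)"
  using T.tangent_cong[OF assms(1,2) lam_Cinf[OF G_add[OF assms(3,4)]] lam_add[OF assms(3,4)]]
    T.tangent_spaceD(1)[OF assms(1) lam_Cinf[OF assms(3)] lam_Cinf[OF assms(4)]] by simp

lemma tangent_lam_fmul:
  assumes "v \<in> tangent_space TE p" "p \<in> points TE" "X \<in> G" "f \<in> Cinf TE"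
  shows "v (lam (fmul f X)) = f p * v (lam X) + lam X p * v f"
  using T.tangent_cong[OF assms(1,2) lam_Cinf[OF G_fmul[OF assms(4,3)]] lam_fmul[OF assms(3)]]
    T.tangent_spaceD(3)[OF assms(1,4) lam_Cinf[OF assms(3)]] by simp

lemma lam_combination:
  assumes "X \<in> G" "Y \<in> G" "p \<in> points TE" "Z p = a *\<^sub>R X p + c *\<^sub>R Y p"
  shows "lam Z p = a * lam X p + c * lam Y p"
proof -
  note sub = subspace_scale[OF subspace_fibre[OF point(1)[OF assms(3)]]]
  show ?thesis using assms(4)
    by (simp add: lam_def dual_spaceD[OF point(2)[OF assms(3)]] G_D(4)[OF _ assms(3)] assms sub)
qed

text \<open>Tensoriality: the derivative of \<open>f\<close> produced by the Leibniz rule of the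
  bracket cancels the one from differentiating \<open>f * lam X\<close> along the right anchor, or
  \<open>f * lam Y\<close> along the left one.\<close>

lemma \<Omega>_linear:
  assumes X: "X \<in> G" and Y: "Y \<in> G" and p: "p \<in> points TE"
  shows "X' \<in> G \<Longrightarrow> \<Omega> (X + X') Y p = \<Omega> X Y p + \<Omega> X' Y p" "Y' \<in> G \<Longrightarrow> \<Omega> X (Y + Y') p = \<Omega> X Y p + \<Omega> X Y' p"
    "f \<in> Cinf TE \<Longrightarrow> \<Omega> (fmul f X) Y p = f p * \<Omega> X Y p" "f \<in> Cinf TE \<Longrightarrow> \<Omega> X (fmul f Y) p = f p * \<Omega> X Y p"
proof -
  show "\<Omega> (X + X') Y p = \<Omega> X Y p + \<Omega> X' Y p" if X': "X' \<in> G"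
    by (simp add: \<Omega>_eq BT_props(2)[OF X Y X'] lam_add[OF BT_props(1)[OF X Y] BT_props(1)[OF X' Y] p]
        tangent_lam_add[OF ar_props(1)[OF Y p] p X X'])
  show "\<Omega> X (Y + Y') p = \<Omega> X Y p + \<Omega> X Y' p" if Y': "Y' \<in> G"
    using ar_props(2)[OF Y p Y']
    by (simp add: \<Omega>_eq BT_props(3)[OF X Y Y'] lam_add[OF BT_props(1)[OF X Y] BT_props(1)[OF X Y'] p]
        tangent_lam_add[OF G_D(5)[OF X p] p Y Y'])
  show "\<Omega> (fmul f X) Y p = f p * \<Omega> X Y p" if f: "f \<in> Cinf TE"
  proof -
    have "lam (BT (fmul f X) Y) p = f p * lam (BT X Y) p + (- ar p (Y p) f) * lam X p"
      by (rule lam_combination[OF BT_props(1)[OF X Y] X p]) (simp add: BT_Leibniz(1)[OF X Y f p])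
    then show ?thesis
      by (simp add: \<Omega>_eq tangent_lam_fmul[OF ar_props(1)[OF Y p] p X f] fmul_apply scaleR_fun_apply algebra_simps)
  qed
  show "\<Omega> X (fmul f Y) p = f p * \<Omega> X Y p" if f: "f \<in> Cinf TE"
  proof -
    have "lam (BT X (fmul f Y)) p = f p * lam (BT X Y) p + snd (X p) f * lam Y p"
      by (rule lam_combination[OF BT_props(1)[OF X Y] Y p]) (simp add: BT_Leibniz(2)[OF X Y f p])
    then show ?thesis
      by (simp add: \<Omega>_eq tangent_lam_fmul[OF G_D(5)[OF X p] p Y f] ar_props(3)[OF Y p] scaleR_fun_apply algebra_simps)
  qed
qed

lemma BT_generators:
  assumes "s \<in> sections E" "t \<in> sections E" "\<kappa> \<in> sections (dual_bundle E)" "\<nu> \<in> sections (dual_bundle E)"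
  shows "BT (hor s) (hor t) = hor (B s t) + LT_vert (vlift_tensor E (R s t))"
    "BT (hor s) (ver \<nu>) = LT_vert (vlift E (dual_connection E \<rho>l Dl s \<nu>))"
    "BT (ver \<kappa>) (hor t) = - LT_vert (vlift E (dual_connection E \<rho>r Dr t \<kappa>))"
    "BT (ver \<kappa>) (ver \<nu>) = 0"
  using LT assms unfolding LT_algebroid_def by blast+

lemma tangent_lam_hor:
  assumes "v \<in> tangent_space TE p" "p \<in> points TE" "s \<in> sections E"
  shows "v (lam (hor s)) = v (hat s)"
  by (rule T.tangent_cong[OF assms(1,2) lam_Cinf[OF hor_G[OF assms(3)]]])
    (simp add: lam_def hor_apply hat_def split_beta)

lemma tangent_lam_ver:
  assumes "v \<in> tangent_space TE p" "p \<in> points TE" "\<nu> \<in> sections (dual_bundle E)"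
  shows "v (lam (ver \<nu>)) = 0"
  using T.tangent_cong[OF assms(1,2) lam_Cinf[OF ver_G[OF assms(3)]], of "\<lambda>_. 0"] T.tangent_const[OF assms(1), of 0]
  by (simp add: lam_def ver_apply assms(3) dual_space_0[OF point(2) subspace_fibre[OF point(1)]])

text \<open>For two horizontal lifts the three terms are the covector at \<open>Dr t s\<close>, at
  \<open>B s t\<close> and, with a minus sign, at \<open>Dl s t\<close>; they cancel by the relation
  between bracket and connections. In the mixed cases only the derivative of \<open>hat s\<close> or
  \<open>hat t\<close> along the vertical vector survives.\<close>

lemma \<Omega>_generators:
  assumes p: "p \<in> points TE" and s: "s \<in> sections E" and t: "t \<in> sections E"
    and \<kappa>: "\<kappa> \<in> sections (dual_bundle E)" and \<nu>: "\<nu> \<in> sections (dual_bundle E)"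
  shows "\<Omega> (hor s) (hor t) p = 0" "\<Omega> (hor s) (ver \<nu>) p = \<nu> (fst p) (s (fst p))"
    "\<Omega> (ver \<kappa>) (hor t) p = - \<kappa> (fst p) (t (fst p))" "\<Omega> (ver \<kappa>) (ver \<nu>) p = 0"
proof -
  have lv: "lam (LT_vert V) p = 0" "lam (- LT_vert V) p = 0" "lam 0 p = 0" for V
    using dual_space_0[OF point(2)[OF p] subspace_fibre[OF point(1)[OF p]]] by (simp_all add: lam_def LT_vert_def)
  have "lam (hor (B s t) + LT_vert V) p = snd p (B s t (fst p))" for V
    using p by (simp add: lam_def hor_apply LT_vert_def)
  then show "\<Omega> (hor s) (hor t) p = 0"
    unfolding \<Omega>_eq BT_generators(1)[OF s t \<kappa> \<nu>] ar_hor[OF t p] tangent_lam_hor[OF hlift_tangent(2)[OF t p] p s]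
    by (simp add: hor_apply[OF p] tangent_lam_hor[OF hlift_tangent(1)[OF s p] p t]
        hlift_l_hat[OF s p t] hlift_r_hat[OF t p s] snd_B[OF p s t])
  have vt: "vert p (\<nu> (fst p)) \<in> tangent_space TE p" if "\<nu> \<in> sections (dual_bundle E)" for \<nu>
    by (rule vert_tangent[OF p dual_section_in[OF that point(1)[OF p]]])
  show "\<Omega> (hor s) (ver \<nu>) p = \<nu> (fst p) (s (fst p))"
    using hlift_tangent[OF s p]
    by (simp add: \<Omega>_eq BT_generators(2)[OF s t \<kappa> \<nu>] ar_ver[OF \<nu> p] tangent_lam_hor[OF vt p s] \<nu> hor_apply[OF p]
        tangent_lam_ver[OF _ p \<nu>] vert_hat[OF p dual_section_in[OF \<nu> point(1)[OF p]] s] lv)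
  show "\<Omega> (ver \<kappa>) (hor t) p = - \<kappa> (fst p) (t (fst p))"
    using hlift_tangent[OF t p]
    by (simp add: \<Omega>_eq BT_generators(3)[OF s t \<kappa> \<nu>] ar_hor[OF t p] tangent_lam_hor[OF vt p t] \<kappa> ver_apply[OF \<kappa> p]
        tangent_lam_ver[OF _ p \<kappa>] vert_hat[OF p dual_section_in[OF \<kappa> point(1)[OF p]] t] lv)
  show "\<Omega> (ver \<kappa>) (ver \<nu>) p = 0"
    by (simp add: \<Omega>_eq BT_generators(4)[OF s t \<kappa> \<nu>] ar_ver[OF \<nu> p] ver_apply[OF \<kappa> p] vt \<kappa> \<nu>
        tangent_lam_ver[OF vt p] lv)
qed

text \<open>Both sides are linear over functions in \<open>X\<close>, so it suffices to compare them
  on lifts. Vertical lifts thus detect the component of \<open>X\<close> in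
  \<open>E\<close>.\<close>

lemma \<Omega>_ver:
  assumes X: "X \<in> G" and p: "p \<in> points TE" and \<nu>: "\<nu> \<in> sections (dual_bundle E)"
  shows "\<Omega> X (ver \<nu>) p = \<nu> (fst p) (fst (X p))"
proof -
  note \<nu>p = dual_spaceD[OF dual_section_in[OF \<nu> point(1)[OF p]]]
  have 0: "\<nu> (fst p) 0 = 0"
    by (rule dual_space_0[OF dual_section_in[OF \<nu> point(1)[OF p]] subspace_fibre[OF point(1)[OF p]]])
  have "\<Omega> X (ver \<nu>) p - \<nu> (fst p) (fst (X p)) = 0"
  proof (rule functional_eq_0[OF p X])
    show "\<Omega> (X + Y) (ver \<nu>) p - \<nu> (fst p) (fst ((X + Y) p)) =
        \<Omega> X (ver \<nu>) p - \<nu> (fst p) (fst (X p)) + (\<Omega> Y (ver \<nu>) p - \<nu> (fst p) (fst (Y p)))"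
      if "X \<in> G" "Y \<in> G" for X Y
      unfolding \<Omega>_linear(1)[OF that(1) ver_G[OF \<nu>] p that(2)] using that by (simp add: \<nu>p G_D(4)[OF _ p])
    show "\<Omega> (fmul f X) (ver \<nu>) p - \<nu> (fst p) (fst (fmul f X p)) = f p * (\<Omega> X (ver \<nu>) p - \<nu> (fst p) (fst (X p)))"
      if "f \<in> Cinf TE" "X \<in> G" for f X
      unfolding \<Omega>_linear(3)[OF that(2) ver_G[OF \<nu>] p that(1)] fmul_apply
      using that by (simp add: \<nu>p G_D(4)[OF _ p] algebra_simps)
  qed (simp_all add: \<Omega>_generators(2)[OF p _ sections_0 \<nu> \<nu>] \<Omega>_generators(4)[OF p sections_0 sections_0 _ \<nu>]
      hor_apply[OF p] ver_apply[OF _ p] 0)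
  then show ?thesis by simp
qed

text \<open>Both sides are tensorial in \<open>X\<close> and agree on lifts. For a horizontal
  \<open>X\<close> the two terms on the right cancel, so the formula measures on
  \<open>hat t\<close> how far the vector part of \<open>X\<close> is from the left horizontal lift
  of its component in \<open>E\<close>.\<close>

lemma \<Omega>_hor:
  assumes X: "X \<in> G" and p: "p \<in> points TE" and t: "t \<in> sections E"
  shows "\<Omega> X (hor t) p = transpose_at (\<lambda>s. Dl s t) p (fst (X p)) - snd (X p) (hat t)"
proof -
  note tr = transpose_at_dual[OF tensor_Dl[OF t] p]
  have 0: "transpose_at (\<lambda>s. Dl s t) p 0 = 0"
    by (rule dual_space_0[OF tr subspace_fibre[OF point(1)[OF p]]])
  \<comment> \<open>An arbitrary dual section, to instantiate the joint statement about
    generators.\<close>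
  obtain \<nu> where \<nu>: "\<nu> \<in> sections (dual_bundle E)"
    using dual_section_through[OF point[OF p]] by blast
  have "\<Omega> X (hor t) p - (transpose_at (\<lambda>s. Dl s t) p (fst (X p)) - snd (X p) (hat t)) = 0"
  proof (rule functional_eq_0[OF p X])
    show "\<Omega> (hor s) (hor t) p - (transpose_at (\<lambda>s. Dl s t) p (fst (hor s p)) - snd (hor s p) (hat t)) = 0"
      if s: "s \<in> sections E" for s
      by (simp add: \<Omega>_generators(1)[OF p s t \<nu> \<nu>] hor_apply[OF p] transpose_at[OF tensor_Dl[OF t] p s] hlift_l_hat[OF s p t])
    show "\<Omega> (ver \<kappa>) (hor t) p - (transpose_at (\<lambda>s. Dl s t) p (fst (ver \<kappa> p)) - snd (ver \<kappa> p) (hat t)) = 0"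
      if \<kappa>: "\<kappa> \<in> sections (dual_bundle E)" for \<kappa>
      by (simp add: \<Omega>_generators(3)[OF p t t \<kappa> \<nu>] ver_apply[OF \<kappa> p] 0 vert_hat[OF p dual_section_in[OF \<kappa> point(1)[OF p]] t])
    show "\<Omega> (X + Y) (hor t) p - (transpose_at (\<lambda>s. Dl s t) p (fst ((X + Y) p)) - snd ((X + Y) p) (hat t)) =
        \<Omega> X (hor t) p - (transpose_at (\<lambda>s. Dl s t) p (fst (X p)) - snd (X p) (hat t)) +
        (\<Omega> Y (hor t) p - (transpose_at (\<lambda>s. Dl s t) p (fst (Y p)) - snd (Y p) (hat t)))"
      if "X \<in> G" "Y \<in> G" for X Y
      unfolding \<Omega>_linear(1)[OF that(1) hor_G[OF t] p that(2)] using that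
      by (simp add: dual_spaceD[OF tr] G_D(4)[OF _ p])
    show "\<Omega> (fmul f X) (hor t) p - (transpose_at (\<lambda>s. Dl s t) p (fst (fmul f X p)) - snd (fmul f X p) (hat t)) =
        f p * (\<Omega> X (hor t) p - (transpose_at (\<lambda>s. Dl s t) p (fst (X p)) - snd (X p) (hat t)))"
      if "f \<in> Cinf TE" "X \<in> G" for f X
      unfolding \<Omega>_linear(3)[OF that(2) hor_G[OF t] p that(1)] fmul_apply
      using that by (simp add: dual_spaceD[OF tr] G_D(4)[OF _ p] scaleR_fun_apply algebra_simps)
  qed
  then show ?thesis by simp
qed


section \<open>Hamiltonian vector fields\<close>

context
  fixes H assumes H: "H \<in> Cinf TE"
begin

abbreviation "HP \<equiv> tensor_hamiltonian_field TE P H"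

definition XH :: "'q \<times> ('e \<Rightarrow> real) \<Rightarrow> ('q, 'e) lt_vec" where
  "XH = (\<lambda>p. (fibre_deriv H p, HP p))"

text \<open>The bracket at \<open>p\<close> depends on \<open>H\<close> only through its
  differential at \<open>p\<close>, which is replaced by that of
  \<open>f \<circ> fst + hat s\<close>; the defining equations of the tensor then give explicit
  values. Since \<open>f\<close> and \<open>s\<close> vary with \<open>p\<close>, this is used only
  pointwise.\<close>

lemma split_at:
  assumes p: "p \<in> points TE"
  obtains f s where "f \<in> Cinf (base E)" "s \<in> sections E" "fibre_deriv H p = s (fst p)"
    "\<And>v. v \<in> tangent_space TE p \<Longrightarrow> v H = v (\<lambda>p. f (fst p)) + v (hat s)"
    "\<And>g. g \<in> Cinf (base E) \<Longrightarrow> HP p (\<lambda>p. g (fst p)) = \<rho>l (fst p) (s (fst p)) g"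
    "\<And>t. t \<in> sections E \<Longrightarrow> HP p (hat t) = snd p (B s t (fst p)) - \<rho>r (fst p) (t (fst p)) f"
proof -
  obtain f s where f: "f \<in> Cinf (base E)" and s: "s \<in> sections E"
    and fs: "\<And>v. v \<in> tangent_space TE p \<Longrightarrow> v H = v (\<lambda>p. f (fst p)) + v (hat s)"
    using differential_split[OF p H] by blast
  have "differential TE H p = differential TE (\<lambda>p. f (fst p)) p + differential TE (hat s) p"
    using fs by (simp add: differential_def fun_eq_iff)
  then have HP: "HP p F = - (tensor_bracket TE P (\<lambda>p. f (fst p)) F p + tensor_bracket TE P (hat s) F p)"
    if F: "F \<in> Cinf TE" for F
    using p F T.differential_dual[OF comp_fst_Cinf[OF f]] T.differential_dual[OF hat_Cinf[OF s]] T.differential_dual[OF F]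
    by (simp add: tensor_hamiltonian_field_def tensor_bracket_def T.tensor_2_0D[OF P_tensor p])
  show ?thesis
    by (rule that[OF f s fibre_deriv_split[OF p H f s fs] fs])
      (simp_all add: HP comp_fst_Cinf hat_Cinf bracket_fst_fst bracket_hat_fst bracket_fst_hat bracket_hat_hat f s p)
qed

text \<open>The fibre condition holds because the projection of \<open>HP p\<close> to the base is
  the left anchor of \<open>s (fst p)\<close>, which is the fibre derivative.\<close>

lemma XH_G: "XH \<in> G"
proof -
  have "XH p \<in> LT_fibre E \<rho>l p" if p: "p \<in> points TE" for p
  proof -
    obtain f s where "fibre_deriv H p = s (fst p)"
      "\<And>g. g \<in> Cinf (base E) \<Longrightarrow> HP p (\<lambda>p. g (fst p)) = \<rho>l (fst p) (s (fst p)) g"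
      using split_at[OF p] by metis
    then show ?thesis
      using fibre_deriv_in[OF p H] T.vector_fieldD(1)[OF T.tensor_hamiltonian_field_vector_field[OF P_tensor H] p]
      by (simp add: XH_def LT_fibre_iff[OF p])
  qed
  moreover have "fst \<circ> XH = fibre_deriv H" "snd \<circ> XH = HP" by (simp_all add: XH_def fun_eq_iff)
  ultimately show ?thesis
    using fibre_deriv_section[OF H] T.tensor_hamiltonian_field_vector_field[OF P_tensor H]
    by (simp add: LT_sections_def)
qed

text \<open>Both sides are tensorial in \<open>Y\<close>. On a horizontal lift of \<open>t\<close>
  the left side is the covector at \<open>Dl s t - B s t = Dr t s\<close> plus
  \<open>\<rho>r (t) f\<close>, which is the right horizontal lift of \<open>t\<close> applied to
  \<open>f \<circ> fst + hat s\<close>. On vertical lifts both sides are the covector at the fibre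
  derivative.\<close>

lemma \<Omega>_XH:
  assumes Y: "Y \<in> G" and p: "p \<in> points TE"
  shows "\<Omega> XH Y p = ar p (Y p) H"
proof -
  have "\<Omega> XH Y p - ar p (Y p) H = 0"
  proof (rule functional_eq_0[OF p Y])
    show "\<Omega> XH (hor t) p - ar p (hor t p) H = 0" if t: "t \<in> sections E" for t
    proof -
      obtain f s where fs: "f \<in> Cinf (base E)" "s \<in> sections E" "fibre_deriv H p = s (fst p)"
        "\<And>v. v \<in> tangent_space TE p \<Longrightarrow> v H = v (\<lambda>p. f (fst p)) + v (hat s)"
        "\<And>g. g \<in> Cinf (base E) \<Longrightarrow> HP p (\<lambda>p. g (fst p)) = \<rho>l (fst p) (s (fst p)) g"
        "\<And>t. t \<in> sections E \<Longrightarrow> HP p (hat t) = snd p (B s t (fst p)) - \<rho>r (fst p) (t (fst p)) f"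
        using split_at[OF p] by blast
      have "\<Omega> XH (hor t) p = snd p (Dr t s (fst p)) + \<rho>r (fst p) (t (fst p)) f"
        by (simp add: \<Omega>_hor[OF XH_G p t]) (simp add: XH_def fs(3,6) t transpose_at[OF tensor_Dl[OF t] p fs(2)] snd_B[OF p fs(2) t])
      moreover have "ar p (hor t p) H = snd p (Dr t s (fst p)) + \<rho>r (fst p) (t (fst p)) f"
        by (simp add: ar_hor[OF t p] fs(4)[OF hlift_tangent(2)[OF t p]] hlift_r_fst[OF t p fs(1)] hlift_r_hat[OF t p fs(2)])
      ultimately show ?thesis by simp
    qed
    show "\<Omega> XH (ver \<nu>) p - ar p (ver \<nu> p) H = 0" if \<nu>: "\<nu> \<in> sections (dual_bundle E)" for \<nu>
      by (simp add: \<Omega>_ver[OF XH_G p \<nu>] ar_ver[OF \<nu> p] vert_fibre_deriv[OF p H dual_section_in[OF \<nu> point(1)[OF p]]])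
        (simp add: XH_def)
  qed (simp_all add: \<Omega>_linear[OF XH_G _ p] ar_props(2)[OF _ p] ar_props(3)[OF _ p] G_fmul scaleR_fun_apply algebra_simps
        del: plus_fun_apply, simp_all)
  then show ?thesis by simp
qed

text \<open>Nondegeneracy in two stages: pairing with vertical lifts determines the component in
  \<open>E\<close>, and with it the vector part on base functions. Pairing with horizontal lifts
  then determines the vector part on the functions \<open>hat t\<close>.\<close>

lemma XH_unique:
  assumes X: "X \<in> G" and eq: "\<And>Y p. Y \<in> G \<Longrightarrow> p \<in> points TE \<Longrightarrow> \<Omega> X Y p = ar p (Y p) H"
  shows "X = XH"
proof
  fix p
  show "X p = XH p"
  proof (cases "p \<in> points TE")
    case False
    then show ?thesis by (simp add: G_D(7)[OF X] G_D(7)[OF XH_G])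
  next
    case p: True
    have 1: "fst (X p) = fst (XH p)"
    proof (rule dual_space_separates[OF point(1)[OF p] G_D(4)[OF X p] G_D(4)[OF XH_G p]])
      fix \<alpha> assume "\<alpha> \<in> dual_space (fibre E (fst p))"
      then obtain \<nu> where \<nu>: "\<nu> \<in> sections (dual_bundle E)" "\<nu> (fst p) = \<alpha>"
        using dual_section_through[OF point(1)[OF p]] by blast
      have "\<Omega> X (ver \<nu>) p = \<Omega> XH (ver \<nu>) p" by (simp add: eq \<Omega>_XH ver_G \<nu> p)
      then show "\<alpha> (fst (X p)) = \<alpha> (fst (XH p))" by (simp add: \<Omega>_ver[OF X p \<nu>(1)] \<Omega>_ver[OF XH_G p \<nu>(1)] \<nu>(2))
    qed
    have "snd (X p) = snd (XH p)"
    proof (rule tangent_eqI[OF p G_D(5)[OF X p] G_D(5)[OF XH_G p]])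
      show "snd (X p) (\<lambda>p. f (fst p)) = snd (XH p) (\<lambda>p. f (fst p))" if "f \<in> Cinf (base E)" for f
        by (simp add: G_D(6)[OF X p that] G_D(6)[OF XH_G p that] 1)
      fix t assume t: "t \<in> sections E"
      have "\<Omega> X (hor t) p = \<Omega> XH (hor t) p" by (simp add: eq \<Omega>_XH hor_G t p)
      then show "snd (X p) (hat t) = snd (XH p) (hat t)" by (simp add: \<Omega>_hor[OF X p t] \<Omega>_hor[OF XH_G p t] 1)
    qed
    with 1 show ?thesis by (rule prod_eqI)
  qed
qed

lemma lr_hamiltonian_field_eq: "lr_hamiltonian_field TE G \<Omega> LT_anchor_l ar H = HP"
proof -
  have "right_hamiltonian_section TE G \<Omega> ar H = XH"
    unfolding right_hamiltonian_section_def d_r_def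
    by (rule the_equality) (use XH_G \<Omega>_XH XH_unique in blast)+
  then show ?thesis
    by (auto simp: lr_hamiltonian_field_def apply_anchor_def LT_anchor_l_eq XH_def fun_eq_iff tensor_hamiltonian_field_def)
qed

end

end

theorem theorem4p3:
  fixes E :: "('q, 'b::fd_inner, 'e::real_vector, 'c::fd_inner) vbundle"
    and B Dl Dr :: "('q \<Rightarrow> 'e) \<Rightarrow> ('q \<Rightarrow> 'e) \<Rightarrow> 'q \<Rightarrow> 'e"
    and \<rho>l \<rho>r :: "'q \<Rightarrow> 'e \<Rightarrow> 'q tvec"
    and R :: "('q \<Rightarrow> 'e) \<Rightarrow> ('q \<Rightarrow> 'e) \<Rightarrow> ('q \<Rightarrow> 'e) \<Rightarrow> 'q \<Rightarrow> 'e"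
    and BT :: "('q \<times> ('e \<Rightarrow> real) \<Rightarrow> ('q, 'e) lt_vec) \<Rightarrow> ('q \<times> ('e \<Rightarrow> real) \<Rightarrow> ('q, 'e) lt_vec) \<Rightarrow>
               'q \<times> ('e \<Rightarrow> real) \<Rightarrow> ('q, 'e) lt_vec"
    and P :: "'q \<times> ('e \<Rightarrow> real) \<Rightarrow> (('q \<times> ('e \<Rightarrow> real)) tvec \<Rightarrow> real) \<Rightarrow>
              (('q \<times> ('e \<Rightarrow> real)) tvec \<Rightarrow> real) \<Rightarrow> real"
    and H :: "'q \<times> ('e \<Rightarrow> real) \<Rightarrow> real"
  assumes "vector_bundle E"
    and "algebroid_on E B \<rho>l \<rho>r"
    and "connection E \<rho>l Dl"
    and "connection E \<rho>r Dr"
    and "\<And>s t. s \<in> sections E \<Longrightarrow> t \<in> sections E \<Longrightarrow> B s t = Dl s t - Dr t s"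
    and "tensor_1_3 E R"
    and "LT_algebroid E B \<rho>l \<rho>r Dl Dr R BT"
    and "Pi_tensor E B \<rho>l \<rho>r P"
    and "H \<in> Cinf (dual_total E)"
  shows "lr_hamiltonian_field (dual_total E) (LT_sections E \<rho>l) (LT_Omega E \<rho>l \<rho>r Dl Dr BT)
           LT_anchor_l (LT_anchor_r E \<rho>l \<rho>r Dl Dr) H =
         tensor_hamiltonian_field (dual_total E) P H"
proof -
  interpret left_tangent_bundle E B Dl Dr \<rho>l \<rho>r R BT P
    by unfold_locales (use assms in auto)
  show ?thesis by (rule lr_hamiltonian_field_eq[OF assms(9)])
qed

end
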